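(* Let $\alpha,\delta\in\mathbb R$. (a) Let $(X_t)_{t\ge0}$ be an additive $(\alpha,\delta)$-dilatively stable process. Then its Lamperti-type transform $(V_t=e^{-(\alpha-\delta/2)t}X_{e^t})_{t\in\mathbb R}$ is a $\delta$-translatively stable wide-sense OU-type process with parameter $\lambda=\delta/2-\alpha$ and driving process $(Y_t)_{t\in\mathbb R}$ given by $Y_t=\int_1^{e^t}u^{-\alpha+\delta/2}\,dX_u$. (b) Let $(V_t)_{t\in\mathbb R}$ be a $\delta$-translatively stable wide-sense OU-type process with parameter $\lambda=\delta/2-\alpha$ and driving process $(Y_t)_{t\in\mathbb R}=\big(L(\tfrac{e^{\delta t}-1}{e^\delta-1})\big)_{t\in\mathbb R}$, where $(L(t))_{t\in\mathbb R}$ is a two-sided Lévy process. If $e^{(\alpha-\delta/2)t}V_t\to0$ in probability as $t\downarrow-\infty$, then the inverse Lamperti-type transform $(X_t=t^{\alpha-\delta/2}V_{\log t})_{t\ge0}$ (with $X_0:=0$) is an additive $(\alpha,\delta)$-dilatively stable process.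
   Context: All processes are real-valued. Let $\mathbb T$ be $\mathbb R$ or $\mathbb R_+=[0,\infty)$. An additive process $(X_t)_{t\in\mathbb T}$ is a process such that: (i) it has independent increments, i.e. for any $t_0<t_1<\dots<t_n$ in $\mathbb T$ the increments $X_{t_1}-X_{t_0},\dots,X_{t_n}-X_{t_{n-1}}$ are independent; (ii) it is stochastically continuous; (iii) almost surely its paths are right-continuous with left limits (càdlàg); (iv) $X_0=0$ almost surely. A process is infinitely divisible if all its finite-dimensional distributions are. For an infinitely divisible process $X$, $\Psi^X_{t_1,\dots,t_k}:\mathbb R^k\to\mathbb C$ denotes the log-characteristic function (Lévy exponent) of $(X_{t_1},\dots,X_{t_k})$, i.e. the unique continuous function with $\Psi^X_{t_1,\dots,t_k}(0,\dots,0)=0$ and $\mathbb E[\exp(i\sum_j\theta_jX_{t_j})]=\exp(\Psi^X_{t_1,\dots,t_k}(\theta_1,\dots,\theta_k))$. An infinitely divisible process $(X_t)_{t\ge0}$ is $(\alpha,\delta)$-dilatively stable if $\Psi^X_{Tt_1,\dots,Tt_k}(\theta_1,\dots,\theta_k)=T^{\delta}\,\Psi^X_{t_1,\dots,t_k}(T^{\alpha-\delta/2}\theta_1,\dots,T^{\alpha-\delta/2}\theta_k)$ for all $T>0$, $k\in\mathbb N$, $t_1,\dots,t_k\ge0$, $\theta_1,\dots,\theta_k\in\mathbb R$. An infinitely divisible process $(V_t)_{t\in\mathbb R}$ is $\delta$-translatively stable if $\Psi^V_{t_1+T,\dots,t_k+T}(\theta_1,\dots,\theta_k)=e^{\delta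 T}\Psi^V_{t_1,\dots,t_k}(\theta_1,\dots,\theta_k)$ for all $T\in\mathbb R$, $k\in\mathbb N$, $t_1,\dots,t_k,\theta_1,\dots,\theta_k\in\mathbb R$. Random integral: for a process $Y$ with càdlàg paths, a continuously differentiable function $A$ and $a<b$, $\int_a^bA(t)\,dY_t:=A(b)Y_b-A(a)Y_a-\int_a^bA'(t)Y_t\,dt$ (pathwise Riemann integral), and $\int_b^aA(t)\,dY_t:=-\int_a^bA(t)\,dY_t$. For an additive process $(Y_t)_{t\in\mathbb R}$, a process $(U_t)_{t\in\mathbb R}$ is called a wide-sense OU-type process with parameter $\lambda\in\mathbb R$ and (background) driving process $Y$ if $U_t=e^{\lambda t}\big(U_0+\int_0^te^{-\lambda s}\,dY_s\big)$ for all $t\in\mathbb R$. Two-sided Lévy process generated by the law of an infinitely divisible random variable: $L(t)=L^{(1)}(t)$ for $t\ge0$ and $L(t)=-L^{(2)}((-t)-)$ for $t<0$ (left limit at $-t$), where $L^{(1)},L^{(2)}$ are independent copies of the (càdlàg) Lévy process whose value at time $1$ has that law. For $\delta=0$ the time change $\frac{e^{\delta t}-1}{e^\delta-1}$ is understood as its limit $t$. *)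

theory Defs
  imports "HOL-Probability.Probability"
begin

definition process :: "'a measure \<Rightarrow> real set \<Rightarrow> (real \<Rightarrow> 'a \<Rightarrow> real) \<Rightarrow> bool" where
  "process M T X \<longleftrightarrow> (\<forall>t\<in>T. X t \<in> borel_measurable M)"

definition tendsto_in_prob ::
    "'a measure \<Rightarrow> ('i \<Rightarrow> 'a \<Rightarrow> real) \<Rightarrow> ('a \<Rightarrow> real) \<Rightarrow> 'i filter \<Rightarrow> bool" where
  "tendsto_in_prob M X Z F \<longleftrightarrow>
     (\<forall>\<epsilon>>0. ((\<lambda>s. measure M {\<omega> \<in> space M. \<bar>X s \<omega> - Z \<omega>\<bar> > \<epsilon>}) \<longlongrightarrow> 0) F)"

definition cadlag_on :: "real set \<Rightarrow> (real \<Rightarrow> real) \<Rightarrow> bool" where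
  "cadlag_on T y \<longleftrightarrow>
     (\<forall>t\<in>T. (y \<longlongrightarrow> y t) (at t within T \<inter> {t<..}) \<and>
            (\<exists>l. (y \<longlongrightarrow> l) (at t within T \<inter> {..<t})))"

definition independent_increments ::
    "'a measure \<Rightarrow> real set \<Rightarrow> (real \<Rightarrow> 'a \<Rightarrow> real) \<Rightarrow> bool" where
  "independent_increments M T X \<longleftrightarrow>
     (\<forall>n (t :: nat \<Rightarrow> real). (\<forall>i\<le>n. t i \<in> T) \<and> (\<forall>i<n. t i < t (Suc i)) \<longrightarrow>
        prob_space.indep_vars M (\<lambda>_. borel) (\<lambda>i \<omega>. X (t (Suc i)) \<omega> - X (t i) \<omega>) {..<n})"

definition additive_process :: "'a measure \<Rightarrow> real set \<Rightarrow> (real \<Rightarrow> 'a \<Rightarrow> real) \<Rightarrow> bool" where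
  "additive_process M T X \<longleftrightarrow>
     process M T X \<and>
     independent_increments M T X \<and>
     (\<forall>t\<in>T. tendsto_in_prob M X (X t) (at t within T)) \<and>
     (AE \<omega> in M. cadlag_on T (\<lambda>t. X t \<omega>)) \<and>
     (AE \<omega> in M. X 0 \<omega> = 0)"

text \<open>The space \<open>\<real>\<^sup>k\<close> is represented by the extensional functions on \<open>{..<k}\<close>, i.e. by the
  space of \<open>PiM {..<k} (\<lambda>_. borel)\<close>; its topology is the product topology. A tuple of
  times is a function \<open>t :: nat \<Rightarrow> real\<close> of which only \<open>t 0, \<dots>, t (k - 1)\<close> matter.\<close>

abbreviation rvec :: "nat \<Rightarrow> (nat \<Rightarrow> real) set" where
  "rvec k \<equiv> {..<k} \<rightarrow>\<^sub>E UNIV"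

abbreviation borel_vec :: "nat \<Rightarrow> (nat \<Rightarrow> real) measure" where
  "borel_vec k \<equiv> PiM {..<k} (\<lambda>_. borel :: real measure)"

definition fin_dim_law ::
    "'a measure \<Rightarrow> (real \<Rightarrow> 'a \<Rightarrow> real) \<Rightarrow> nat \<Rightarrow> (nat \<Rightarrow> real) \<Rightarrow> (nat \<Rightarrow> real) measure" where
  "fin_dim_law M X k t = distr M (borel_vec k) (\<lambda>\<omega>. \<lambda>j\<in>{..<k}. X (t j) \<omega>)"

text \<open>For every \<open>n \<ge> 1\<close>, \<open>\<mu>\<close> is the law of a sum of \<open>n\<close> i.i.d. random vectors, i.e. the
  \<open>n\<close>-fold convolution power of some probability measure \<open>\<nu>\<close> on \<open>\<real>\<^sup>k\<close>.\<close>

definition infinitely_divisible_law :: "nat \<Rightarrow> (nat \<Rightarrow> real) measure \<Rightarrow> bool" where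
  "infinitely_divisible_law k \<mu> \<longleftrightarrow>
     (\<forall>n::nat. n \<ge> 1 \<longrightarrow> (\<exists>\<nu>. prob_space \<nu> \<and> sets \<nu> = sets (borel_vec k) \<and>
        \<mu> = distr (PiM {..<n} (\<lambda>_. \<nu>)) (borel_vec k) (\<lambda>x. \<lambda>j\<in>{..<k}. \<Sum>i<n. x i j)))"

definition infinitely_divisible_process ::
    "'a measure \<Rightarrow> real set \<Rightarrow> (real \<Rightarrow> 'a \<Rightarrow> real) \<Rightarrow> bool" where
  "infinitely_divisible_process M T X \<longleftrightarrow>
     process M T X \<and>
     (\<forall>k t. (\<forall>j<k. t j \<in> T) \<longrightarrow> infinitely_divisible_law k (fin_dim_law M X k t))"

text \<open>The condition \<open>\<Psi> \<in> extensional (rvec k)\<close> only fixes the values of \<open>\<Psi>\<close> outside \<open>\<real>\<^sup>k\<close>, so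
  that the description is unique. Existence holds for infinitely divisible laws, and the
  exponent is only used for infinitely divisible processes.\<close>

definition levy_exponent ::
    "'a measure \<Rightarrow> (real \<Rightarrow> 'a \<Rightarrow> real) \<Rightarrow> nat \<Rightarrow> (nat \<Rightarrow> real) \<Rightarrow> (nat \<Rightarrow> real) \<Rightarrow> complex" where
  "levy_exponent M X k t =
     (THE \<Psi>. \<Psi> \<in> extensional (rvec k) \<and>
        continuous_on (rvec k) \<Psi> \<and>
        \<Psi> (\<lambda>j\<in>{..<k}. 0) = 0 \<and>
        (\<forall>\<theta>\<in>rvec k. (CLINT \<omega>|M. iexp (\<Sum>j<k. \<theta> j * X (t j) \<omega>)) = exp (\<Psi> \<theta>)))"

definition dilatively_stable :: "'a measure \<Rightarrow> real \<Rightarrow> real \<Rightarrow> (real \<Rightarrow> 'a \<Rightarrow> real) \<Rightarrow> bool" where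
  "dilatively_stable M \<alpha> \<delta> X \<longleftrightarrow>
     infinitely_divisible_process M {0..} X \<and>
     (\<forall>T>0. \<forall>k t. \<forall>\<theta>\<in>rvec k. (\<forall>j<k. t j \<ge> 0) \<longrightarrow>
        levy_exponent M X k (\<lambda>j. T * t j) \<theta> =
          complex_of_real (T powr \<delta>) *
          levy_exponent M X k t (\<lambda>j\<in>{..<k}. T powr (\<alpha> - \<delta> / 2) * \<theta> j))"

definition translatively_stable :: "'a measure \<Rightarrow> real \<Rightarrow> (real \<Rightarrow> 'a \<Rightarrow> real) \<Rightarrow> bool" where
  "translatively_stable M \<delta> V \<longleftrightarrow>
     infinitely_divisible_process M UNIV V \<and>
     (\<forall>T k t. \<forall>\<theta>\<in>rvec k.
        levy_exponent M V k (\<lambda>j. t j + T) \<theta> =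
          complex_of_real (exp (\<delta> * T)) * levy_exponent M V k t \<theta>)"

text \<open>The pathwise integral of \<open>A\<close> with respect to the path \<open>y\<close> from \<open>a\<close> to \<open>b\<close>. For cadlag
  \<open>y\<close> and continuously differentiable \<open>A\<close> the integrand is Riemann integrable, so the
  Henstock--Kurzweil integral used here is the Riemann integral.\<close>

definition path_integral :: "(real \<Rightarrow> real) \<Rightarrow> (real \<Rightarrow> real) \<Rightarrow> real \<Rightarrow> real \<Rightarrow> real" where
  "path_integral A y a b =
     (let J = (\<lambda>a b. A b * y b - A a * y a - integral {a..b} (\<lambda>t. deriv A t * y t))
      in if a \<le> b then J a b else - J b a)"

text \<open>Paths are cadlag only almost surely, so a family \<open>Z\<close> defined path by path through
  integrals or left limits is meaningful only off a null set, and need not be measurable on it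
  (\<open>M\<close> is not assumed complete). The process given by such a \<open>Z\<close> is therefore any process
  whose paths coincide with those of \<open>Z\<close> almost surely; it is determined up to
  indistinguishability.\<close>

definition process_given_by ::
    "'a measure \<Rightarrow> (real \<Rightarrow> 'a \<Rightarrow> real) \<Rightarrow> (real \<Rightarrow> 'a \<Rightarrow> real) \<Rightarrow> bool" where
  "process_given_by M Y Z \<longleftrightarrow> process M UNIV Y \<and> (AE \<omega> in M. \<forall>t. Y t \<omega> = Z t \<omega>)"

definition wide_sense_OU ::
    "'a measure \<Rightarrow> real \<Rightarrow> (real \<Rightarrow> 'a \<Rightarrow> real) \<Rightarrow> (real \<Rightarrow> 'a \<Rightarrow> real) \<Rightarrow> bool" where
  "wide_sense_OU M \<kappa> Y U \<longleftrightarrow>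
     additive_process M UNIV Y \<and>
     process M UNIV U \<and>
     (AE \<omega> in M. \<forall>t. U t \<omega> =
        exp (\<kappa> * t) * (U 0 \<omega> + path_integral (\<lambda>s. exp (- \<kappa> * s)) (\<lambda>s. Y s \<omega>) 0 t))"

definition levy_process :: "'a measure \<Rightarrow> (real \<Rightarrow> 'a \<Rightarrow> real) \<Rightarrow> bool" where
  "levy_process M L \<longleftrightarrow>
     additive_process M {0..} L \<and>
     (\<forall>s\<ge>0. \<forall>h\<ge>0. distr M borel (\<lambda>\<omega>. L (s + h) \<omega> - L s \<omega>) = distr M borel (L h))"

text \<open>The generating law is the common law of \<open>L1 1\<close> and \<open>L2 1\<close>, which determines the laws of
  the Levy processes \<open>L1\<close> and \<open>L2\<close>; it is automatically infinitely divisible.\<close>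

definition two_sided_levy_process :: "'a measure \<Rightarrow> (real \<Rightarrow> 'a \<Rightarrow> real) \<Rightarrow> bool" where
  "two_sided_levy_process M L \<longleftrightarrow>
     (\<exists>L1 L2. levy_process M L1 \<and> levy_process M L2 \<and>
        distr M borel (L1 1) = distr M borel (L2 1) \<and>
        prob_space.indep_var M
          (PiM {0..} (\<lambda>_. borel)) (\<lambda>\<omega>. \<lambda>t\<in>{0..}. L1 t \<omega>)
          (PiM {0..} (\<lambda>_. borel)) (\<lambda>\<omega>. \<lambda>t\<in>{0..}. L2 t \<omega>) \<and>
        process_given_by M L
          (\<lambda>t \<omega>. if t \<ge> 0 then L1 t \<omega> else - Lim (at_left (- t)) (\<lambda>s. L2 s \<omega>)))"

definition time_change :: "real \<Rightarrow> real \<Rightarrow> real" where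
  "time_change \<delta> t = (if \<delta> = 0 then t else (exp (\<delta> * t) - 1) / (exp \<delta> - 1))"

definition lamperti :: "real \<Rightarrow> real \<Rightarrow> (real \<Rightarrow> 'a \<Rightarrow> real) \<Rightarrow> real \<Rightarrow> 'a \<Rightarrow> real" where
  "lamperti \<alpha> \<delta> X t \<omega> = exp (- (\<alpha> - \<delta> / 2) * t) * X (exp t) \<omega>"

definition inverse_lamperti :: "real \<Rightarrow> real \<Rightarrow> (real \<Rightarrow> 'a \<Rightarrow> real) \<Rightarrow> real \<Rightarrow> 'a \<Rightarrow> real" where
  "inverse_lamperti \<alpha> \<delta> V t \<omega> = (if t = 0 then 0 else t powr (\<alpha> - \<delta> / 2) * V (ln t) \<omega>)"

end

theory Submission
  imports Defs
begin

text \<open>Substituting \<open>u = e\<^sup>s\<close> turns the driving process of (a) into the pathwise integral of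
  \<open>exp (- (\<alpha> - \<delta> / 2) s)\<close> against \<open>W s = X (exp s)\<close>, and in (b) the process
  \<open>exp ((\<alpha> - \<delta> / 2) t) V t\<close> is, up to the summand \<open>V 0\<close>, the pathwise integral of
  \<open>exp ((\<alpha> - \<delta> / 2) s)\<close> against the driving process. Such an integral inherits cadlag paths
  and stochastic continuity from its integrator, and its increments are almost sure limits of
  Stieltjes sums, so that they are again independent. Integrating \<open>exp (- a s)\<close> and then
  \<open>exp (a s)\<close> gives back the increments of the integrator, which is the OU equation of (a).

  At the time point \<open>0\<close> of (b), convergence in probability is upgraded to almost sure
  convergence by Ottaviani's maximal inequality.

  The two stability properties are exchanged by a diagonal rescaling of the characteristic
  functions. This transfers to the Levy exponents because these exist and are unique:
  characteristic functions of infinitely divisible laws have no zeros and \<open>\<real>\<^sup>k\<close> is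
  contractible.\<close>

section \<open>Cadlag paths and pathwise integrals\<close>

text \<open>Three obstacles shape the proof. First, nothing is known about the joint law of
  \<open>V 0\<close> and the driving process in (b). But \<open>V 0\<close> is a summand of
  \<open>exp (c * t) * V t\<close>, with \<open>c = \<alpha> - \<delta> / 2\<close>, that does not
  depend on time and cancels from every increment; increments starting at time 0 are limits of
  increments starting at small positive times. Secondly, cadlag paths may jump, so their
  antiderivatives are in general differentiable only from the right; iterated integrals are
  therefore identified by comparing continuous functions with equal right derivatives. Thirdly,
  convergence in probability at time 0 says nothing about single paths there; independence of the
  increments is what bounds a whole path on \<open>(0, t]\<close> through the one variable
  \<open>X t\<close>.

  On the side of stability the defining equations hold between logarithms, which the characteristic
  functions fix only up to multiples of \<open>2 * pi * \<i>\<close>. Hence continuity along rays is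
  used for uniqueness, and existence is needed at every tuple of times, since otherwise the definite
  description has no known value.\<close>

lemma cadlag_on_UNIV_iff:
  "cadlag_on UNIV y \<longleftrightarrow> (\<forall>t. (y \<longlongrightarrow> y t) (at_right t) \<and> (\<exists>l. (y \<longlongrightarrow> l) (at_left t)))"
  by (simp add: cadlag_on_def)

text \<open>One-sided limits bound a cadlag path near every point, and bisection glues the local
  bounds. The result supplies dominating constants for the integrands below.\<close>

lemma cadlag_on_UNIV_bounded:
  assumes "cadlag_on UNIV y"
  obtains B where "B \<ge> 0" "\<And>t. t \<in> {a..b} \<Longrightarrow> \<bar>y t\<bar> \<le> B"
proof (cases "a \<le> b")
  case True
  have "\<exists>B. \<forall>t\<in>{a..b}. \<bar>y t\<bar> \<le> B"
    using True
  proof (induction rule: Bolzano)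
    case (trans a b c)
    then obtain B1 B2 where "\<forall>t\<in>{a..b}. \<bar>y t\<bar> \<le> B1" "\<forall>t\<in>{b..c}. \<bar>y t\<bar> \<le> B2" by auto
    then have "\<forall>t\<in>{a..c}. \<bar>y t\<bar> \<le> max B1 B2"
      by (metis atLeastAtMost_iff le_max_iff_disj linear)
    then show ?case by blast
  next
    case (local x)
    obtain l where l: "(y \<longlongrightarrow> l) (at_left x)" and r: "(y \<longlongrightarrow> y x) (at_right x)"
      using assms by (auto simp: cadlag_on_UNIV_iff)
    have "\<forall>\<^sub>F t in at_left x. dist (y t) l < 1"
      using l by (rule tendstoD) simp
    then obtain e1 where e1: "e1 < x" "\<And>t. e1 < t \<Longrightarrow> t < x \<Longrightarrow> dist (y t) l < 1"
      unfolding eventually_at_left_field by blast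
    have "\<forall>\<^sub>F t in at_right x. dist (y t) (y x) < 1"
      using r by (rule tendstoD) simp
    then obtain e2 where e2: "e2 > x" "\<And>t. x < t \<Longrightarrow> t < e2 \<Longrightarrow> dist (y t) (y x) < 1"
      unfolding eventually_at_right_field by blast
    define d where "d = min (x - e1) (e2 - x)"
    have "\<bar>y t\<bar> \<le> \<bar>l\<bar> + \<bar>y x\<bar> + 1" if "a \<le> x" "x \<le> b" "b - a < d" "t \<in> {a..b}" for a b t
    proof -
      consider "t < x" | "t = x" | "x < t" by linarith
      then show ?thesis
      proof cases
        case 1
        then have "dist (y t) l < 1" using that by (intro e1) (auto simp: d_def)
        then show ?thesis by (auto simp: dist_real_def)
      next
        case 3
        then have "dist (y t) (y x) < 1" using that by (intro e2) (auto simp: d_def)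
        then show ?thesis by (auto simp: dist_real_def)
      qed auto
    qed
    moreover have "d > 0" using e1 e2 by (auto simp: d_def)
    ultimately show ?case by blast
  qed
  then obtain B where "\<And>t. t \<in> {a..b} \<Longrightarrow> \<bar>y t\<bar> \<le> B" by blast
  then show ?thesis using that[of "max B 0"] by (simp add: le_max_iff_disj)
next
  case False
  then show ?thesis using that[of 0] by simp
qed

text \<open>A mean value argument from one-sided information: for a slope \<open>e > 0\<close> let
  \<open>s\<close> be the infimum of the points violating
  \<open>\<bar>f x - f a\<bar> \<le> e * (x - a)\<close>. Continuity gives the bound at
  \<open>s\<close>, and the right derivative extends it beyond \<open>s\<close>, which contradicts
  the choice of \<open>s\<close>. Then \<open>e\<close> tends to 0.\<close>

lemma right_derivative_zero_imp_eq:
  fixes f :: "real \<Rightarrow> real"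
  assumes cont: "continuous_on {a..b} f" and "a \<le> b"
    and der: "\<And>x. a \<le> x \<Longrightarrow> x < b \<Longrightarrow> (f has_real_derivative 0) (at_right x)"
  shows "f b = f a"
proof -
  have bound: "\<bar>f b - f a\<bar> \<le> e * (b - a)" if e: "e > 0" for e
  proof (rule ccontr)
    assume neg: "\<not> ?thesis"
    define S where "S = {x \<in> {a..b}. \<bar>f x - f a\<bar> > e * (x - a)}"
    define s where "s = Inf S"
    have "b \<in> S" using neg \<open>a \<le> b\<close> by (auto simp: S_def)
    have bdd: "bdd_below S" by (auto simp: S_def bdd_below_def)
    have "s \<le> b" unfolding s_def by (rule cInf_lower[OF \<open>b \<in> S\<close> bdd])
    have "a \<le> s" unfolding s_def by (rule cInf_greatest) (use \<open>b \<in> S\<close> in \<open>auto simp: S_def\<close>)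
    have below: "\<bar>f x - f a\<bar> \<le> e * (x - a)" if "a \<le> x" "x < s" for x
    proof (rule ccontr)
      assume "\<not> ?thesis"
      then have "x \<in> S" using that \<open>s \<le> b\<close> by (auto simp: S_def)
      then have "s \<le> x" unfolding s_def by (rule cInf_lower[OF _ bdd])
      then show False using that by simp
    qed
    have at_s: "\<bar>f s - f a\<bar> \<le> e * (s - a)"
    proof (cases "s = a")
      case False
      then have "a < s" using \<open>a \<le> s\<close> by simp
      have cs: "continuous_on {a..s} f" by (rule continuous_on_subset[OF cont]) (use \<open>s \<le> b\<close> in auto)
      have lim: "(f \<longlongrightarrow> f s) (at_left s)"
        by (rule continuous_on_Icc_at_leftD[OF cs \<open>a < s\<close>])
      show ?thesis
      proof (rule tendsto_le[of "at_left s"])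
        show "((\<lambda>x. e * (x - a)) \<longlongrightarrow> e * (s - a)) (at_left s)" by (intro tendsto_intros)
        show "((\<lambda>x. \<bar>f x - f a\<bar>) \<longlongrightarrow> \<bar>f s - f a\<bar>) (at_left s)" by (intro tendsto_intros lim)
        show "\<forall>\<^sub>F x in at_left s. \<bar>f x - f a\<bar> \<le> e * (x - a)"
          unfolding eventually_at_left_field using \<open>a < s\<close> below by (intro exI[of _ a]) auto
      qed simp
    qed auto
    have "s < b"
      using \<open>s \<le> b\<close> at_s neg by (cases "s = b") auto
    have "((\<lambda>y. (f y - f s) / (y - s)) \<longlongrightarrow> 0) (at_right s)"
      using der[OF \<open>a \<le> s\<close> \<open>s < b\<close>] by (simp add: has_field_derivative_iff)
    then have "\<forall>\<^sub>F y in at_right s. dist ((f y - f s) / (y - s)) 0 < e" using e by (rule tendstoD)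
    then obtain d where d: "d > s" "\<And>y. s < y \<Longrightarrow> y < d \<Longrightarrow> dist ((f y - f s) / (y - s)) 0 < e"
      unfolding eventually_at_right_field by blast
    have above: "\<bar>f y - f a\<bar> \<le> e * (y - a)" if "s < y" "y < d" for y
    proof -
      have "\<bar>f y - f s\<bar> / \<bar>y - s\<bar> < e" using d(2)[OF that] by (simp add: dist_real_def)
      then have "\<bar>f y - f s\<bar> \<le> e * (y - s)" using that by (simp add: field_simps)
      then show ?thesis using at_s by (simp add: algebra_simps)
    qed
    have "min d b \<le> s"
      unfolding s_def
    proof (rule cInf_greatest)
      fix x assume x: "x \<in> S"
      show "min d b \<le> x"
      proof (rule ccontr)
        assume "\<not> min d b \<le> x"
        moreover have "s \<le> x" unfolding s_def by (rule cInf_lower[OF x bdd])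
        ultimately have "\<bar>f x - f a\<bar> \<le> e * (x - a)"
          using above at_s by (cases "x = s") auto
        then show False using x by (simp add: S_def)
      qed
    qed (use \<open>b \<in> S\<close> in auto)
    then show False using \<open>s < b\<close> d(1) by linarith
  qed
  have "\<bar>f b - f a\<bar> \<le> 0"
  proof (rule field_le_epsilon)
    fix e :: real assume "e > 0"
    \<comment> \<open>The \<open>+ 1\<close> keeps the chosen slope positive when
      \<open>a = b\<close>.\<close>
    then have "\<bar>f b - f a\<bar> \<le> e / (b - a + 1) * (b - a)"
      using \<open>a \<le> b\<close> by (intro bound) auto
    also have "\<dots> \<le> e" using \<open>e > 0\<close> \<open>a \<le> b\<close> by (simp add: field_simps)
    finally show "\<bar>f b - f a\<bar> \<le> 0 + e" by simp
  qed
  then show ?thesis by simp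
qed

lemma right_derivative_eq_imp_eq:
  fixes f g :: "real \<Rightarrow> real"
  assumes "continuous_on UNIV f" "continuous_on UNIV g"
    and "\<And>x. (f has_real_derivative f' x) (at_right x)"
    and "\<And>x. (g has_real_derivative f' x) (at_right x)"
    and "f a = g a"
  shows "f = g"
proof
  fix t
  have c: "continuous_on S (\<lambda>x. f x - g x)" for S
    by (intro continuous_intros continuous_on_subset[OF assms(1)] continuous_on_subset[OF assms(2)]) auto
  have d: "((\<lambda>x. f x - g x) has_real_derivative 0) (at_right x)" for x
    using DERIV_diff[OF assms(3)[of x] assms(4)[of x]] by simp
  show "f t = g t"
    using right_derivative_zero_imp_eq[OF c _ d, of a t] right_derivative_zero_imp_eq[OF c _ d, of t a] assms(5)
    by (cases "a \<le> t") auto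
qed

text \<open>The antiderivative that vanishes at 0, on the whole line. It turns integrals with end
  points in either order into differences, so that later arguments need no cases on the
  orientation.\<close>

definition signed_integral :: "(real \<Rightarrow> real) \<Rightarrow> real \<Rightarrow> real" where
  "signed_integral f t = (if 0 \<le> t then integral {0..t} f else - integral {t..0} f)"

lemma signed_integral_diff:
  assumes f: "\<And>a b. f integrable_on {a..b}" and "a \<le> b"
  shows "integral {a..b} f = signed_integral f b - signed_integral f a"
proof -
  consider "0 \<le> a" | "b < 0" | "a < 0" "0 \<le> b" by linarith
  then show ?thesis
  proof cases
    case 1
    then show ?thesis using Henstock_Kurzweil_Integration.integral_combine[of 0 a b f] f \<open>a \<le> b\<close> by (simp add: signed_integral_def)
  next
    case 2
    then show ?thesis using Henstock_Kurzweil_Integration.integral_combine[of a b 0 f] f \<open>a \<le> b\<close> by (simp add: signed_integral_def)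
  next
    case 3
    then show ?thesis using Henstock_Kurzweil_Integration.integral_combine[of a 0 b f] f \<open>a \<le> b\<close> by (simp add: signed_integral_def)
  qed
qed

lemma signed_integral_shift:
  assumes f: "\<And>a b. f integrable_on {a..b}" and "m \<le> t"
  shows "signed_integral f t = signed_integral f m + integral {m..t} f"
  using signed_integral_diff[OF f \<open>m \<le> t\<close>] by simp

lemma continuous_signed_integral:
  assumes f: "\<And>a b. f integrable_on {a..b}"
  shows "continuous_on UNIV (signed_integral f)"
proof -
  have "isCont (signed_integral f) t" for t
  proof -
    \<comment> \<open>Moving the base point to \<open>t - 1\<close> makes \<open>t\<close> an
      interior point of the interval on which the indefinite integral is known to be
      continuous.\<close>
    have "continuous_on {t - 1..t + 1} (\<lambda>x. signed_integral f (t - 1) + integral {t - 1..x} f)"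
      by (intro continuous_intros indefinite_integral_continuous_1 f)
    then have "continuous_on {t - 1..t + 1} (signed_integral f)"
      by (rule continuous_on_eq) (simp add: signed_integral_shift[OF f, symmetric])
    then have "continuous_on {t - 1<..<t + 1} (signed_integral f)"
      by (rule continuous_on_subset) auto
    then show ?thesis by (subst (asm) continuous_on_eq_continuous_at) auto
  qed
  then show ?thesis by (simp add: continuous_on_eq_continuous_at)
qed

lemma right_derivative_signed_integral:
  assumes f: "\<And>a b. f integrable_on {a..b}" and lim: "(f \<longlongrightarrow> f x) (at_right x)"
  shows "(signed_integral f has_real_derivative f x) (at_right x)"
proof -
  have w: "at x within {x..x + 1} = at_right x"
    by (rule at_within_Icc_at_right) simp
  have "((\<lambda>u. integral {x..u} f) has_vector_derivative f x) (at x within ({x..x + 1} - {}))"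
    by (rule integral_has_vector_derivative_continuous_at)
       (use f lim in \<open>auto simp: continuous_within w\<close>)
  then have "((\<lambda>u. integral {x..u} f) has_real_derivative f x) (at_right x)"
    by (simp add: w has_real_derivative_iff_has_vector_derivative)
  then have "((\<lambda>u. signed_integral f x + integral {x..u} f) has_real_derivative f x) (at_right x)"
    by (auto intro!: derivative_eq_intros)
  moreover have "\<forall>\<^sub>F u in at_right x. signed_integral f x + integral {x..u} f = signed_integral f u"
    unfolding eventually_at_right_field
    by (intro exI[of _ "x + 1"]) (simp add: signed_integral_shift[OF f, symmetric])
  ultimately show ?thesis
    by (subst (asm) has_field_derivative_cong_eventually) auto
qed

section \<open>Stieltjes sums over equidistant meshes\<close>

definition mesh :: "real \<Rightarrow> real \<Rightarrow> nat \<Rightarrow> nat \<Rightarrow> real" where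
  "mesh p q m j = p + (q - p) * real j / real (Suc m)"

text \<open>The right end point of the mesh cell around \<open>s\<close>: it approaches \<open>s\<close> from the
  right, where cadlag paths are continuous.\<close>

definition mesh_right :: "real \<Rightarrow> real \<Rightarrow> nat \<Rightarrow> real \<Rightarrow> real" where
  "mesh_right p q m s = p + (q - p) * of_int \<lceil>(s - p) * real (Suc m) / (q - p)\<rceil> / real (Suc m)"

lemma mesh_0 [simp]: "mesh p q m 0 = p"
  and mesh_Suc_self [simp]: "mesh p q m (Suc m) = q"
  by (simp_all add: mesh_def)

lemma mesh_less_mesh: "p < q \<Longrightarrow> i < j \<Longrightarrow> mesh p q m i < mesh p q m j"
  by (simp add: mesh_def divide_strict_right_mono)

lemma mesh_le_mesh: "p \<le> q \<Longrightarrow> i \<le> j \<Longrightarrow> mesh p q m i \<le> mesh p q m j"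
  by (simp add: mesh_def divide_right_mono mult_left_mono)

lemma mesh_right_eq:
  assumes "p < q" "mesh p q m j < s" "s \<le> mesh p q m (Suc j)"
  shows "mesh_right p q m s = mesh p q m (Suc j)"
proof -
  have "\<lceil>(s - p) * real (Suc m) / (q - p)\<rceil> = int (Suc j)"
    by (rule ceiling_unique) (use assms in \<open>simp_all add: mesh_def field_simps\<close>)
  then show ?thesis by (simp only: mesh_right_def mesh_def of_int_of_nat_eq)
qed

lemma mesh_right_bounds:
  assumes "p < q"
  shows "s \<le> mesh_right p q m s" "mesh_right p q m s \<le> s + (q - p) / real (Suc m)"
proof -
  define n where "n = real (Suc m)"
  have n: "n > 0" by (simp add: n_def)
  define z where "z = (s - p) * n / (q - p)"
  have 1: "z \<le> of_int \<lceil>z\<rceil>" and 2: "of_int \<lceil>z\<rceil> \<le> z + 1" by linarith+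
  have s: "s = p + (q - p) * z / n" using assms n by (simp add: z_def)
  have r: "mesh_right p q m s = p + (q - p) * of_int \<lceil>z\<rceil> / n" by (simp only: mesh_right_def z_def n_def)
  show "s \<le> mesh_right p q m s"
    unfolding r by (subst s) (use assms n 1 in \<open>simp add: divide_right_mono mult_left_mono\<close>)
  have "mesh_right p q m s \<le> p + (q - p) * (z + 1) / n"
    unfolding r using assms n 2 by (simp add: divide_right_mono mult_left_mono)
  also have "\<dots> = s + (q - p) / n" using s by (simp add: algebra_simps add_divide_distrib diff_divide_distrib)
  finally show "mesh_right p q m s \<le> s + (q - p) / real (Suc m)" by (simp only: n_def)
qed

text \<open>On each cell \<open>y\<close> is frozen at the right end point, so the integral over the
  cell is an increment of \<open>A\<close> times a constant. The number \<open>J\<close> of cells is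
  kept free for the induction.\<close>

lemma has_integral_mesh_right:
  assumes A: "\<And>s. (A has_real_derivative A' s) (at s)" and "p < q"
  shows "((\<lambda>s. A' s * y (mesh_right p q m s)) has_integral
     (\<Sum>j<J. (A (mesh p q m (Suc j)) - A (mesh p q m j)) * y (mesh p q m (Suc j)))) {p..mesh p q m J}"
proof (induction J)
  case (Suc J)
  let ?u = "mesh p q m"
  have le: "?u J \<le> ?u (Suc J)" using assms by (intro mesh_le_mesh) auto
  have "(A' has_integral (A (?u (Suc J)) - A (?u J))) {?u J..?u (Suc J)}"
    by (rule fundamental_theorem_of_calculus[OF le])
       (use A in \<open>auto simp: has_real_derivative_iff_has_vector_derivative[symmetric] intro: has_field_derivative_at_within\<close>)
  then have "((\<lambda>s. A' s * y (?u (Suc J))) has_integral (A (?u (Suc J)) - A (?u J)) * y (?u (Suc J))) {?u J..?u (Suc J)}"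
    by (rule has_integral_mult_left)
  \<comment> \<open>At the left end of the cell \<open>mesh_right\<close> rounds to that point
    itself instead of the right end; a single point is negligible.\<close>
  then have "((\<lambda>s. A' s * y (mesh_right p q m s)) has_integral (A (?u (Suc J)) - A (?u J)) * y (?u (Suc J))) {?u J..?u (Suc J)}"
    by (rule has_integral_spike_finite[of "{?u J}", rotated 2])
       (use mesh_right_eq[OF \<open>p < q\<close>, of m J] in auto)
  from has_integral_combine[OF _ le Suc.IH this] show ?case
    using mesh_le_mesh[of p q 0 J m] assms by (simp add: less_imp_le)
qed auto

text \<open>Freezing \<open>y\<close> at \<open>mesh_right\<close> gives integrable functions that
  are uniformly bounded and converge pointwise, because \<open>mesh_right\<close> approaches each
  point from the right. Dominated convergence yields integrability of the limit together with
  convergence of the integrals, and summation by parts rewrites the latter as Stieltjes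
  sums.\<close>

lemma
  assumes y: "cadlag_on UNIV y"
    and A: "\<And>s. (A has_real_derivative A' s) (at s)" and A': "continuous_on UNIV A'"
  shows cadlag_mult_integrable: "(\<lambda>s. A' s * y s) integrable_on {p..q}"
    and cadlag_stieltjes_sums: "p < q \<Longrightarrow>
      (\<lambda>m. \<Sum>j<Suc m. A (mesh p q m j) * (y (mesh p q m (Suc j)) - y (mesh p q m j)))
        \<longlonglongrightarrow> A q * y q - A p * y p - integral {p..q} (\<lambda>s. A' s * y s)"
proof -
  define f where "f m s = A' s * y (mesh_right p q m s)" for m s
  have *: "(\<lambda>s. A' s * y s) integrable_on {p..q} \<and>
      (\<lambda>m. integral {p..q} (f m)) \<longlonglongrightarrow> integral {p..q} (\<lambda>s. A' s * y s)" if "p < q"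
  proof -
    \<comment> \<open>The upper bound for \<open>mesh_right\<close> allows for one cell beyond
      \<open>q\<close>, and a cell has length at most \<open>q - p\<close>.\<close>
    obtain B where B: "B \<ge> 0" "\<And>t. t \<in> {p..q + (q - p)} \<Longrightarrow> \<bar>y t\<bar> \<le> B"
      using cadlag_on_UNIV_bounded[OF y, of p "q + (q - p)"] by blast
    have "compact (A' ` {p..q})"
      by (intro compact_continuous_image continuous_on_subset[OF A']) auto
    then obtain C where "\<forall>x\<in>A' ` {p..q}. norm x \<le> C"
      using compact_imp_bounded bounded_iff by blast
    then have C: "\<bar>A' s\<bar> \<le> C" if "s \<in> {p..q}" for s
      using that by auto
    have int: "f m integrable_on {p..q}" for m
      using has_integral_mesh_right[OF A that, of y m "Suc m"]
      unfolding f_def by (auto simp: integrable_on_def)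
    have le: "norm (f m s) \<le> C * B" if "s \<in> {p..q}" for m s
    proof -
      have "(q - p) / real (Suc m) \<le> q - p" using \<open>p < q\<close> mult_left_mono[of 1 "real (Suc m)" "q - p"]
        by (simp add: divide_le_eq)
      then have "mesh_right p q m s \<in> {p..q + (q - p)}"
        using mesh_right_bounds[OF \<open>p < q\<close>, where s = s and m = m] that unfolding atLeastAtMost_iff by linarith
      then have "\<bar>A' s\<bar> * \<bar>y (mesh_right p q m s)\<bar> \<le> C * B"
        using B C that abs_ge_zero order_trans by (intro mult_mono) blast+
      then show ?thesis by (simp add: f_def abs_mult)
    qed
    have conv: "(\<lambda>m. f m s) \<longlonglongrightarrow> A' s * y s" if "s \<in> {p..q}" for s
    proof -
      have lim: "(\<lambda>m. mesh_right p q m s) \<longlonglongrightarrow> s"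
      proof (rule real_tendsto_sandwich)
        show "\<forall>\<^sub>F m in sequentially. s \<le> mesh_right p q m s"
          "\<forall>\<^sub>F m in sequentially. mesh_right p q m s \<le> s + (q - p) * inverse (real (Suc m))"
          using mesh_right_bounds[OF \<open>p < q\<close>, where s = s] by (simp_all add: divide_inverse)
        have "(\<lambda>m. s + (q - p) * inverse (real (Suc m))) \<longlonglongrightarrow> s + (q - p) * 0"
          by (intro tendsto_intros LIMSEQ_inverse_real_of_nat)
        then show "(\<lambda>m. s + (q - p) * inverse (real (Suc m))) \<longlonglongrightarrow> s" by simp
      qed simp
      have "continuous (at s within {s..}) y"
        using y by (simp add: cadlag_on_UNIV_iff continuous_within at_within_Ici_at_right)
      then have "(\<lambda>m. y (mesh_right p q m s)) \<longlonglongrightarrow> y s"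
        using lim mesh_right_bounds(1)[OF \<open>p < q\<close>, where s = s]
        unfolding continuous_within_sequentially by (auto simp: o_def)
      then show ?thesis unfolding f_def by (intro tendsto_intros)
    qed
    show ?thesis
      using dominated_convergence[OF int integrable_const_ivl le conv] by blast
  qed
  show "(\<lambda>s. A' s * y s) integrable_on {p..q}"
    using * integrable_on_refl[of "\<lambda>s. A' s * y s" p] by (cases p q rule: linorder_cases) auto
  assume "p < q"
  \<comment> \<open>Summation by parts: weights \<open>A\<close> at left end points turn into values
    of \<open>y\<close> at right end points, which is the form produced by
    \<open>mesh_right\<close>.\<close>
  have sum: "(\<Sum>j<n. A (mesh p q m j) * (y (mesh p q m (Suc j)) - y (mesh p q m j))) =
      A (mesh p q m n) * y (mesh p q m n) - A p * y p
      - (\<Sum>j<n. (A (mesh p q m (Suc j)) - A (mesh p q m j)) * y (mesh p q m (Suc j)))" for m n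
    by (induction n) (simp_all add: algebra_simps)
  have int: "integral {p..q} (f m) = (\<Sum>j<Suc m. (A (mesh p q m (Suc j)) - A (mesh p q m j)) * y (mesh p q m (Suc j)))" for m
    using has_integral_mesh_right[OF A \<open>p < q\<close>, of y m "Suc m"]
    unfolding f_def by (intro integral_unique) simp
  show "(\<lambda>m. \<Sum>j<Suc m. A (mesh p q m j) * (y (mesh p q m (Suc j)) - y (mesh p q m j)))
        \<longlonglongrightarrow> A q * y q - A p * y p - integral {p..q} (\<lambda>s. A' s * y s)"
    unfolding sum int[symmetric] mesh_Suc_self using *[OF \<open>p < q\<close>] by (intro tendsto_intros) auto
qed

section \<open>Pathwise integrals of exponentials\<close>

lemma path_integral_eq:
  assumes y: "cadlag_on UNIV y"
    and A: "\<And>s. (A has_real_derivative A' s) (at s)" and A': "continuous_on UNIV A'"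
  shows "path_integral A y a b = A b * y b - A a * y a
    - (signed_integral (\<lambda>t. A' t * y t) b - signed_integral (\<lambda>t. A' t * y t) a)"
proof -
  have "deriv A = A'" using A DERIV_imp_deriv by blast
  then show ?thesis
    using signed_integral_diff[OF cadlag_mult_integrable[OF y A A'], of a b]
      signed_integral_diff[OF cadlag_mult_integrable[OF y A A'], of b a]
    by (auto simp: path_integral_def Let_def)
qed

lemma has_real_derivative_exp_scaled:
  "((\<lambda>s. exp (a * s)) has_real_derivative a * exp (a * s)) (at s :: real filter)"
  by (auto intro!: derivative_eq_intros)

lemma continuous_on_exp_scaled: "continuous_on S (\<lambda>s::real. a * exp (a * s :: real))"
  by (intro continuous_intros)

lemmas path_integral_exp =
  path_integral_eq[OF _ has_real_derivative_exp_scaled continuous_on_exp_scaled]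
lemmas cadlag_exp_integrable =
  cadlag_mult_integrable[OF _ has_real_derivative_exp_scaled continuous_on_exp_scaled]

lemma cadlag_on_continuous:
  assumes "continuous_on UNIV f"
  shows "cadlag_on UNIV f"
  using assms unfolding cadlag_on_UNIV_iff continuous_on_def
  by (meson tendsto_within_subset subset_UNIV iso_tuple_UNIV_I)

lemma cadlag_on_UNIV_add:
  assumes "cadlag_on UNIV f" "cadlag_on UNIV g"
  shows "cadlag_on UNIV (\<lambda>t. f t + g t)"
  using assms unfolding cadlag_on_UNIV_iff by (fast intro: tendsto_add)

lemma cadlag_on_UNIV_mult:
  assumes "cadlag_on UNIV f" "cadlag_on UNIV g"
  shows "cadlag_on UNIV (\<lambda>t. f t * g t)"
  using assms unfolding cadlag_on_UNIV_iff by (fast intro: tendsto_mult)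

text \<open>Separates the only term that can jump, \<open>exp (a * t) * y t\<close>, from a
  continuous function of \<open>t\<close>; this is what makes the integral cadlag.\<close>

lemma path_integral_exp_as_sum:
  assumes "cadlag_on UNIV y"
  shows "path_integral (\<lambda>s. exp (a * s)) y 0 =
    (\<lambda>t. exp (a * t) * y t + (- y 0 - signed_integral (\<lambda>t. a * exp (a * t) * y t) t))"
  by (rule ext) (simp add: path_integral_exp[OF assms] signed_integral_def)

lemma cadlag_on_path_integral_exp:
  assumes y: "cadlag_on UNIV y"
  shows "cadlag_on UNIV (path_integral (\<lambda>s. exp (a * s)) y 0)"
  unfolding path_integral_exp_as_sum[OF y]
  by (intro cadlag_on_UNIV_add cadlag_on_UNIV_mult y cadlag_on_continuous continuous_intros
      continuous_signed_integral cadlag_exp_integrable)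

lemma path_integral_exp_diff:
  assumes y: "cadlag_on UNIV y"
  shows "path_integral (\<lambda>s. exp (a * s)) y 0 t - path_integral (\<lambda>s. exp (a * s)) y 0 s =
    path_integral (\<lambda>s. exp (a * s)) y s t"
  by (simp add: path_integral_exp[OF y])

text \<open>Formally \<open>dz = exp (- a * t) dy\<close> gives \<open>dy = exp (a * t) dz\<close>.
  With integrals defined by parts this amounts to finding the antiderivative of
  \<open>a * exp (a * t) * z t\<close>. As \<open>P\<close> has right derivative
  \<open>- a * exp (- a * t) * y t\<close>, the product rule shows that
  \<open>- exp (a * t) * (y 0 + P t)\<close> has the wanted right derivative, and adding
  \<open>y 0\<close> makes the value at 0 vanish.\<close>

lemma path_integral_exp_inverse:
  assumes y: "cadlag_on UNIV y"
  shows "path_integral (\<lambda>s. exp (a * s)) (path_integral (\<lambda>s. exp (- a * s)) y 0) 0 t = y t - y 0"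
proof -
  define z where "z = path_integral (\<lambda>s. exp (- a * s)) y 0"
  define P where "P = signed_integral (\<lambda>t. - a * exp (- a * t) * y t)"
  have z: "z t = exp (- a * t) * y t - y 0 - P t" for t
    unfolding z_def path_integral_exp_as_sum[OF y] P_def by simp
  have cz: "cadlag_on UNIV z" unfolding z_def by (rule cadlag_on_path_integral_exp[OF y])
  have right: "(y \<longlongrightarrow> y x) (at_right x)" "(z \<longlongrightarrow> z x) (at_right x)" for x
    using y cz by (simp_all add: cadlag_on_UNIV_iff)
  have contP: "continuous_on UNIV P"
    unfolding P_def by (intro continuous_signed_integral cadlag_exp_integrable y)
  have dP: "(P has_real_derivative - a * exp (- a * x) * y x) (at_right x)" for x
    unfolding P_def
    by (intro right_derivative_signed_integral cadlag_exp_integrable y tendsto_intros right)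
  \<comment> \<open>Cadlag integrands are only continuous from the right, so right derivatives are compared.\<close>
  have "signed_integral (\<lambda>t. a * exp (a * t) * z t) = (\<lambda>t. y 0 - exp (a * t) * y 0 - exp (a * t) * P t)"
  proof (rule right_derivative_eq_imp_eq[where a = 0])
    show "continuous_on UNIV (signed_integral (\<lambda>t. a * exp (a * t) * z t))"
      by (intro continuous_signed_integral cadlag_exp_integrable cz)
    show "continuous_on UNIV (\<lambda>t. y 0 - exp (a * t) * y 0 - exp (a * t) * P t)"
      by (intro continuous_intros contP)
    show "(signed_integral (\<lambda>t. a * exp (a * t) * z t) has_real_derivative a * exp (a * x) * z x) (at_right x)" for x
      by (intro right_derivative_signed_integral cadlag_exp_integrable cz tendsto_intros right)
    have e: "exp (a * x) * exp (- a * x) = 1" for x by (simp add: exp_minus)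
    have "((\<lambda>t. y 0 - exp (a * t) * y 0 - exp (a * t) * P t) has_real_derivative
        - (a * exp (a * x) * y 0) - (a * exp (a * x) * P x + exp (a * x) * (- a * exp (- a * x) * y x))) (at_right x)" for x
      by (rule derivative_eq_intros dP refl | simp)+
    moreover have "- (a * exp (a * x) * y 0) - (a * exp (a * x) * P x + exp (a * x) * (- a * exp (- a * x) * y x))
        = a * exp (a * x) * z x" for x
      using e[of x] unfolding z by (simp add: algebra_simps)
    ultimately show "((\<lambda>t. y 0 - exp (a * t) * y 0 - exp (a * t) * P t) has_real_derivative a * exp (a * x) * z x) (at_right x)" for x
      by simp
  qed (simp add: signed_integral_def P_def)
  moreover have "z 0 = 0" by (simp add: z P_def signed_integral_def)
  ultimately show ?thesis
    unfolding z_def[symmetric] path_integral_exp_as_sum[OF cz]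
    by (simp add: z algebra_simps exp_minus)
qed

section \<open>The substitution u = exp s\<close>

lemma cadlag_on_exp:
  assumes "cadlag_on {0..} y"
  shows "cadlag_on UNIV (\<lambda>t. y (exp t))"
  unfolding cadlag_on_UNIV_iff
proof (intro allI conjI)
  fix t :: real
  have lim: "(exp \<longlongrightarrow> exp t) (at t within S)" for S by (intro tendsto_intros)
  have y: "(y \<longlongrightarrow> y (exp t)) (at (exp t) within {0..} \<inter> {exp t<..})"
    "\<exists>l. (y \<longlongrightarrow> l) (at (exp t) within {0..} \<inter> {..<exp t})"
    using assms by (auto simp: cadlag_on_def)
  have "filterlim exp (at (exp t) within {0..} \<inter> {exp t<..}) (at_right t)"
    using lim by (auto simp: filterlim_at eventually_at_filter)
  from filterlim_compose[OF y(1) this] show "((\<lambda>t. y (exp t)) \<longlongrightarrow> y (exp t)) (at_right t)" .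
  have f: "filterlim exp (at (exp t) within {0..} \<inter> {..<exp t}) (at_left t)"
    using lim by (auto simp: filterlim_at eventually_at_filter)
  show "\<exists>l. ((\<lambda>t. y (exp t)) \<longlongrightarrow> l) (at_left t)"
    using y(2) filterlim_compose[OF _ f] by blast
qed

lemma exp_image_Icc: "exp ` {p..q} = {exp p..exp (q::real)}"
proof
  show "{exp p..exp q} \<subseteq> exp ` {p..q}"
  proof
    fix x assume x: "x \<in> {exp p..exp q}"
    then have "x > 0" using exp_gt_zero[of p] by (simp only: atLeastAtMost_iff) linarith
    then have "x = exp (ln x)" "ln x \<in> {p..q}"
      using x by (auto simp: ln_ge_iff) (metis exp_le_cancel_iff exp_ln)
    then show "x \<in> exp ` {p..q}" by blast
  qed
qed auto

text \<open>The boundary terms agree since \<open>exp s powr a = exp (a * s)\<close>. The integrals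
  are matched by the change of variables theorem, whose demand for absolute integrability is met
  because the integrand in \<open>s\<close> is bounded on compact intervals.\<close>

lemma path_integral_powr_exp:
  fixes y :: "real \<Rightarrow> real"
  assumes y: "cadlag_on {0..} y"
  shows "path_integral (\<lambda>u. u powr a) y 1 (exp t) = path_integral (\<lambda>s. exp (a * s)) (\<lambda>s. y (exp s)) 0 t"
proof -
  have cw: "cadlag_on UNIV (\<lambda>s. y (exp s))" by (rule cadlag_on_exp[OF y])
  have int: "integral {exp p..exp q} (\<lambda>u. deriv (\<lambda>u. u powr a) u * y u)
      = integral {p..q} (\<lambda>s. deriv (\<lambda>s. exp (a * s)) s * y (exp s))" for p q
  proof -
    have "cadlag_on UNIV (\<lambda>s. a * exp (a * s) * y (exp s))"
      by (intro cadlag_on_UNIV_mult cw cadlag_on_continuous continuous_intros)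
    then obtain B where B: "\<bar>a * exp (a * s) * y (exp s)\<bar> \<le> B" if "s \<in> {p..q}" for s
      by (rule cadlag_on_UNIV_bounded[of _ p q]) blast
    have abs: "(\<lambda>s. a * exp (a * s) * y (exp s)) absolutely_integrable_on {p..q}"
      by (rule absolutely_integrable_integrable_bound[where g = "\<lambda>_. B"])
         (use B in \<open>auto intro!: cadlag_exp_integrable cw\<close>)
    \<comment> \<open>The Jacobian \<open>exp s\<close> raises the exponent \<open>a - 1\<close> of
      the derivative back to \<open>a\<close>.\<close>
    have eq: "\<bar>exp s\<bar> * (a * exp s powr (a - 1) * y (exp s)) = a * exp (a * s) * y (exp s)" for s :: real
      by (simp add: powr_def exp_add[symmetric] algebra_simps)
    have d1: "deriv (\<lambda>s. exp (a * s)) s = a * exp (a * s)" for s :: real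
      by (rule DERIV_imp_deriv[OF has_real_derivative_exp_scaled])
    have d2: "deriv (\<lambda>u. u powr a) u = a * u powr (a - 1)" if "u > 0" for u :: real
      using that by (intro DERIV_imp_deriv) (auto intro!: derivative_eq_intros)
    have "integral (exp ` {p..q}) (\<lambda>u. a * u powr (a - 1) * y u) =
        integral {p..q} (\<lambda>s. a * exp (a * s) * y (exp s))"
      using has_absolute_integral_change_of_variables_1'[of "{p..q}" exp exp
          "\<lambda>u. a * u powr (a - 1) * y u" "integral {p..q} (\<lambda>s. a * exp (a * s) * y (exp s))"] abs
        DERIV_exp[THEN has_field_derivative_at_within]
      unfolding eq by (auto simp: inj_on_def)
    then show ?thesis
      unfolding exp_image_Icc d1
      by (subst Henstock_Kurzweil_Integration.integral_cong[where g = "\<lambda>u. a * u powr (a - 1) * y u"])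
         (use d2 exp_gt_zero less_le_trans in \<open>auto, blast\<close>)
  qed
  show ?thesis
    using int[of 0 t] int[of t 0] by (simp add: path_integral_def Let_def powr_def)
qed

section \<open>Convergence in probability and independence\<close>

lemma tendsto_in_prob_compose:
  assumes "tendsto_in_prob M X Z F" and f: "filterlim f F G"
  shows "tendsto_in_prob M (\<lambda>i. X (f i)) Z G"
  unfolding tendsto_in_prob_def
proof (intro allI impI)
  fix e :: real assume "e > 0"
  then have "((\<lambda>s. measure M {\<omega> \<in> space M. \<bar>X s \<omega> - Z \<omega>\<bar> > e}) \<longlongrightarrow> 0) F"
    using assms(1) by (simp add: tendsto_in_prob_def)
  from filterlim_compose[OF this f]
  show "((\<lambda>i. measure M {\<omega> \<in> space M. \<bar>X (f i) \<omega> - Z \<omega>\<bar> > e}) \<longlongrightarrow> 0) G" .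
qed

lemma tendsto_in_prob_diff_iff:
  "tendsto_in_prob M X Z F \<longleftrightarrow> tendsto_in_prob M (\<lambda>i \<omega>. X i \<omega> - Z \<omega>) (\<lambda>_. 0) F"
  by (simp add: tendsto_in_prob_def)

text \<open>Almost sure convergence is turned into convergence in probability by dominated
  convergence, which works along sequences; a limit at a point is reduced to that case here.\<close>

lemma tendsto_in_prob_at_sequentiallyI:
  fixes t :: "'b::first_countable_topology"
  assumes "\<And>S. (\<And>i. S i \<in> T - {t}) \<Longrightarrow> S \<longlonglongrightarrow> t \<Longrightarrow>
    tendsto_in_prob M (\<lambda>i. X (S i)) Z sequentially"
  shows "tendsto_in_prob M X Z (at t within T)"
  unfolding tendsto_in_prob_def tendsto_at_iff_sequentially o_def
proof (intro allI impI)
  fix e :: real and S :: "nat \<Rightarrow> 'b"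
  assume "e > 0" "\<forall>i. S i \<in> T - {t}" "S \<longlonglongrightarrow> t"
  then show "(\<lambda>i. measure M {\<omega> \<in> space M. e < \<bar>X (S i) \<omega> - Z \<omega>\<bar>}) \<longlonglongrightarrow> 0"
    using assms[of S] by (simp add: tendsto_in_prob_def)
qed

lemma tendsto_in_prob_eventually_cong:
  assumes "\<forall>\<^sub>F i in F. X i = Y i" and "tendsto_in_prob M X Z F"
  shows "tendsto_in_prob M Y Z F"
  unfolding tendsto_in_prob_def
proof (intro allI impI)
  fix e :: real assume "e > 0"
  then have "((\<lambda>s. measure M {\<omega> \<in> space M. \<bar>X s \<omega> - Z \<omega>\<bar> > e}) \<longlongrightarrow> 0) F"
    using assms(2) by (simp add: tendsto_in_prob_def)
  moreover have "\<forall>\<^sub>F s in F. measure M {\<omega> \<in> space M. \<bar>X s \<omega> - Z \<omega>\<bar> > e} =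
      measure M {\<omega> \<in> space M. \<bar>Y s \<omega> - Z \<omega>\<bar> > e}"
    using assms(1) by eventually_elim simp
  ultimately show "((\<lambda>s. measure M {\<omega> \<in> space M. \<bar>Y s \<omega> - Z \<omega>\<bar> > e}) \<longlongrightarrow> 0) F"
    by (rule Lim_transform_eventually)
qed

lemma independent_increments_indep_vars:
  fixes t :: "nat \<Rightarrow> real"
  assumes "independent_increments M T X" "\<And>i. i \<le> n \<Longrightarrow> t i \<in> T" "\<And>i. i < n \<Longrightarrow> t i < t (Suc i)"
  shows "prob_space.indep_vars M (\<lambda>_. borel) (\<lambda>i \<omega>. X (t (Suc i)) \<omega> - X (t i) \<omega>) {..<n}"
  using assms unfolding independent_increments_def by blast

lemma independent_increments_time_change:
  assumes X: "independent_increments M T X"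
    and h: "\<And>t. t \<in> T' \<Longrightarrow> h t \<in> T" "\<And>s t. s \<in> T' \<Longrightarrow> t \<in> T' \<Longrightarrow> s < t \<Longrightarrow> h s < h t"
  shows "independent_increments M T' (\<lambda>t. X (h t))"
  unfolding independent_increments_def
proof (intro allI impI, elim conjE)
  fix n and t :: "nat \<Rightarrow> real"
  assume t: "\<forall>i\<le>n. t i \<in> T'" "\<forall>i<n. t i < t (Suc i)"
  show "prob_space.indep_vars M (\<lambda>_. borel) (\<lambda>i \<omega>. X (h (t (Suc i))) \<omega> - X (h (t i)) \<omega>) {..<n}"
    by (rule independent_increments_indep_vars[OF X, of n "\<lambda>i. h (t i)"]) (use t h in auto)
qed

context prob_space
begin

lemma tendsto_in_prob_AE:
  assumes [measurable]: "\<And>n. X n \<in> borel_measurable M" "Z \<in> borel_measurable M"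
    and lim: "AE \<omega> in M. (\<lambda>n. X n \<omega>) \<longlonglongrightarrow> Z \<omega>"
  shows "tendsto_in_prob M X Z sequentially"
  unfolding tendsto_in_prob_def
proof (intro allI impI)
  fix e :: real assume e: "e > 0"
  let ?A = "\<lambda>n. {\<omega> \<in> space M. \<bar>X n \<omega> - Z \<omega>\<bar> > e}"
  have "(\<lambda>n. \<integral>\<omega>. indicator (?A n) \<omega> \<partial>M) \<longlonglongrightarrow> (\<integral>\<omega>. 0 \<partial>M :: real)"
  proof (rule integral_dominated_convergence[where w = "\<lambda>_. 1"])
    show "AE \<omega> in M. (\<lambda>n. indicator (?A n) \<omega> :: real) \<longlonglongrightarrow> 0"
      using lim
    proof eventually_elim
      case (elim \<omega>)
      then have "\<forall>\<^sub>F n in sequentially. dist (X n \<omega>) (Z \<omega>) < e" using e by (rule tendstoD)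
      then have "\<forall>\<^sub>F n in sequentially. indicator (?A n) \<omega> = (0 :: real)"
        by eventually_elim (auto simp: indicator_def dist_real_def)
      then show ?case by (rule tendsto_eventually)
    qed
    show "AE \<omega> in M. norm (indicator (?A n) \<omega> :: real) \<le> 1" for n
      by (auto split: split_indicator)
  qed measurable
  then show "(\<lambda>n. measure M (?A n)) \<longlonglongrightarrow> 0" by simp
qed

lemma tendsto_in_prob_add:
  assumes [measurable]: "\<And>i. X i \<in> borel_measurable M" "\<And>i. Y i \<in> borel_measurable M"
    "Z \<in> borel_measurable M" "U \<in> borel_measurable M"
    and X: "tendsto_in_prob M X Z F" and Y: "tendsto_in_prob M Y U F"
  shows "tendsto_in_prob M (\<lambda>i \<omega>. X i \<omega> + Y i \<omega>) (\<lambda>\<omega>. Z \<omega> + U \<omega>) F"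
  unfolding tendsto_in_prob_def
proof (intro allI impI)
  fix e :: real assume e: "e > 0"
  let ?A = "\<lambda>i. {\<omega> \<in> space M. \<bar>X i \<omega> - Z \<omega>\<bar> > e / 2}" and ?B = "\<lambda>i. {\<omega> \<in> space M. \<bar>Y i \<omega> - U \<omega>\<bar> > e / 2}"
  let ?C = "\<lambda>i. {\<omega> \<in> space M. \<bar>X i \<omega> + Y i \<omega> - (Z \<omega> + U \<omega>)\<bar> > e}"
  have le: "prob (?C i) \<le> prob (?A i) + prob (?B i)" for i
  proof -
    have "prob (?C i) \<le> prob (?A i \<union> ?B i)"
    proof (intro finite_measure_mono subsetI)
      fix \<omega> assume "\<omega> \<in> ?C i"
      then have "\<omega> \<in> space M" "\<bar>X i \<omega> - Z \<omega>\<bar> > e / 2 \<or> \<bar>Y i \<omega> - U \<omega>\<bar> > e / 2"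
        unfolding mem_Collect_eq by (blast, linarith)
      then show "\<omega> \<in> ?A i \<union> ?B i" by auto
    qed measurable
    also have "\<dots> \<le> prob (?A i) + prob (?B i)"
      by (intro measure_Un_le) auto
    finally show ?thesis .
  qed
  have lim: "((\<lambda>i. prob (?A i) + prob (?B i)) \<longlongrightarrow> 0) F"
    using X[unfolded tendsto_in_prob_def, rule_format, OF half_gt_zero[OF e]]
      Y[unfolded tendsto_in_prob_def, rule_format, OF half_gt_zero[OF e]]
    by (rule tendsto_add_zero)
  show "((\<lambda>i. prob (?C i)) \<longlongrightarrow> 0) F"
    by (rule tendsto_sandwich[OF _ _ tendsto_const lim]) (use le in auto)
qed

lemma tendsto_in_prob_mult_bounded:
  fixes b :: "'i \<Rightarrow> real"
  assumes [measurable]: "\<And>i. X i \<in> borel_measurable M"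
    and X: "tendsto_in_prob M X (\<lambda>_. 0) F" and b: "\<forall>\<^sub>F i in F. \<bar>b i\<bar> \<le> C"
  shows "tendsto_in_prob M (\<lambda>i \<omega>. b i * X i \<omega>) (\<lambda>_. 0) F"
  unfolding tendsto_in_prob_def
proof (intro allI impI)
  fix e :: real assume e: "e > 0"
  \<comment> \<open>Taking the maximum with 1 keeps the threshold \<open>e / D\<close> positive even
    for \<open>C \<le> 0\<close>.\<close>
  define D where "D = max C 1"
  have D: "D > 0" by (simp add: D_def)
  have le: "prob {\<omega> \<in> space M. \<bar>b i * X i \<omega> - 0\<bar> > e} \<le> prob {\<omega> \<in> space M. \<bar>X i \<omega> - 0\<bar> > e / D}"
    if "\<bar>b i\<bar> \<le> C" for i
  proof (intro finite_measure_mono)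
    show "{\<omega> \<in> space M. \<bar>b i * X i \<omega> - 0\<bar> > e} \<subseteq> {\<omega> \<in> space M. \<bar>X i \<omega> - 0\<bar> > e / D}"
    proof safe
      fix \<omega> assume "e < \<bar>b i * X i \<omega> - 0\<bar>"
      also have "\<dots> = \<bar>b i\<bar> * \<bar>X i \<omega>\<bar>" by (simp add: abs_mult)
      also have "\<dots> \<le> D * \<bar>X i \<omega>\<bar>" using that by (intro mult_right_mono) (auto simp: D_def)
      finally show "e / D < \<bar>X i \<omega> - 0\<bar>" using D by (simp add: field_simps)
    qed
  qed auto
  have lim: "((\<lambda>i. prob {\<omega> \<in> space M. \<bar>X i \<omega> - 0\<bar> > e / D}) \<longlongrightarrow> 0) F"
    using X e D unfolding tendsto_in_prob_def by auto
  show "((\<lambda>i. prob {\<omega> \<in> space M. \<bar>b i * X i \<omega> - 0\<bar> > e}) \<longlongrightarrow> 0) F"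
  proof (rule tendsto_sandwich[OF _ _ tendsto_const lim])
    show "\<forall>\<^sub>F i in F. prob {\<omega> \<in> space M. \<bar>b i * X i \<omega> - 0\<bar> > e} \<le> prob {\<omega> \<in> space M. \<bar>X i \<omega> - 0\<bar> > e / D}"
      using b by eventually_elim (rule le)
  qed simp
qed

text \<open>Where \<open>X n\<close> is within \<open>d / 2\<close> of \<open>Z\<close>, uniform
  continuity makes the difference small; elsewhere it is at most 1, on an event of small
  probability. The absolute value stays inside the expectation so that differences of products can
  be telescoped later.\<close>

lemma tendsto_in_prob_expectation:
  fixes f :: "real \<Rightarrow> real"
  assumes [measurable]: "\<And>n. X n \<in> borel_measurable M" "Z \<in> borel_measurable M"
    and X: "tendsto_in_prob M X Z F"
    and f: "uniformly_continuous_on UNIV f" and f01: "\<And>x. 0 \<le> f x" "\<And>x. f x \<le> 1"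
  shows "((\<lambda>n. expectation (\<lambda>\<omega>. \<bar>f (X n \<omega>) - f (Z \<omega>)\<bar>)) \<longlongrightarrow> 0) F"
proof (rule tendstoI)
  fix e :: real assume e: "e > 0"
  have [measurable]: "f \<in> borel_measurable borel"
    using f by (intro borel_measurable_continuous_onI uniformly_continuous_imp_continuous)
  obtain d where d: "d > 0" "\<And>x y. dist x y < d \<Longrightarrow> dist (f x) (f y) < e / 2"
    using f e unfolding uniformly_continuous_on_def by (metis UNIV_I half_gt_zero)
  let ?A = "\<lambda>n. {\<omega> \<in> space M. \<bar>X n \<omega> - Z \<omega>\<bar> > d / 2}"
  have "\<forall>\<^sub>F n in F. dist (prob (?A n)) 0 < e / 2"
    by (rule tendstoD[OF X[unfolded tendsto_in_prob_def, rule_format, OF half_gt_zero[OF d(1)]] half_gt_zero[OF e]])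
  then show "\<forall>\<^sub>F n in F. dist (expectation (\<lambda>\<omega>. \<bar>f (X n \<omega>) - f (Z \<omega>)\<bar>)) 0 < e"
  proof eventually_elim
    case (elim n)
    have b: "\<bar>f (X n \<omega>) - f (Z \<omega>)\<bar> \<le> 1" for \<omega>
      using f01[of "X n \<omega>"] f01[of "Z \<omega>"] by linarith
    have int: "integrable M (indicator (?A n) :: _ \<Rightarrow> real)"
      by (intro integrable_const_bound[where B = 1]) (auto split: split_indicator)
    have "expectation (\<lambda>\<omega>. \<bar>f (X n \<omega>) - f (Z \<omega>)\<bar>) \<le> expectation (\<lambda>\<omega>. e / 2 + indicator (?A n) \<omega>)"
    proof (rule integral_mono)
      show "integrable M (\<lambda>\<omega>. \<bar>f (X n \<omega>) - f (Z \<omega>)\<bar>)"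
        by (rule integrable_const_bound[where B = 1]) (use b in auto)
      show "\<bar>f (X n \<omega>) - f (Z \<omega>)\<bar> \<le> e / 2 + indicator (?A n) \<omega>" if "\<omega> \<in> space M" for \<omega>
      proof (cases "\<omega> \<in> ?A n")
        case True
        then show ?thesis using b[of \<omega>] e by simp
      next
        case False
        then have "dist (f (X n \<omega>)) (f (Z \<omega>)) < e / 2" using that d by (intro d) (auto simp: dist_real_def)
        then show ?thesis using False by (simp add: dist_real_def)
      qed
      show "integrable M (\<lambda>\<omega>. e / 2 + indicator (?A n) \<omega>)" by (intro Bochner_Integration.integrable_add integrable_const int)
    qed
    also have "\<dots> = e / 2 + prob (?A n)"
      by (rule trans[OF Bochner_Integration.integral_add[OF integrable_const int]]) (simp add: prob_space)
    finally show ?case using elim by (simp add: integral_nonneg)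
  qed
qed

section \<open>Independence survives limits in probability\<close>

lemma cts_step_bounds: "a < b \<Longrightarrow> 0 \<le> cts_step a b x \<and> cts_step a b x \<le> 1"
  by (auto simp: cts_step_def field_simps)

text \<open>Independence is tested by expectations of products of uniformly continuous functions
  with values in \<open>[0, 1]\<close>: these factorise for each \<open>X n\<close>, hence in the
  limit. Continuous ramps converging to indicators of half-lines then carry the factorisation to a
  generator of the Borel sets that is closed under intersection.\<close>

lemma indep_vars_tendsto_in_prob:
  fixes X :: "nat \<Rightarrow> 'i \<Rightarrow> 'a \<Rightarrow> real"
  assumes "finite I" and indep: "\<And>n. indep_vars (\<lambda>_. borel) (X n) I"
    and Z: "\<And>i. i \<in> I \<Longrightarrow> Z i \<in> borel_measurable M"
    and lim: "\<And>i. i \<in> I \<Longrightarrow> tendsto_in_prob M (\<lambda>n. X n i) (Z i) sequentially"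
  shows "indep_vars (\<lambda>_. borel) Z I"
proof (cases "I = {}")
  case True
  then show ?thesis by (simp add: indep_vars_def indep_sets_def)
next
  case False
  have X: "X n i \<in> borel_measurable M" if "i \<in> I" for n i
    using indep[of n] that by (auto simp: indep_vars_def)
  have prod: "expectation (\<lambda>\<omega>. \<Prod>i\<in>I. f i (Z i \<omega>)) = (\<Prod>i\<in>I. expectation (\<lambda>\<omega>. f i (Z i \<omega>)))"
    if f: "\<And>i. i \<in> I \<Longrightarrow> uniformly_continuous_on UNIV (f i)"
      and f01: "\<And>i x. 0 \<le> f i x" "\<And>i x. f i x \<le> 1" for f :: "'i \<Rightarrow> real \<Rightarrow> real"
  proof -
    have fm: "f i \<in> borel_measurable borel" if "i \<in> I" for i
      using f[OF that] by (intro borel_measurable_continuous_onI uniformly_continuous_imp_continuous)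
    have mX: "(\<lambda>\<omega>. f i (X n i \<omega>)) \<in> borel_measurable M" if "i \<in> I" for i n
      by (rule measurable_compose[OF X[OF that] fm[OF that]])
    have mZ: "(\<lambda>\<omega>. f i (Z i \<omega>)) \<in> borel_measurable M" if "i \<in> I" for i
      by (rule measurable_compose[OF Z[OF that] fm[OF that]])
    have b: "norm (f i x) \<le> 1" for i x using f01 by simp
    have intX: "integrable M (\<lambda>\<omega>. f i (X n i \<omega>))" if "i \<in> I" for i n
      by (rule integrable_const_bound[where B = 1]) (use b mX[OF that] in auto)
    have intZ: "integrable M (\<lambda>\<omega>. f i (Z i \<omega>))" if "i \<in> I" for i
      by (rule integrable_const_bound[where B = 1]) (use b mZ[OF that] in auto)
    have intD: "integrable M (\<lambda>\<omega>. \<bar>f i (X n i \<omega>) - f i (Z i \<omega>)\<bar>)" if "i \<in> I" for i n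
      using intX[OF that] intZ[OF that] by auto
    have pb: "norm (\<Prod>i\<in>I. f i (x i)) \<le> 1" for x
      by (simp add: f01 prod_nonneg prod_le_1)
    have intPX: "integrable M (\<lambda>\<omega>. \<Prod>i\<in>I. f i (X n i \<omega>))" for n
      by (rule integrable_const_bound[where B = 1]) (use pb mX in auto)
    have intPZ: "integrable M (\<lambda>\<omega>. \<Prod>i\<in>I. f i (Z i \<omega>))"
      by (rule integrable_const_bound[where B = 1]) (use pb mZ in auto)
    have lim1: "(\<lambda>n. expectation (\<lambda>\<omega>. \<bar>f i (X n i \<omega>) - f i (Z i \<omega>)\<bar>)) \<longlonglongrightarrow> 0" if "i \<in> I" for i
      by (rule tendsto_in_prob_expectation) (use X Z lim f f01 that in auto)
    have limE: "(\<lambda>n. expectation (\<lambda>\<omega>. f i (X n i \<omega>))) \<longlonglongrightarrow> expectation (\<lambda>\<omega>. f i (Z i \<omega>))" if "i \<in> I" for i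
    proof (rule Lim_null_comparison[OF _ lim1[OF that], THEN LIM_zero_cancel], rule always_eventually, rule allI)
      fix n
      have "expectation (\<lambda>\<omega>. f i (X n i \<omega>)) - expectation (\<lambda>\<omega>. f i (Z i \<omega>))
          = expectation (\<lambda>\<omega>. f i (X n i \<omega>) - f i (Z i \<omega>))"
        using intX[OF that] intZ[OF that] by simp
      then show "norm (expectation (\<lambda>\<omega>. f i (X n i \<omega>)) - expectation (\<lambda>\<omega>. f i (Z i \<omega>)))
          \<le> expectation (\<lambda>\<omega>. \<bar>f i (X n i \<omega>) - f i (Z i \<omega>)\<bar>)"
        using integral_abs_bound[of M "\<lambda>\<omega>. f i (X n i \<omega>) - f i (Z i \<omega>)"] by simp
    qed
    have limP: "(\<lambda>n. expectation (\<lambda>\<omega>. \<Prod>i\<in>I. f i (X n i \<omega>))) \<longlonglongrightarrow> expectation (\<lambda>\<omega>. \<Prod>i\<in>I. f i (Z i \<omega>))"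
    proof (rule Lim_null_comparison[THEN LIM_zero_cancel], rule always_eventually, rule allI)
      show "(\<lambda>n. \<Sum>i\<in>I. expectation (\<lambda>\<omega>. \<bar>f i (X n i \<omega>) - f i (Z i \<omega>)\<bar>)) \<longlonglongrightarrow> 0"
        using lim1 by (rule tendsto_null_sum)
      fix n
      have "norm (expectation (\<lambda>\<omega>. \<Prod>i\<in>I. f i (X n i \<omega>)) - expectation (\<lambda>\<omega>. \<Prod>i\<in>I. f i (Z i \<omega>)))
          = \<bar>expectation (\<lambda>\<omega>. (\<Prod>i\<in>I. f i (X n i \<omega>)) - (\<Prod>i\<in>I. f i (Z i \<omega>)))\<bar>"
        using intPX intPZ by simp
      also have "\<dots> \<le> expectation (\<lambda>\<omega>. \<bar>(\<Prod>i\<in>I. f i (X n i \<omega>)) - (\<Prod>i\<in>I. f i (Z i \<omega>))\<bar>)"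
        by (rule integral_abs_bound)
      \<comment> \<open>A difference of two products whose factors have norm at most 1 is bounded by
        the sum of the differences of the factors.\<close>
      also have "\<dots> \<le> expectation (\<lambda>\<omega>. \<Sum>i\<in>I. \<bar>f i (X n i \<omega>) - f i (Z i \<omega>)\<bar>)"
      proof (rule integral_mono)
        show "\<bar>(\<Prod>i\<in>I. f i (X n i \<omega>)) - (\<Prod>i\<in>I. f i (Z i \<omega>))\<bar> \<le> (\<Sum>i\<in>I. \<bar>f i (X n i \<omega>) - f i (Z i \<omega>)\<bar>)" for \<omega>
          using norm_prod_diff[of I "\<lambda>i. f i (X n i \<omega>)" "\<lambda>i. f i (Z i \<omega>)"] b by simp
      qed (use intPX intPZ intD in auto)
      also have "\<dots> = (\<Sum>i\<in>I. expectation (\<lambda>\<omega>. \<bar>f i (X n i \<omega>) - f i (Z i \<omega>)\<bar>))"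
        using intD by simp
      finally show "norm (expectation (\<lambda>\<omega>. \<Prod>i\<in>I. f i (X n i \<omega>)) - expectation (\<lambda>\<omega>. \<Prod>i\<in>I. f i (Z i \<omega>)))
          \<le> (\<Sum>i\<in>I. expectation (\<lambda>\<omega>. \<bar>f i (X n i \<omega>) - f i (Z i \<omega>)\<bar>))" .
    qed
    have "expectation (\<lambda>\<omega>. \<Prod>i\<in>I. f i (X n i \<omega>)) = (\<Prod>i\<in>I. expectation (\<lambda>\<omega>. f i (X n i \<omega>)))" for n
      by (rule indep_vars_lebesgue_integral[OF \<open>finite I\<close> indep_vars_compose2[OF indep fm] intX])
    then have "(\<lambda>n. expectation (\<lambda>\<omega>. \<Prod>i\<in>I. f i (X n i \<omega>))) \<longlonglongrightarrow> (\<Prod>i\<in>I. expectation (\<lambda>\<omega>. f i (Z i \<omega>)))"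
      using limE by (simp add: tendsto_prod)
    then show ?thesis by (rule LIMSEQ_unique[OF limP])
  qed
  \<comment> \<open>The whole line is included because the criterion for finite families wants the
    full space in the generator.\<close>
  define E where "E = insert UNIV (range (atMost :: real \<Rightarrow> real set))"
  have approx: "\<exists>g :: nat \<Rightarrow> real \<Rightarrow> real. (\<forall>k. uniformly_continuous_on UNIV (g k) \<and> (\<forall>x. 0 \<le> g k x \<and> g k x \<le> 1))
      \<and> (\<forall>x. (\<lambda>k. g k x) \<longlonglongrightarrow> indicator A x)" if AE: "A \<in> E" for A
  proof (cases "A = UNIV")
    case True
    then show ?thesis by (intro exI[of _ "\<lambda>_ _. 1"]) (auto simp: uniformly_continuous_on_const)
  next
    case False
    then obtain a where a: "A = {..a}" using AE unfolding E_def by blast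
    let ?g = "\<lambda>k. cts_step a (a + inverse (real (Suc k)))"
    have "(\<lambda>k. ?g k x) \<longlonglongrightarrow> indicator A x" for x
    proof (cases "x \<le> a")
      case True
      then show ?thesis by (simp add: cts_step_def a)
    next
      case False
      have "(\<lambda>k. a + inverse (real (Suc k))) \<longlonglongrightarrow> a + 0" by (intro tendsto_intros LIMSEQ_inverse_real_of_nat)
      then have "\<forall>\<^sub>F k in sequentially. a + inverse (real (Suc k)) < x"
        using False by (intro order_tendstoD) auto
      then have "\<forall>\<^sub>F k in sequentially. ?g k x = 0"
        by eventually_elim (use False in \<open>simp add: cts_step_def\<close>)
      then show ?thesis using False by (simp add: a tendsto_eventually)
    qed
    moreover have "uniformly_continuous_on UNIV (?g k)" for k
      by (intro cts_step_uniformly_continuous) auto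
    moreover have "0 \<le> ?g k x \<and> ?g k x \<le> 1" for k x
      using cts_step_bounds[of a "a + inverse (real (Suc k))" x] by simp
    ultimately show ?thesis by (intro exI[of _ ?g]) simp
  qed
  have sets_E: "sets borel = sigma_sets UNIV E"
  proof -
    have "sigma_sets UNIV E = sigma_sets UNIV (range atMost)"
      unfolding E_def by (intro sigma_sets_eqI) (auto intro: sigma_sets_top)
    then show ?thesis by (simp add: borel_eq_atMost)
  qed
  have "prob (\<Inter>j\<in>I. Z j -` A j \<inter> space M) = (\<Prod>j\<in>I. prob (Z j -` A j \<inter> space M))"
    if A: "A \<in> (\<Pi> i\<in>I. E)" for A
  proof -
    have "\<forall>i\<in>I. \<exists>g :: nat \<Rightarrow> real \<Rightarrow> real. (\<forall>k. uniformly_continuous_on UNIV (g k) \<and> (\<forall>x. 0 \<le> g k x \<and> g k x \<le> 1))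
      \<and> (\<forall>x. (\<lambda>k. g k x) \<longlonglongrightarrow> indicator (A i) x)"
      using approx A by auto
    then obtain g :: "'i \<Rightarrow> nat \<Rightarrow> real \<Rightarrow> real" where g: "\<And>i k. i \<in> I \<Longrightarrow> uniformly_continuous_on UNIV (g i k)"
      "\<And>i k x. i \<in> I \<Longrightarrow> 0 \<le> g i k x" "\<And>i k x. i \<in> I \<Longrightarrow> g i k x \<le> 1"
      "\<And>i x. i \<in> I \<Longrightarrow> (\<lambda>k. g i k x) \<longlonglongrightarrow> indicator (A i) x"
      by metis
    have gm: "g i k \<in> borel_measurable borel" if "i \<in> I" for i k
      using g(1)[OF that] by (intro borel_measurable_continuous_onI uniformly_continuous_imp_continuous)
    have mZ: "(\<lambda>\<omega>. g i k (Z i \<omega>)) \<in> borel_measurable M" if "i \<in> I" for i k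
      by (rule measurable_compose[OF Z[OF that] gm[OF that]])
    have Am: "A i \<in> sets borel" if "i \<in> I" for i
      using A that by (auto simp: E_def Pi_iff)
    have ZA: "Z i -` A i \<inter> space M \<in> sets M" if "i \<in> I" for i
      by (rule measurable_sets[OF Z[OF that] Am[OF that]])
    have eq: "expectation (\<lambda>\<omega>. \<Prod>i\<in>I. g i k (Z i \<omega>)) = (\<Prod>i\<in>I. expectation (\<lambda>\<omega>. g i k (Z i \<omega>)))" for k
    proof -
      \<comment> \<open>The fact \<open>prod\<close> asks for bounds at every index, while
        \<open>g\<close> is controlled on \<open>I\<close> only; outside \<open>I\<close> it is
        replaced by 0.\<close>
      have "expectation (\<lambda>\<omega>. \<Prod>i\<in>I. (if i \<in> I then g i k else (\<lambda>_. 0)) (Z i \<omega>))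
          = (\<Prod>i\<in>I. expectation (\<lambda>\<omega>. (if i \<in> I then g i k else (\<lambda>_. 0)) (Z i \<omega>)))"
        by (rule prod) (use g in auto)
      then show ?thesis by simp
    qed
    have "(\<lambda>k. expectation (\<lambda>\<omega>. \<Prod>i\<in>I. g i k (Z i \<omega>))) \<longlonglongrightarrow> expectation (\<lambda>\<omega>. \<Prod>i\<in>I. indicator (A i) (Z i \<omega>))"
    proof (rule integral_dominated_convergence[where w = "\<lambda>_. 1"])
      show "(\<lambda>\<omega>. \<Prod>i\<in>I. indicator (A i) (Z i \<omega>) :: real) \<in> borel_measurable M"
        by (intro borel_measurable_prod measurable_compose[OF Z]) (use Am in auto)
      show "AE \<omega> in M. (\<lambda>k. \<Prod>i\<in>I. g i k (Z i \<omega>)) \<longlonglongrightarrow> (\<Prod>i\<in>I. indicator (A i) (Z i \<omega>))"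
        by (intro always_eventually allI tendsto_prod g)
      show "AE \<omega> in M. norm (\<Prod>i\<in>I. g i k (Z i \<omega>)) \<le> 1" for k
        using g by (intro always_eventually allI) (simp add: prod_nonneg prod_le_1)
    qed (use mZ in auto)
    moreover have "(\<lambda>k. \<Prod>i\<in>I. expectation (\<lambda>\<omega>. g i k (Z i \<omega>))) \<longlonglongrightarrow> (\<Prod>i\<in>I. expectation (\<lambda>\<omega>. indicator (A i) (Z i \<omega>)))"
    proof (intro tendsto_prod integral_dominated_convergence[where w = "\<lambda>_. 1"])
      fix i assume i: "i \<in> I"
      show "(\<lambda>\<omega>. indicator (A i) (Z i \<omega>) :: real) \<in> borel_measurable M"
        by (intro measurable_compose[OF Z]) (use Am i in auto)
    qed (use mZ g in auto)
    ultimately have "expectation (\<lambda>\<omega>. \<Prod>i\<in>I. indicator (A i) (Z i \<omega>)) = (\<Prod>i\<in>I. expectation (\<lambda>\<omega>. indicator (A i) (Z i \<omega>) :: real))"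
      unfolding eq by (rule LIMSEQ_unique)
    moreover have "expectation (\<lambda>\<omega>. \<Prod>i\<in>I. indicator (A i) (Z i \<omega>)) = prob (\<Inter>j\<in>I. Z j -` A j \<inter> space M)"
    proof -
      have "expectation (\<lambda>\<omega>. \<Prod>i\<in>I. indicator (A i) (Z i \<omega>) :: real) = expectation (indicator (\<Inter>j\<in>I. Z j -` A j \<inter> space M))"
      proof (intro Bochner_Integration.integral_cong refl)
        fix \<omega> assume \<omega>: "\<omega> \<in> space M"
        show "(\<Prod>i\<in>I. indicator (A i) (Z i \<omega>)) = (indicator (\<Inter>j\<in>I. Z j -` A j \<inter> space M) \<omega> :: real)"
        proof (cases "\<forall>i\<in>I. Z i \<omega> \<in> A i")
          case True
          then show ?thesis using \<omega> \<open>I \<noteq> {}\<close> by simp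
        next
          case False
          then obtain i where "i \<in> I" "Z i \<omega> \<notin> A i" by blast
          then have "(\<Prod>i\<in>I. indicator (A i) (Z i \<omega>) :: real) = 0"
            using \<open>finite I\<close> by (intro prod_zero) (auto intro!: bexI[of _ i])
          moreover have "\<omega> \<notin> (\<Inter>j\<in>I. Z j -` A j \<inter> space M)" using \<open>i \<in> I\<close> \<open>Z i \<omega> \<notin> A i\<close> by auto
          ultimately show ?thesis by simp
        qed
      qed
      moreover have "(\<Inter>j\<in>I. Z j -` A j \<inter> space M) \<in> sets M"
        using ZA \<open>finite I\<close> \<open>I \<noteq> {}\<close> by (intro sets.finite_INT) auto
      ultimately show ?thesis using \<open>I \<noteq> {}\<close> by simp
    qed
    moreover have "expectation (\<lambda>\<omega>. indicator (A i) (Z i \<omega>) :: real) = prob (Z i -` A i \<inter> space M)" if "i \<in> I" for i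
    proof -
      have "expectation (\<lambda>\<omega>. indicator (A i) (Z i \<omega>) :: real) = expectation (indicator (Z i -` A i \<inter> space M))"
        by (intro Bochner_Integration.integral_cong) (auto simp: indicator_def)
      then show ?thesis using ZA[OF that] by simp
    qed
    ultimately show ?thesis by simp
  qed
  moreover have "Int_stable E"
    unfolding E_def by (auto simp: Int_stable_def)
  ultimately show ?thesis
    using \<open>finite I\<close> False Z sets_E
    by (subst indep_vars_finite[where E = "\<lambda>_. E"]) (auto simp: E_def)
qed

section \<open>Pathwise integrals of processes with independent increments\<close>

text \<open>The Stieltjes sums for different intervals use disjoint blocks of increments of
  \<open>W\<close> over one common partition, so they are independent, and independence passes to
  their limits. The summand \<open>K\<close> cancels from the increments and may therefore depend on
  \<open>W\<close> in any way.\<close>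

lemma independent_increments_path_integral:
  assumes W: "process M UNIV W" "independent_increments M UNIV W"
    and cadlag: "AE \<omega> in M. cadlag_on UNIV (\<lambda>t. W t \<omega>)"
    and Y: "process M UNIV Y"
    and eq: "AE \<omega> in M. \<forall>t. Y t \<omega> = K \<omega> + path_integral (\<lambda>s. exp (a * s)) (\<lambda>s. W s \<omega>) 0 t"
  shows "independent_increments M UNIV Y"
  unfolding independent_increments_def
proof (intro allI impI, elim conjE)
  fix n and t :: "nat \<Rightarrow> real"
  assume t: "\<forall>i<n. t i < t (Suc i)"
  \<comment> \<open>All meshes are strung together: index \<open>i * Suc m + j\<close> is point
    \<open>j\<close> of the mesh of the \<open>i\<close>-th interval, and the last point of one mesh
    is the first point of the next.\<close>
  define v where "v m l = mesh (t (l div Suc m)) (t (Suc (l div Suc m))) m (l mod Suc m)" for m l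
  have v: "v m (i * Suc m + j) = mesh (t i) (t (Suc i)) m j" if "j \<le> Suc m" for m i j
  proof (cases "j = Suc m")
    case True
    then have "i * Suc m + j = Suc i * Suc m" by simp
    then show ?thesis
      unfolding v_def by (simp only: div_mult_self_is_m mod_mult_self2_is_0 zero_less_Suc mesh_0 True mesh_Suc_self)
  next
    case False
    then have "(i * Suc m + j) div Suc m = i" "(i * Suc m + j) mod Suc m = j"
      using that by (simp_all only: div_mult_self3 mod_mult_self3 div_less mod_less)
    then show ?thesis unfolding v_def by simp
  qed
  have v_Suc: "v m l < v m (Suc l)" if "l < n * Suc m" for m l
  proof -
    define i j where "i = l div Suc m" and "j = l mod Suc m"
    have l: "l = i * Suc m + j" unfolding i_def j_def by (rule div_mult_mod_eq[symmetric])
    have j: "j < Suc m" unfolding j_def by simp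
    have "i < n" unfolding i_def using that by (simp add: less_mult_imp_div_less)
    then show ?thesis
      using v[of j m i] v[of "Suc j" m i] j t mesh_less_mesh[of "t i" "t (Suc i)" j "Suc j" m]
      by (simp add: l)
  qed
  define D where "D m l \<omega> = W (v m (Suc l)) \<omega> - W (v m l) \<omega>" for m l \<omega>
  define S where "S m i \<omega> = (\<Sum>j<Suc m. exp (a * v m (i * Suc m + j)) * D m (i * Suc m + j) \<omega>)" for m i \<omega>
  have indep_S: "indep_vars (\<lambda>_. borel) (S m) {..<n}" for m
  proof -
    let ?K = "\<lambda>i. {i * Suc m..<Suc i * Suc m}"
    let ?F = "\<lambda>i f. \<Sum>j<Suc m. exp (a * v m (i * Suc m + j)) * f (i * Suc m + j)"
    have "indep_vars (\<lambda>_. borel) (D m) {..<n * Suc m}"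
      unfolding D_def by (rule independent_increments_indep_vars[OF W(2)]) (use v_Suc in auto)
    \<comment> \<open>Disjoint blocks of independent variables are independent, and
      \<open>S m i\<close> is a function of block \<open>i\<close> alone.\<close>
    then have "indep_vars (\<lambda>i. PiM (?K i) (\<lambda>_. borel)) (\<lambda>i \<omega>. restrict (\<lambda>l. D m l \<omega>) (?K i)) {..<n}"
    proof (rule indep_vars_restrict)
      fix i assume "i \<in> {..<n}"
      then have "Suc i * Suc m \<le> n * Suc m" by (intro mult_le_mono1) auto
      then show "?K i \<subseteq> {..<n * Suc m}" by auto
    next
      show "disjoint_family_on ?K {..<n}"
      proof (unfold disjoint_family_on_def, intro ballI impI)
        fix i i' :: nat assume "i \<noteq> i'"
        then consider "Suc i \<le> i'" | "Suc i' \<le> i" by linarith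
        then show "?K i \<inter> ?K i' = {}"
        proof cases
          case 1
          then have "Suc i * Suc m \<le> i' * Suc m" by (rule mult_le_mono1)
          then show ?thesis by auto
        next
          case 2
          then have "Suc i' * Suc m \<le> i * Suc m" by (rule mult_le_mono1)
          then show ?thesis by auto
        qed
      qed
    qed
    then have "indep_vars (\<lambda>_. borel) (\<lambda>i \<omega>. ?F i (restrict (\<lambda>l. D m l \<omega>) (?K i))) {..<n}"
      by (rule indep_vars_compose2)
         (intro borel_measurable_sum borel_measurable_times measurable_const measurable_component_singleton, auto)
    moreover have "?F i (restrict (\<lambda>l. D m l \<omega>) (?K i)) = S m i \<omega>" for i \<omega>
      unfolding S_def by (intro sum.cong) auto
    ultimately show ?thesis by simp
  qed
  show "indep_vars (\<lambda>_. borel) (\<lambda>i \<omega>. Y (t (Suc i)) \<omega> - Y (t i) \<omega>) {..<n}"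
  proof (rule indep_vars_tendsto_in_prob[OF _ indep_S])
    fix i assume "i \<in> {..<n}"
    then have ti: "t i < t (Suc i)" using t by auto
    show meas: "(\<lambda>\<omega>. Y (t (Suc i)) \<omega> - Y (t i) \<omega>) \<in> borel_measurable M"
      using Y by (auto simp: process_def intro!: borel_measurable_diff)
    show "tendsto_in_prob M (\<lambda>m. S m i) (\<lambda>\<omega>. Y (t (Suc i)) \<omega> - Y (t i) \<omega>) sequentially"
    proof (rule tendsto_in_prob_AE[OF _ meas])
      show "S m i \<in> borel_measurable M" for m
        using indep_S[of m] \<open>i \<in> {..<n}\<close> by (auto simp: indep_vars_def)
      show "AE \<omega> in M. (\<lambda>m. S m i \<omega>) \<longlonglongrightarrow> Y (t (Suc i)) \<omega> - Y (t i) \<omega>"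
        using cadlag eq
      proof eventually_elim
        case (elim \<omega>)
        let ?y = "\<lambda>s. W s \<omega>" and ?p = "t i" and ?q = "t (Suc i)"
        have S: "S m i \<omega> = (\<Sum>j<Suc m. exp (a * mesh ?p ?q m j) * (?y (mesh ?p ?q m (Suc j)) - ?y (mesh ?p ?q m j)))" for m
          unfolding S_def D_def
        proof (intro sum.cong refl)
          fix j assume "j \<in> {..<Suc m}"
          then show "exp (a * v m (i * Suc m + j)) * (W (v m (Suc (i * Suc m + j))) \<omega> - W (v m (i * Suc m + j)) \<omega>) =
              exp (a * mesh ?p ?q m j) * (?y (mesh ?p ?q m (Suc j)) - ?y (mesh ?p ?q m j))"
            using v[of j m i] v[of "Suc j" m i] by simp
        qed
        have "Y ?q \<omega> - Y ?p \<omega> = path_integral (\<lambda>s. exp (a * s)) ?y ?p ?q"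
          using elim(2) path_integral_exp_diff[OF elim(1), of a ?q ?p] by simp
        also have "\<dots> = exp (a * ?q) * ?y ?q - exp (a * ?p) * ?y ?p - integral {?p..?q} (\<lambda>s. a * exp (a * s) * ?y s)"
          using signed_integral_diff[OF cadlag_exp_integrable[OF elim(1)], of ?p ?q a] ti
          by (simp add: path_integral_exp[OF elim(1)])
        finally show ?case
          unfolding S
          using cadlag_stieltjes_sums[OF elim(1) has_real_derivative_exp_scaled continuous_on_exp_scaled ti] by simp
      qed
    qed
  qed simp
qed

text \<open>The increment of \<open>Y\<close> splits into
  \<open>exp (a * S i) * (W (S i) - W s)\<close>, which tends to 0 in probability, and a remainder
  in which \<open>W\<close> enters only through its value at \<open>s\<close> and a continuous
  antiderivative; this remainder tends to 0 almost surely.\<close>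

lemma stochastic_continuity_path_integral:
  assumes W: "process M UNIV W" "tendsto_in_prob M W (W s) (at s)"
    and cadlag: "AE \<omega> in M. cadlag_on UNIV (\<lambda>t. W t \<omega>)"
    and Y: "process M UNIV Y"
    and eq: "AE \<omega> in M. \<forall>t. Y t \<omega> = K \<omega> + path_integral (\<lambda>s. exp (a * s)) (\<lambda>s. W s \<omega>) 0 t"
  shows "tendsto_in_prob M Y (Y s) (at s)"
proof (rule tendsto_in_prob_at_sequentiallyI)
  fix S assume S: "\<And>i. S i \<in> UNIV - {s}" "S \<longlonglongrightarrow> s"
  have [measurable]: "W t \<in> borel_measurable M" "Y t \<in> borel_measurable M" for t
    using W(1) Y by (auto simp: process_def)
  have expS: "(\<lambda>i. exp (a * S i)) \<longlonglongrightarrow> exp (a * s)" by (intro tendsto_intros S)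
  have "filterlim S (at s) sequentially"
    using S by (auto simp: filterlim_at)
  from tendsto_in_prob_compose[OF W(2) this]
  have "tendsto_in_prob M (\<lambda>i \<omega>. W (S i) \<omega> - W s \<omega>) (\<lambda>_. 0) sequentially"
    by (subst tendsto_in_prob_diff_iff[symmetric])
  then have 1: "tendsto_in_prob M (\<lambda>i \<omega>. exp (a * S i) * (W (S i) \<omega> - W s \<omega>)) (\<lambda>_. 0) sequentially"
  proof (rule tendsto_in_prob_mult_bounded[rotated])
    have "\<forall>\<^sub>F i in sequentially. exp (a * S i) < exp (a * s) + 1"
      using expS by (intro order_tendstoD) auto
    then show "\<forall>\<^sub>F i in sequentially. \<bar>exp (a * S i)\<bar> \<le> exp (a * s) + 1"
      by eventually_elim auto
  qed measurable
  have 2: "tendsto_in_prob M (\<lambda>i \<omega>. Y (S i) \<omega> - Y s \<omega> - exp (a * S i) * (W (S i) \<omega> - W s \<omega>)) (\<lambda>_. 0) sequentially"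
  proof (rule tendsto_in_prob_AE)
    show "AE \<omega> in M. (\<lambda>i. Y (S i) \<omega> - Y s \<omega> - exp (a * S i) * (W (S i) \<omega> - W s \<omega>)) \<longlonglongrightarrow> 0"
      using cadlag eq
    proof eventually_elim
      case (elim \<omega>)
      define P where "P = signed_integral (\<lambda>t. a * exp (a * t) * W t \<omega>)"
      have "continuous_on UNIV P"
        unfolding P_def by (intro continuous_signed_integral cadlag_exp_integrable elim)
      then have "isCont P s" by (simp add: continuous_on_eq_continuous_at)
      then have "(\<lambda>i. P (S i)) \<longlonglongrightarrow> P s" using S(2) by (rule isCont_tendsto_compose)
      then have "(\<lambda>i. (exp (a * S i) - exp (a * s)) * W s \<omega> - (P (S i) - P s)) \<longlonglongrightarrow>
          (exp (a * s) - exp (a * s)) * W s \<omega> - (P s - P s)"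
        by (intro tendsto_intros expS)
      moreover have "Y (S i) \<omega> - Y s \<omega> = exp (a * S i) * W (S i) \<omega> - exp (a * s) * W s \<omega> - (P (S i) - P s)" for i
        unfolding P_def path_integral_exp[OF elim(1), symmetric]
        using elim(2) path_integral_exp_diff[OF elim(1), of a "S i" s] by simp
      then have "Y (S i) \<omega> - Y s \<omega> - exp (a * S i) * (W (S i) \<omega> - W s \<omega>) =
          (exp (a * S i) - exp (a * s)) * W s \<omega> - (P (S i) - P s)" for i
        by (simp add: algebra_simps)
      ultimately show ?case by simp
    qed
  qed measurable
  have "tendsto_in_prob M (\<lambda>i \<omega>. Y (S i) \<omega> - Y s \<omega> - exp (a * S i) * (W (S i) \<omega> - W s \<omega>)
      + exp (a * S i) * (W (S i) \<omega> - W s \<omega>)) (\<lambda>_. 0 + 0) sequentially"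
    by (rule tendsto_in_prob_add[OF _ _ _ _ 2 1]) measurable
  then show "tendsto_in_prob M (\<lambda>i. Y (S i)) (Y s) sequentially"
    by (subst tendsto_in_prob_diff_iff) simp
qed

lemma cadlag_path_integral_process:
  assumes "AE \<omega> in M. cadlag_on UNIV (\<lambda>t. W t \<omega>)"
    and "AE \<omega> in M. \<forall>t. Y t \<omega> = K \<omega> + path_integral (\<lambda>s. exp (a * s)) (\<lambda>s. W s \<omega>) 0 t"
  shows "AE \<omega> in M. cadlag_on UNIV (\<lambda>t. Y t \<omega>)"
  using assms
proof eventually_elim
  case (elim \<omega>)
  then have "(\<lambda>t. Y t \<omega>) = (\<lambda>t. K \<omega> + path_integral (\<lambda>s. exp (a * s)) (\<lambda>s. W s \<omega>) 0 t)" by simp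
  then show ?case
    using cadlag_on_UNIV_add[OF cadlag_on_continuous[OF continuous_on_const] cadlag_on_path_integral_exp[OF elim(1)]]
    by simp
qed

section \<open>The maximal inequality and paths near time 0\<close>

text \<open>Decompose by the first index \<open>k\<close> with
  \<open>\<bar>S k \<omega>\<bar> > 2 * e\<close>. The displacement from \<open>k\<close> to
  \<open>n\<close> is independent of that event and at most \<open>e\<close> with probability at
  least one half, and when both occur \<open>\<bar>S n \<omega>\<bar> > e\<close>. So the disjoint
  first passage events together weigh at most twice the event on the right.\<close>

lemma ottaviani_inequality:
  fixes D :: "nat \<Rightarrow> 'a \<Rightarrow> real"
  assumes indep: "indep_vars (\<lambda>_. borel) D {..<n}"
    and S: "\<And>k \<omega>. k \<le> n \<Longrightarrow> S k \<omega> = (\<Sum>i<k. D i \<omega>)"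
    and half: "\<And>k. k \<le> n \<Longrightarrow> prob {\<omega> \<in> space M. \<bar>S n \<omega> - S k \<omega>\<bar> > e} \<le> 1 / 2"
  shows "prob {\<omega> \<in> space M. \<exists>k\<le>n. \<bar>S k \<omega>\<bar> > 2 * e} \<le> 2 * prob {\<omega> \<in> space M. \<bar>S n \<omega>\<bar> > e}"
proof -
  have D: "D i \<in> borel_measurable M" if "i < n" for i
    using indep that by (auto simp: indep_vars_def)
  have Sm: "S k \<in> borel_measurable M" if "k \<le> n" for k
  proof -
    have "S k = (\<lambda>\<omega>. \<Sum>i<k. D i \<omega>)" using S[OF that] by auto
    then show ?thesis using D that by simp
  qed
  define E where "E k = {\<omega> \<in> space M. \<bar>S k \<omega>\<bar> > 2 * e \<and> (\<forall>j<k. \<bar>S j \<omega>\<bar> \<le> 2 * e)}" for k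
  define G where "G k = {\<omega> \<in> space M. \<bar>S n \<omega> - S k \<omega>\<bar> \<le> e}" for k
  have ES: "E k \<in> events" and GS: "G k \<in> events" if "k \<le> n" for k
  proof -
    have [measurable]: "S k \<in> borel_measurable M" "S n \<in> borel_measurable M" "j < k \<Longrightarrow> S j \<in> borel_measurable M" for j
      using Sm that by auto
    have "E k = {\<omega> \<in> space M. \<bar>S k \<omega>\<bar> > 2 * e} \<inter> {\<omega> \<in> space M. \<forall>j\<in>{..<k}. \<bar>S j \<omega>\<bar> \<le> 2 * e}"
      by (auto simp: E_def)
    also have "\<dots> \<in> events"
      by (intro sets.Int sets.sets_Collect_finite_All) auto
    finally show "E k \<in> events" .
    show "G k \<in> events" unfolding G_def by measurable
  qed
  have EG: "prob (E k) \<le> 2 * prob (E k \<inter> G k)" if k: "k \<le> n" for k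
  proof -
    \<comment> \<open>Independence is given for the increments, so past and future of
      \<open>k\<close> are rewritten as events of the increments with index below \<open>k\<close>
      and from \<open>k\<close> on.\<close>
    let ?A = "{x \<in> space (PiM {..<k} (\<lambda>_. borel)). \<bar>\<Sum>i<k. x i\<bar> > 2 * e \<and> (\<forall>j\<in>{..<k}. \<bar>\<Sum>i<j. x i\<bar> \<le> 2 * e)} :: (nat \<Rightarrow> real) set"
    let ?B = "{x \<in> space (PiM {k..<n} (\<lambda>_. borel)). \<bar>\<Sum>i=k..<n. x i\<bar> \<le> e} :: (nat \<Rightarrow> real) set"
    let ?f = "\<lambda>\<omega>. restrict (\<lambda>i. D i \<omega>) {..<k}" and ?g = "\<lambda>\<omega>. restrict (\<lambda>i. D i \<omega>) {k..<n}"
    have "indep_var (PiM {..<k} (\<lambda>_. borel)) ?f (PiM {k..<n} (\<lambda>_. borel)) ?g"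
      by (rule indep_var_restrict[OF indep]) (use k in auto)
    moreover have "?A \<in> sets (PiM {..<k} (\<lambda>_. borel))"
    proof -
      have c: "(\<lambda>x. \<Sum>i<j. x i) \<in> borel_measurable (PiM {..<k} (\<lambda>_. borel :: real measure))" if "j \<le> k" for j
        using that by (intro borel_measurable_sum measurable_component_singleton) auto
      have "?A = {x \<in> space (PiM {..<k} (\<lambda>_. borel)). \<bar>\<Sum>i<k. x i\<bar> > 2 * e} \<inter>
          {x \<in> space (PiM {..<k} (\<lambda>_. borel)). \<forall>j\<in>{..<k}. \<bar>\<Sum>i<j. x i\<bar> \<le> 2 * e}" by auto
      also have "\<dots> \<in> sets (PiM {..<k} (\<lambda>_. borel))"
      proof (intro sets.Int sets.sets_Collect_finite_All)
        show "{x \<in> space (PiM {..<k} (\<lambda>_. borel)). \<bar>\<Sum>i<k. x i\<bar> > 2 * e} \<in> sets (PiM {..<k} (\<lambda>_. borel :: real measure))"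
          using c[OF order_refl] by measurable
        show "{x \<in> space (PiM {..<k} (\<lambda>_. borel)). \<bar>\<Sum>i<j. x i\<bar> \<le> 2 * e} \<in> sets (PiM {..<k} (\<lambda>_. borel :: real measure))"
          if "j \<in> {..<k}" for j
          using c[OF less_imp_le[OF that[unfolded lessThan_iff]]] by measurable
      qed auto
      finally show ?thesis .
    qed
    moreover have "?B \<in> sets (PiM {k..<n} (\<lambda>_. borel))"
      by measurable
    ultimately have "prob ((\<lambda>\<omega>. (?f \<omega>, ?g \<omega>)) -` (?A \<times> ?B) \<inter> space M) =
        prob (?f -` ?A \<inter> space M) * prob (?g -` ?B \<inter> space M)"
      by (rule indep_varD)
    moreover have fA: "?f \<omega> \<in> ?A \<longleftrightarrow> \<bar>S k \<omega>\<bar> > 2 * e \<and> (\<forall>j<k. \<bar>S j \<omega>\<bar> \<le> 2 * e)" for \<omega>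
    proof -
      have "(\<Sum>i<j. ?f \<omega> i) = S j \<omega>" if "j \<le> k" for j
        using S[of j \<omega>] that k by (auto intro!: sum.cong)
      then show ?thesis by (auto simp: space_PiM)
    qed
    moreover have gB: "?g \<omega> \<in> ?B \<longleftrightarrow> \<bar>S n \<omega> - S k \<omega>\<bar> \<le> e" for \<omega>
    proof -
      have "{..<n} = {..<k} \<union> {k..<n}" using k by auto
      then have "(\<Sum>i<n. D i \<omega>) = (\<Sum>i<k. D i \<omega>) + (\<Sum>i=k..<n. D i \<omega>)"
        by (simp add: sum.union_disjoint ivl_disj_int)
      then have "(\<Sum>i=k..<n. ?g \<omega> i) = S n \<omega> - S k \<omega>" using S[of n \<omega>] S[of k \<omega>] k by simp
      then show ?thesis by (auto simp: space_PiM)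
    qed
    ultimately have "prob (E k \<inter> G k) = prob (E k) * prob (G k)"
    proof -
      have "(\<lambda>\<omega>. (?f \<omega>, ?g \<omega>)) -` (?A \<times> ?B) \<inter> space M = E k \<inter> G k"
        using fA gB by (auto simp: E_def G_def simp del: restrict_apply mem_Collect_eq)
      moreover have "?f -` ?A \<inter> space M = E k" "?g -` ?B \<inter> space M = G k"
        using fA gB by (auto simp: E_def G_def)
      ultimately show ?thesis
        using \<open>prob ((\<lambda>\<omega>. (?f \<omega>, ?g \<omega>)) -` (?A \<times> ?B) \<inter> space M) = _\<close> by simp
    qed
    moreover have "prob (G k) \<ge> 1 / 2"
    proof -
      have "G k = space M - {\<omega> \<in> space M. \<bar>S n \<omega> - S k \<omega>\<bar> > e}" by (auto simp: G_def)
      moreover have "{\<omega> \<in> space M. \<bar>S n \<omega> - S k \<omega>\<bar> > e} \<in> events"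
        using Sm[of n] Sm[OF k] by measurable
      ultimately show ?thesis using half[OF k] by (simp add: prob_compl)
    qed
    ultimately show ?thesis using mult_left_mono[of "1/2" "prob (G k)" "prob (E k)"] by simp
  qed
  have disj: "disjoint_family_on E {..n}"
  proof (unfold disjoint_family_on_def, intro ballI impI)
    fix i j :: nat assume "i \<noteq> j"
    then consider "i < j" | "j < i" by linarith
    then show "E i \<inter> E j = {}" by cases (force simp: E_def)+
  qed
  have "{\<omega> \<in> space M. \<exists>k\<le>n. \<bar>S k \<omega>\<bar> > 2 * e} = (\<Union>k\<in>{..n}. E k)"
  proof (intro equalityI subsetI)
    fix \<omega> assume "\<omega> \<in> {\<omega> \<in> space M. \<exists>k\<le>n. \<bar>S k \<omega>\<bar> > 2 * e}"
    then obtain k where k: "\<omega> \<in> space M" "k \<le> n" "\<bar>S k \<omega>\<bar> > 2 * e" by auto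
    define l where "l = (LEAST k. \<bar>S k \<omega>\<bar> > 2 * e)"
    have "\<bar>S l \<omega>\<bar> > 2 * e" unfolding l_def by (rule LeastI[of _ k]) (rule k)
    moreover have "l \<le> k" unfolding l_def by (rule Least_le) (rule k)
    moreover have "\<bar>S j \<omega>\<bar> \<le> 2 * e" if "j < l" for j
      using not_less_Least[of j "\<lambda>k. \<bar>S k \<omega>\<bar> > 2 * e"] that by (simp add: l_def)
    ultimately show "\<omega> \<in> (\<Union>k\<in>{..n}. E k)" using k by (auto simp: E_def intro!: bexI[of _ l])
  qed (auto simp: E_def)
  then have "prob {\<omega> \<in> space M. \<exists>k\<le>n. \<bar>S k \<omega>\<bar> > 2 * e} = (\<Sum>k\<le>n. prob (E k))"
    using finite_measure_finite_Union[OF _ _ disj] ES by auto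
  also have "\<dots> \<le> (\<Sum>k\<le>n. 2 * prob (E k \<inter> G k))"
    by (rule sum_mono) (use EG in auto)
  also have "\<dots> = 2 * prob (\<Union>k\<in>{..n}. E k \<inter> G k)"
  proof -
    have "disjoint_family_on (\<lambda>k. E k \<inter> G k) {..n}"
      using disj by (auto simp: disjoint_family_on_def)
    then have "prob (\<Union>k\<in>{..n}. E k \<inter> G k) = (\<Sum>k\<le>n. prob (E k \<inter> G k))"
      using ES GS by (intro finite_measure_finite_Union) auto
    then show ?thesis by (simp add: sum_distrib_left)
  qed
  also have "\<dots> \<le> 2 * prob {\<omega> \<in> space M. \<bar>S n \<omega>\<bar> > e}"
  proof -
    have "{\<omega> \<in> space M. \<bar>S n \<omega>\<bar> > e} \<in> events" using Sm[of n] by measurable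
    then show ?thesis
      by (intro mult_left_mono finite_measure_mono) (auto simp: E_def G_def)
  qed
  finally show ?thesis .
qed

text \<open>Ottaviani's inequality on the dyadic grids of \<open>[0, t]\<close> bounds the supremum of the
  process over \<open>(0, t]\<close> in terms of \<open>X t\<close>; letting \<open>t\<close> tend to \<open>0\<close> upgrades
  convergence in probability to almost sure convergence.\<close>

lemma independent_increments_tendsto_0_AE:
  assumes X: "process M {0..} X" "independent_increments M {0..} X"
    and X0: "\<And>\<omega>. X 0 \<omega> = 0"
    and prob0: "tendsto_in_prob M X (\<lambda>_. 0) (at_right 0)"
    and right: "AE \<omega> in M. \<forall>t>0. ((\<lambda>s. X s \<omega>) \<longlongrightarrow> X t \<omega>) (at_right t)"
  shows "AE \<omega> in M. ((\<lambda>s. X s \<omega>) \<longlongrightarrow> 0) (at_right 0)"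
proof -
  have Xm: "X t \<in> borel_measurable M" if "t \<ge> 0" for t
    using X(1) that by (auto simp: process_def)
  define g where "g t m k = t * real k / 2 ^ m" for t :: real and m k :: nat
  define C where "C e t = {\<omega> \<in> space M. \<exists>m. \<exists>k\<le>2 ^ m. \<bar>X (g t m k) \<omega>\<bar> > 2 * e}" for e t
  have g_nonneg: "g t m k \<ge> 0" if "t > 0" for t m k using that by (simp add: g_def)
  have small: "\<bar>X s \<omega>\<bar> \<le> 2 * e"
    if \<omega>: "\<omega> \<in> space M" "\<forall>t>0. ((\<lambda>s. X s \<omega>) \<longlongrightarrow> X t \<omega>) (at_right t)"
      and C: "\<omega> \<notin> C e t" and s: "0 < s" "s \<le> t" for \<omega> e s t
  proof -
    \<comment> \<open>The grid point next to \<open>s\<close> from the right: right continuity at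
      \<open>s > 0\<close> carries the bound from the grids to \<open>s\<close>.\<close>
    define r where "r m = g t m (nat \<lceil>s * 2 ^ m / t\<rceil>)" for m
    have t: "t > 0" using s by simp
    have pos: "real (nat \<lceil>s * 2 ^ m / t\<rceil>) = of_int \<lceil>s * 2 ^ m / t\<rceil>" for m
    proof -
      have "0 < s * 2 ^ m / t" using s t by simp
      then show ?thesis by simp
    qed
    have r_ge: "s \<le> r m" for m
    proof -
      have "s = t * (s * 2 ^ m / t) / 2 ^ m" using t by simp
      also have "\<dots> \<le> r m"
        unfolding r_def g_def pos using t by (intro divide_right_mono mult_left_mono) auto
      finally show ?thesis .
    qed
    have r_le: "r m \<le> s + t * inverse 2 ^ m" for m
    proof -
      have "r m \<le> t * (s * 2 ^ m / t + 1) / 2 ^ m"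
        unfolding r_def g_def pos using t by (intro divide_right_mono mult_left_mono) auto
      also have "\<dots> = s + t * inverse 2 ^ m" using t by (simp add: field_simps)
      finally show ?thesis .
    qed
    have "r \<longlonglongrightarrow> s"
    proof (rule real_tendsto_sandwich[where f = "\<lambda>_. s" and h = "\<lambda>m. s + t * inverse 2 ^ m"])
      have "(\<lambda>m. s + t * inverse 2 ^ m) \<longlonglongrightarrow> s + t * 0"
        by (intro tendsto_intros LIMSEQ_power_zero) auto
      then show "(\<lambda>m. s + t * inverse 2 ^ m) \<longlonglongrightarrow> s" by simp
    qed (use r_ge r_le in auto)
    moreover have "continuous (at s within {s..}) (\<lambda>s. X s \<omega>)"
      using \<omega> s by (simp add: continuous_within at_within_Ici_at_right)
    ultimately have "(\<lambda>m. X (r m) \<omega>) \<longlonglongrightarrow> X s \<omega>"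
      using r_ge unfolding continuous_within_sequentially by (auto simp: o_def)
    then have lim: "(\<lambda>m. \<bar>X (r m) \<omega>\<bar>) \<longlonglongrightarrow> \<bar>X s \<omega>\<bar>" by (rule tendsto_rabs)
    have "\<bar>X (r m) \<omega>\<bar> \<le> 2 * e" for m
    proof -
      have "\<lceil>s * 2 ^ m / t\<rceil> \<le> 2 ^ m"
        by (rule ceiling_le) (use s t in \<open>simp add: field_simps\<close>)
      then have "nat \<lceil>s * 2 ^ m / t\<rceil> \<le> 2 ^ m" by (simp add: nat_le_iff)
      then show ?thesis using C \<omega>(1) unfolding C_def r_def by fastforce
    qed
    then show ?thesis by (intro LIMSEQ_le_const2[OF lim]) blast
  qed
  have meas_B: "{\<omega> \<in> space M. \<exists>k\<le>2 ^ m. \<bar>X (g t m k) \<omega>\<bar> > 2 * e} \<in> events" if "t > 0" for e t m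
  proof -
    have "{\<omega> \<in> space M. \<exists>k\<in>{..2 ^ m}. \<bar>X (g t m k) \<omega>\<bar> > 2 * e} \<in> events"
    proof (intro sets.sets_Collect_finite_Ex)
      fix k
      show "{\<omega> \<in> space M. \<bar>X (g t m k) \<omega>\<bar> > 2 * e} \<in> events"
        using Xm[OF g_nonneg[OF that]] by measurable
    qed auto
    then show ?thesis by (simp only: atMost_iff Bex_def)
  qed
  have C_Union: "C e t = (\<Union>m. {\<omega> \<in> space M. \<exists>k\<le>2 ^ m. \<bar>X (g t m k) \<omega>\<bar> > 2 * e})" for e t
    by (auto simp: C_def)
  have C_meas: "C e t \<in> events" if "t > 0" for e t
    unfolding C_Union by (rule sets.countable_UN) (use meas_B[OF that] in blast)
  have C_bound: "\<exists>\<eta>>0. \<forall>t\<in>{0<..<\<eta>}. prob (C e t) \<le> 2 * prob {\<omega> \<in> space M. \<bar>X t \<omega>\<bar> > e}" if e: "e > 0" for e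
  proof -
    \<comment> \<open>Half the level and one quarter: \<open>X t - X s\<close> exceeds
      \<open>e\<close> in absolute value only if one of the two variables exceeds
      \<open>e / 2\<close>, and two quarters add up to the one half that the maximal inequality
      requires.\<close>
    have "((\<lambda>s. prob {\<omega> \<in> space M. \<bar>X s \<omega> - 0\<bar> > e / 2}) \<longlongrightarrow> 0) (at_right 0)"
      by (rule prob0[unfolded tendsto_in_prob_def, rule_format, OF half_gt_zero[OF e]])
    then have "\<forall>\<^sub>F s in at_right 0. prob {\<omega> \<in> space M. \<bar>X s \<omega> - 0\<bar> > e / 2} < 1 / 4"
      by (rule order_tendstoD) simp
    then obtain \<eta> where \<eta>: "\<eta> > 0" "\<And>s. 0 < s \<Longrightarrow> s < \<eta> \<Longrightarrow> prob {\<omega> \<in> space M. \<bar>X s \<omega>\<bar> > e / 2} < 1 / 4"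
      unfolding eventually_at_right_field by auto
    have quarter: "prob {\<omega> \<in> space M. \<bar>X s \<omega>\<bar> > e / 2} \<le> 1 / 4" if "0 \<le> s" "s < \<eta>" for s
      using \<eta>(2)[of s] that e by (cases "s = 0") (auto simp: X0 less_imp_le)
    have "prob (C e t) \<le> 2 * prob {\<omega> \<in> space M. \<bar>X t \<omega>\<bar> > e}" if t: "0 < t" "t < \<eta>" for t
    proof -
      have grid: "prob {\<omega> \<in> space M. \<exists>k\<le>2 ^ m. \<bar>X (g t m k) \<omega>\<bar> > 2 * e} \<le> 2 * prob {\<omega> \<in> space M. \<bar>X t \<omega>\<bar> > e}" for m
      proof -
        have gn: "g t m (2 ^ m) = t" by (simp add: g_def)
        have "prob {\<omega> \<in> space M. \<exists>k\<le>2 ^ m. \<bar>X (g t m k) \<omega>\<bar> > 2 * e} \<le>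
            2 * prob {\<omega> \<in> space M. \<bar>X (g t m (2 ^ m)) \<omega>\<bar> > e}"
        proof (rule ottaviani_inequality)
          show "indep_vars (\<lambda>_. borel) (\<lambda>i \<omega>. X (g t m (Suc i)) \<omega> - X (g t m i) \<omega>) {..<2 ^ m}"
            by (rule independent_increments_indep_vars[OF X(2)])
               (use t g_nonneg in \<open>auto simp: g_def divide_strict_right_mono\<close>)
          show "X (g t m k) \<omega> = (\<Sum>i<k. X (g t m (Suc i)) \<omega> - X (g t m i) \<omega>)" for k \<omega>
            by (subst sum_lessThan_telescope) (simp add: g_def X0)
        next
          fix k :: nat assume k: "k \<le> 2 ^ m"
          let ?s = "g t m k"
          have s: "0 \<le> ?s" "?s < \<eta>"
          proof -
            have "real k / 2 ^ m \<le> 1"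
              using k by (simp add: divide_le_eq)
            then have "t * (real k / 2 ^ m) \<le> t * 1" using t by (intro mult_left_mono) auto
            then show "?s < \<eta>" using t by (simp add: g_def)
            show "0 \<le> ?s" by (rule g_nonneg[OF t(1)])
          qed
          have [measurable]: "X t \<in> borel_measurable M" "X ?s \<in> borel_measurable M"
            using Xm t s by auto
          have "prob {\<omega> \<in> space M. \<bar>X (g t m (2 ^ m)) \<omega> - X ?s \<omega>\<bar> > e} \<le>
              prob ({\<omega> \<in> space M. \<bar>X t \<omega>\<bar> > e / 2} \<union> {\<omega> \<in> space M. \<bar>X ?s \<omega>\<bar> > e / 2})"
            unfolding gn
          proof (intro finite_measure_mono subsetI)
            fix \<omega> assume "\<omega> \<in> {\<omega> \<in> space M. \<bar>X t \<omega> - X ?s \<omega>\<bar> > e}"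
            then have "\<omega> \<in> space M" "\<bar>X t \<omega>\<bar> > e / 2 \<or> \<bar>X ?s \<omega>\<bar> > e / 2"
              unfolding mem_Collect_eq by (blast, linarith)
            then show "\<omega> \<in> {\<omega> \<in> space M. \<bar>X t \<omega>\<bar> > e / 2} \<union> {\<omega> \<in> space M. \<bar>X ?s \<omega>\<bar> > e / 2}" by auto
          qed measurable
          also have "\<dots> \<le> prob {\<omega> \<in> space M. \<bar>X t \<omega>\<bar> > e / 2} + prob {\<omega> \<in> space M. \<bar>X ?s \<omega>\<bar> > e / 2}"
            by (rule measure_Un_le) measurable
          also have "\<dots> \<le> 1 / 2" using quarter[of t] quarter[OF s] t by simp
          finally show "prob {\<omega> \<in> space M. \<bar>X (g t m (2 ^ m)) \<omega> - X ?s \<omega>\<bar> > e} \<le> 1 / 2" .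
        qed
        then show ?thesis by (simp only: gn)
      qed
      \<comment> \<open>Dyadic grids are nested, so the events increase to \<open>C e t\<close>, and
        the bound, being uniform in \<open>m\<close>, passes to the limit.\<close>
      have "incseq (\<lambda>m. {\<omega> \<in> space M. \<exists>k\<le>2 ^ m. \<bar>X (g t m k) \<omega>\<bar> > 2 * e})"
      proof (rule incseq_SucI, rule subsetI)
        fix m \<omega> assume "\<omega> \<in> {\<omega> \<in> space M. \<exists>k\<le>2 ^ m. \<bar>X (g t m k) \<omega>\<bar> > 2 * e}"
        then obtain k where "\<omega> \<in> space M" "k \<le> 2 ^ m" "\<bar>X (g t m k) \<omega>\<bar> > 2 * e" by auto
        moreover have "g t m k = g t (Suc m) (2 * k)" by (simp add: g_def)
        ultimately show "\<omega> \<in> {\<omega> \<in> space M. \<exists>k\<le>2 ^ Suc m. \<bar>X (g t (Suc m) k) \<omega>\<bar> > 2 * e}"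
          by (auto intro!: exI[of _ "2 * k"])
      qed
      then have "(\<lambda>m. prob {\<omega> \<in> space M. \<exists>k\<le>2 ^ m. \<bar>X (g t m k) \<omega>\<bar> > 2 * e}) \<longlonglongrightarrow> prob (C e t)"
        unfolding C_Union by (rule finite_Lim_measure_incseq[rotated]) (use meas_B[OF t(1)] in blast)
      then show ?thesis by (rule LIMSEQ_le_const2) (use grid in auto)
    qed
    then show ?thesis by (intro exI[of _ \<eta>] conjI ballI \<eta>(1)) simp
  qed
  have AE_small: "AE \<omega> in M. \<exists>t>0. \<omega> \<notin> C e t" if e: "e > 0" for e
  proof -
    \<comment> \<open>A sequence of times keeps the intersection below countable. Its probability is
      eventually bounded by a null sequence, as \<open>X (\<tau> n)\<close> tends to 0 in
      probability.\<close>
    define \<tau> where "\<tau> n = inverse (real (Suc n))" for n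
    have \<tau>: "\<tau> n > 0" for n by (simp add: \<tau>_def)
    have \<tau>_lim: "filterlim \<tau> (at_right 0) sequentially"
      using LIMSEQ_inverse_real_of_nat[folded \<tau>_def] \<tau>
      by (auto simp: filterlim_at less_imp_neq[symmetric])
    have lim: "(\<lambda>n. 2 * prob {\<omega> \<in> space M. \<bar>X (\<tau> n) \<omega> - 0\<bar> > e}) \<longlonglongrightarrow> 2 * 0"
      using tendsto_in_prob_compose[OF prob0 \<tau>_lim, unfolded tendsto_in_prob_def, rule_format, OF e]
      by (intro tendsto_mult tendsto_const)
    obtain \<eta> where \<eta>: "\<eta> > 0" "\<And>t. t \<in> {0<..<\<eta>} \<Longrightarrow> prob (C e t) \<le> 2 * prob {\<omega> \<in> space M. \<bar>X t \<omega>\<bar> > e}"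
      using C_bound[OF e] by blast
    let ?N = "\<Inter>n. C e (\<tau> n)"
    have N: "?N \<in> events" using C_meas \<tau> by auto
    have "prob ?N \<le> 2 * 0"
    proof (rule tendsto_lowerbound[OF lim])
      have "\<forall>\<^sub>F n in sequentially. \<tau> n < \<eta>"
        using \<tau>_lim \<eta>(1) by (intro order_tendstoD[of _ 0]) (auto simp: filterlim_at)
      then show "\<forall>\<^sub>F n in sequentially. prob ?N \<le> 2 * prob {\<omega> \<in> space M. \<bar>X (\<tau> n) \<omega> - 0\<bar> > e}"
      proof eventually_elim
        case (elim n)
        have "prob ?N \<le> prob (C e (\<tau> n))"
          by (intro finite_measure_mono C_meas \<tau>) auto
        also have "\<dots> \<le> 2 * prob {\<omega> \<in> space M. \<bar>X (\<tau> n) \<omega>\<bar> > e}" using elim \<tau> by (intro \<eta>) auto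
        finally show ?case by simp
      qed
    qed simp
    then have "prob ?N = 0" using measure_nonneg[of M ?N] by linarith
    then have "AE \<omega> in M. \<omega> \<notin> ?N" using N by (simp add: prob_eq_0)
    then show ?thesis by eventually_elim (use \<tau> in blast)
  qed
  \<comment> \<open>Countably many levels suffice for the limit and admit a common null set.\<close>
  have "AE \<omega> in M. \<forall>n. \<exists>t>0. \<omega> \<notin> C (inverse (real (Suc n))) t"
    unfolding AE_all_countable by (intro allI AE_small) simp
  then show ?thesis
    using right AE_space
  proof eventually_elim
    case (elim \<omega>)
    show ?case
    proof (rule tendstoI)
      fix e :: real assume "e > 0"
      then obtain n where n: "inverse (real (Suc n)) < e / 2" using reals_Archimedean[of "e / 2"] by auto
      obtain t where t: "t > 0" "\<omega> \<notin> C (inverse (real (Suc n))) t" using elim(1) by blast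
      have "dist (X s \<omega>) 0 < e" if "0 < s" "s < t" for s
        using small[OF elim(3,2) t(2) that(1)] that n by (simp add: dist_real_def)
      then show "\<forall>\<^sub>F s in at_right 0. dist (X s \<omega>) 0 < e"
        unfolding eventually_at_right_field using t(1) by blast
    qed
  qed
qed

end

section \<open>Exponents of infinitely divisible laws\<close>

text \<open>After a rotation that makes the characteristic function real and nonnegative at the
  given point, this is \<open>1 - cos (2 * u) \<le> 4 * (1 - cos u)\<close>.\<close>

lemma (in prob_space) norm_expectation_iexp_double:
  assumes [measurable]: "Y \<in> borel_measurable M"
  shows "1 - cmod (CLINT \<omega>|M. iexp (2 * Y \<omega>)) \<le> 4 * (1 - cmod (CLINT \<omega>|M. iexp (Y \<omega>)))"
proof -
  have int: "integrable M (\<lambda>\<omega>. iexp (Z \<omega>))" if [measurable]: "Z \<in> borel_measurable M" for Z :: "'a \<Rightarrow> real"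
    by (rule integrable_const_bound[where B = 1]) auto
  have re: "Re (iexp (- b) * (CLINT \<omega>|M. iexp (Z \<omega>))) = (LINT \<omega>|M. cos (Z \<omega> - b))"
    if [measurable]: "Z \<in> borel_measurable M" for Z b
  proof -
    have "iexp (- b) * (CLINT \<omega>|M. iexp (Z \<omega>)) = (CLINT \<omega>|M. iexp (Z \<omega> - b))"
      by (simp add: exp_add[symmetric] algebra_simps flip: integral_mult_right_zero)
    also have "Re \<dots> = (LINT \<omega>|M. Re (iexp (Z \<omega> - b)))"
      by (rule integral_Re[symmetric], rule int) measurable
    also have "\<dots> = (LINT \<omega>|M. cos (Z \<omega> - b))"
      by (simp add: cis_conv_exp[symmetric] flip: of_real_diff)
    finally show ?thesis .
  qed
  have intc: "integrable M (\<lambda>\<omega>. cos (Z \<omega>))" if [measurable]: "Z \<in> borel_measurable M" for Z :: "'a \<Rightarrow> real"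
    by (rule integrable_const_bound[where B = 1]) auto
  let ?z = "CLINT \<omega>|M. iexp (Y \<omega>)"
  obtain b where b: "?z = of_real (cmod ?z) * iexp b"
    using Arg_eq[of ?z] by (cases "?z = 0") auto
  have "iexp (- b) * ?z = of_real (cmod ?z)"
    by (subst b) (simp add: exp_minus)
  then have 1: "cmod ?z = (LINT \<omega>|M. cos (Y \<omega> - b))"
    using re[of Y b] by simp
  have "(LINT \<omega>|M. cos (2 * Y \<omega> - 2 * b)) = Re (iexp (- (2 * b)) * (CLINT \<omega>|M. iexp (2 * Y \<omega>)))"
    by (rule re[symmetric]) measurable
  also have "\<dots> \<le> cmod (iexp (- (2 * b)) * (CLINT \<omega>|M. iexp (2 * Y \<omega>)))"
    by (rule complex_Re_le_cmod)
  finally have 2: "(LINT \<omega>|M. cos (2 * Y \<omega> - 2 * b)) \<le> cmod (CLINT \<omega>|M. iexp (2 * Y \<omega>))"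
    by (simp add: norm_mult)
  have "4 * (LINT \<omega>|M. cos (Y \<omega> - b)) - 3 = (LINT \<omega>|M. 4 * cos (Y \<omega> - b) - 3)"
    using intc[of "\<lambda>\<omega>. Y \<omega> - b"] by (simp add: prob_space)
  also have "\<dots> \<le> (LINT \<omega>|M. cos (2 * Y \<omega> - 2 * b))"
  proof (rule integral_mono)
    show "4 * cos (Y \<omega> - b) - 3 \<le> cos (2 * Y \<omega> - 2 * b)" for \<omega>
    proof -
      have "cos (2 * (Y \<omega> - b)) = 2 * (cos (Y \<omega> - b))\<^sup>2 - 1" by (rule cos_double_cos)
      moreover have "0 \<le> (cos (Y \<omega> - b) - 1)\<^sup>2" by simp
      ultimately show ?thesis by (simp add: power2_eq_square algebra_simps)
    qed
    show "integrable M (\<lambda>\<omega>. 4 * cos (Y \<omega> - b) - 3)"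
      using intc[of "\<lambda>\<omega>. Y \<omega> - b"] by simp
    show "integrable M (\<lambda>\<omega>. cos (2 * Y \<omega> - 2 * b))" by (rule intc) measurable
  qed
  also note 2
  finally have le: "4 * (LINT \<omega>|M. cos (Y \<omega> - b)) - 3 \<le> cmod (CLINT \<omega>|M. iexp (2 * Y \<omega>))" .
  have "4 * c - 3 \<le> d \<Longrightarrow> 1 - d \<le> 4 * (1 - c)" for c d :: real by simp
  from this[OF le] show ?thesis by (simp only: 1)
qed

section \<open>Characteristic functions without zeros\<close>

definition cf_vec :: "nat \<Rightarrow> (nat \<Rightarrow> real) measure \<Rightarrow> (nat \<Rightarrow> real) \<Rightarrow> complex" where
  "cf_vec k \<mu> \<theta> = (CLINT x|\<mu>. iexp (\<Sum>j<k. \<theta> j * x j))"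

lemma measurable_linear_form [measurable]:
  "(\<lambda>x. \<Sum>j<k. \<theta> j * x j) \<in> borel_measurable (borel_vec k)"
  by (intro borel_measurable_sum borel_measurable_times measurable_const measurable_component_singleton) auto

lemma measurable_vec_sum [measurable]:
  "(\<lambda>x. \<lambda>j\<in>{..<k}. \<Sum>i<n. x i j) \<in> measurable (PiM {..<n} (\<lambda>_. borel_vec k)) (borel_vec k)"
proof (intro measurable_restrict borel_measurable_sum)
  fix i j assume "i \<in> {..<n}" "j \<in> {..<k}"
  then show "(\<lambda>x. x i j) \<in> borel_measurable (PiM {..<n} (\<lambda>_. borel_vec k))"
    by (intro measurable_compose[OF measurable_component_singleton[of i]] measurable_component_singleton)
qed

lemma infinitely_divisible_lawE:
  fixes n :: nat
  assumes "infinitely_divisible_law k \<mu>" "n \<ge> 1"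
  obtains \<nu> where "prob_space \<nu>" "sets \<nu> = sets (borel_vec k)"
    "\<mu> = distr (PiM {..<n} (\<lambda>_. \<nu>)) (borel_vec k) (\<lambda>x. \<lambda>j\<in>{..<k}. \<Sum>i<n. x i j)"
  using assms(1)[unfolded infinitely_divisible_law_def, rule_format, OF assms(2)]
  by (elim exE conjE) (rule that)

lemma measurable_vec_sum':
  assumes "sets \<nu> = sets (borel_vec k)"
  shows "(\<lambda>x. \<lambda>j\<in>{..<k}. \<Sum>i<n. x i j) \<in> measurable (PiM {..<n} (\<lambda>_. \<nu>)) (borel_vec k)"
proof -
  have "sets (PiM {..<n} (\<lambda>_. \<nu>)) = sets (PiM {..<n} (\<lambda>_. borel_vec k))"
    using assms by (intro sets_PiM_cong) auto
  from measurable_cong_sets[OF this refl] show ?thesis using measurable_vec_sum by blast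
qed

lemma cf_vec_convolution_power:
  assumes "prob_space \<nu>" and sets: "sets \<nu> = sets (borel_vec k)"
  shows "cf_vec k (distr (PiM {..<n} (\<lambda>_. \<nu>)) (borel_vec k) (\<lambda>x. \<lambda>j\<in>{..<k}. \<Sum>i<n. x i j)) \<theta>
    = cf_vec k \<nu> \<theta> ^ n"
proof -
  interpret \<nu>: prob_space \<nu> by fact
  interpret product_sigma_finite "\<lambda>_. \<nu>" ..
  have m: "(\<lambda>x. \<Sum>j<k. \<theta> j * x j) \<in> borel_measurable \<nu>"
    using measurable_linear_form measurable_cong_sets[OF sets refl] by blast
  have "cf_vec k (distr (PiM {..<n} (\<lambda>_. \<nu>)) (borel_vec k) (\<lambda>x. \<lambda>j\<in>{..<k}. \<Sum>i<n. x i j)) \<theta> =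
      (CLINT x|PiM {..<n} (\<lambda>_. \<nu>). iexp (\<Sum>j<k. \<theta> j * (\<lambda>j\<in>{..<k}. \<Sum>i<n. x i j) j))"
    unfolding cf_vec_def by (rule integral_distr[OF measurable_vec_sum'[OF sets]]) measurable
  also have "\<dots> = (CLINT x|PiM {..<n} (\<lambda>_. \<nu>). \<Prod>i<n. iexp (\<Sum>j<k. \<theta> j * x i j))"
  proof (intro Bochner_Integration.integral_cong refl)
    fix x :: "nat \<Rightarrow> nat \<Rightarrow> real"
    have "(\<Sum>j<k. \<theta> j * (\<lambda>j\<in>{..<k}. \<Sum>i<n. x i j) j) = (\<Sum>j<k. \<Sum>i<n. \<theta> j * x i j)"
      by (intro sum.cong) (auto simp: sum_distrib_left)
    also have "\<dots> = (\<Sum>i<n. \<Sum>j<k. \<theta> j * x i j)" by (rule sum.swap)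
    finally show "iexp (\<Sum>j<k. \<theta> j * (\<lambda>j\<in>{..<k}. \<Sum>i<n. x i j) j) = (\<Prod>i<n. iexp (\<Sum>j<k. \<theta> j * x i j))"
      by (simp only: of_real_sum sum_distrib_left exp_sum finite_lessThan)
  qed
  also have "\<dots> = (\<Prod>i<n. cf_vec k \<nu> \<theta>)"
    unfolding cf_vec_def
  proof (rule product_integral_prod)
    show "integrable \<nu> (\<lambda>x. iexp (\<Sum>j<k. \<theta> j * x j))"
      by (rule \<nu>.integrable_const_bound[where B = 1])
         (use measurable_compose[OF m, of iexp borel] in auto)
  qed simp
  finally show ?thesis by simp
qed

lemma infinitely_divisible_law_prob:
  assumes "infinitely_divisible_law k \<mu>"
  shows "prob_space \<mu>" "sets \<mu> = sets (borel_vec k)"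
proof -
  obtain \<nu> where \<nu>: "prob_space \<nu>" "sets \<nu> = sets (borel_vec k)"
    "\<mu> = distr (PiM {..<1::nat} (\<lambda>_. \<nu>)) (borel_vec k) (\<lambda>x. \<lambda>j\<in>{..<k}. \<Sum>i<1. x i j)"
    by (rule infinitely_divisible_lawE[OF assms order_refl])
  show "prob_space \<mu>" unfolding \<nu>(3)
    by (intro prob_space.prob_space_distr prob_space_PiM \<nu>(1) measurable_vec_sum'[OF \<nu>(2)])
  show "sets \<mu> = sets (borel_vec k)" unfolding \<nu>(3) by simp
qed

text \<open>The characteristic function of an \<open>n\<close>-th convolution root has modulus
  \<open>root n r\<close> at \<open>\<theta>\<close>, which tends to 1. Once it is close enough to
  1, the doubling inequality excludes a zero of that function at twice the point, and its
  \<open>n\<close>-th power is then nonzero too.\<close>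

lemma cf_vec_double_nonzero:
  assumes "infinitely_divisible_law k \<mu>" and nz: "cf_vec k \<mu> \<theta> \<noteq> 0"
  shows "cf_vec k \<mu> (\<lambda>j. 2 * \<theta> j) \<noteq> 0"
proof -
  define r where "r = cmod (cf_vec k \<mu> \<theta>)"
  have "r > 0" using nz by (simp add: r_def)
  \<comment> \<open>Above \<open>3 / 4\<close> the bound \<open>4 * (1 - root n r)\<close> from the
    doubling inequality drops below 1.\<close>
  then have "\<forall>\<^sub>F n in sequentially. root n r > 3 / 4"
    using LIMSEQ_root_const by (intro order_tendstoD) auto
  then have "\<forall>\<^sub>F n in sequentially. root n r > 3 / 4 \<and> n \<ge> 1"
    using eventually_ge_at_top by (rule eventually_conj)
  then obtain n where n: "root n r > 3 / 4" "n \<ge> 1"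
    using eventually_happens'[OF sequentially_bot] by blast
  obtain \<nu> where \<nu>: "prob_space \<nu>" "sets \<nu> = sets (borel_vec k)"
    and \<mu>: "\<mu> = distr (PiM {..<n} (\<lambda>_. \<nu>)) (borel_vec k) (\<lambda>x. \<lambda>j\<in>{..<k}. \<Sum>i<n. x i j)"
    by (rule infinitely_divisible_lawE[OF assms(1) n(2)])
  interpret \<nu>: prob_space \<nu> by fact
  have m: "(\<lambda>x. \<Sum>j<k. \<theta> j * x j) \<in> borel_measurable \<nu>"
    using measurable_linear_form measurable_cong_sets[OF \<nu>(2) refl] by blast
  have "r = cmod (cf_vec k \<nu> \<theta>) ^ n"
    unfolding r_def \<mu> cf_vec_convolution_power[OF \<nu>] by (simp add: norm_power)
  then have "root n r = cmod (cf_vec k \<nu> \<theta>)" using n(2) by (simp add: real_root_power_cancel)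
  moreover have "1 - cmod (cf_vec k \<nu> (\<lambda>j. 2 * \<theta> j)) \<le> 4 * (1 - cmod (cf_vec k \<nu> \<theta>))"
    using \<nu>.norm_expectation_iexp_double[OF m] by (simp add: cf_vec_def sum_distrib_left mult.assoc)
  ultimately have "cf_vec k \<nu> (\<lambda>j. 2 * \<theta> j) \<noteq> 0" using n(1) by auto
  then show ?thesis unfolding \<mu> cf_vec_convolution_power[OF \<nu>] by simp
qed

lemma cf_vec_tendsto:
  assumes "prob_space \<mu>" and sets: "sets \<mu> = sets (borel_vec k)"
    and lim: "\<And>j. j < k \<Longrightarrow> (\<lambda>n. \<theta> n j) \<longlonglongrightarrow> \<eta> j"
  shows "(\<lambda>n. cf_vec k \<mu> (\<theta> n)) \<longlonglongrightarrow> cf_vec k \<mu> \<eta>"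
  unfolding cf_vec_def
proof (rule integral_dominated_convergence[where w = "\<lambda>_. 1"])
  interpret prob_space \<mu> by fact
  have m: "(\<lambda>x. \<Sum>j<k. \<theta> j * x j) \<in> borel_measurable \<mu>" for \<theta>
    using measurable_linear_form measurable_cong_sets[OF sets refl] by blast
  show "(\<lambda>x. iexp (\<Sum>j<k. \<eta> j * x j)) \<in> borel_measurable \<mu>"
    "(\<lambda>x. iexp (\<Sum>j<k. \<theta> n j * x j)) \<in> borel_measurable \<mu>" for n
    using measurable_compose[OF m, of iexp borel] by auto
  show "AE x in \<mu>. (\<lambda>n. iexp (\<Sum>j<k. \<theta> n j * x j)) \<longlonglongrightarrow> iexp (\<Sum>j<k. \<eta> j * x j)"
    by (intro always_eventually allI tendsto_intros lim) auto
  show "integrable \<mu> (\<lambda>_. 1 :: real)" by (rule integrable_const)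
qed auto

text \<open>Near the origin the value is close to 1, so it is nonzero at
  \<open>\<theta> / 2 ^ n\<close> for some \<open>n\<close>; doubling \<open>n\<close> times leads
  back to \<open>\<theta>\<close>.\<close>

lemma cf_vec_nonzero:
  assumes id: "infinitely_divisible_law k \<mu>"
  shows "cf_vec k \<mu> \<theta> \<noteq> 0"
proof -
  note \<mu> = infinitely_divisible_law_prob[OF id]
  have "(\<lambda>n. cf_vec k \<mu> (\<lambda>j. \<theta> j / 2 ^ n)) \<longlonglongrightarrow> cf_vec k \<mu> (\<lambda>j. 0)"
  proof (rule cf_vec_tendsto[OF \<mu>])
    fix j
    have "(\<lambda>n. \<theta> j * inverse 2 ^ n) \<longlonglongrightarrow> \<theta> j * 0"
      by (intro tendsto_intros LIMSEQ_power_zero) auto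
    then show "(\<lambda>n. \<theta> j / 2 ^ n) \<longlonglongrightarrow> 0" by (simp add: field_simps)
  qed
  moreover have "cf_vec k \<mu> (\<lambda>j. 0) = 1"
    using \<mu>(1) by (simp add: cf_vec_def prob_space.prob_space)
  ultimately have "\<forall>\<^sub>F n in sequentially. cf_vec k \<mu> (\<lambda>j. \<theta> j / 2 ^ n) \<noteq> 0"
    by (intro tendsto_imp_eventually_ne) auto
  then obtain n where n: "cf_vec k \<mu> (\<lambda>j. \<theta> j / 2 ^ n) \<noteq> 0"
    using eventually_happens'[OF sequentially_bot] by blast
  have "cf_vec k \<mu> (\<lambda>j. 2 ^ i * (\<theta> j / 2 ^ n)) \<noteq> 0" for i
  proof (induction i)
    case (Suc i)
    from cf_vec_double_nonzero[OF id Suc.IH] show ?case by (simp add: mult.assoc)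
  qed (use n in simp)
  from this[of n] show ?thesis by simp
qed

section \<open>Uniqueness and existence of Levy exponents\<close>

text \<open>The property under the definite description in \<open>levy_exponent\<close>, named so
  that existence and uniqueness can be stated.\<close>

definition is_levy_exponent ::
    "'a measure \<Rightarrow> (real \<Rightarrow> 'a \<Rightarrow> real) \<Rightarrow> nat \<Rightarrow> (nat \<Rightarrow> real) \<Rightarrow> ((nat \<Rightarrow> real) \<Rightarrow> complex) \<Rightarrow> bool" where
  "is_levy_exponent M X k t \<Psi> \<longleftrightarrow>
     \<Psi> \<in> extensional (rvec k) \<and>
        continuous_on (rvec k) \<Psi> \<and>
        \<Psi> (\<lambda>j\<in>{..<k}. 0) = 0 \<and>
        (\<forall>\<theta>\<in>rvec k. (CLINT \<omega>|M. iexp (\<Sum>j<k. \<theta> j * X (t j) \<omega>)) = exp (\<Psi> \<theta>))"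

text \<open>Along the ray from the origin to \<open>\<theta>\<close> the difference of two exponents
  is continuous with values in the multiples of \<open>2 * pi * \<i>\<close>, hence constant and
  equal to its value 0 at the origin.\<close>

lemma is_levy_exponent_unique:
  assumes "is_levy_exponent M X k t \<Psi>" "is_levy_exponent M X k t \<Phi>"
  shows "\<Psi> = \<Phi>"
proof (rule extensionalityI)
  show "\<Psi> \<in> extensional (rvec k)" "\<Phi> \<in> extensional (rvec k)"
    using assms by (auto simp: is_levy_exponent_def)
  fix \<theta> assume \<theta>: "\<theta> \<in> rvec k"
  define p where "p s = (\<lambda>j\<in>{..<k}. s * \<theta> j)" for s :: real
  have p: "p s \<in> rvec k" for s by (simp add: p_def)
  have contp: "continuous_on {0..1} p"
  proof (rule continuous_on_coordinatewise_then_product)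
    fix j show "continuous_on {0..1} (\<lambda>s. p s j)"
      by (cases "j < k") (auto simp: p_def intro!: continuous_intros)
  qed
  define h where "h s = \<Psi> (p s) - \<Phi> (p s)" for s
  have conth: "continuous_on {0..1} h"
    unfolding h_def using assms p
    by (intro continuous_intros continuous_on_compose2[OF _ contp]) (auto simp: is_levy_exponent_def)
  have exph: "exp (h s) = 1" for s
  proof -
    have "exp (\<Psi> (p s)) = exp (\<Phi> (p s))"
      using assms p[of s] by (auto simp: is_levy_exponent_def)
    then show ?thesis by (simp add: h_def exp_diff)
  qed
  have "h constant_on {0..1}"
  proof (rule continuous_discrete_range_constant[OF _ conth])
    have "2 * pi \<le> cmod (h y - h x)" if "h y \<noteq> h x" for x y
    proof -
      obtain n :: int where n: "h y = h x + (of_int (2 * n) * pi) * \<i>"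
        using exph[of x] exph[of y] exp_eq[of "h y" "h x"] by auto
      then have "n \<noteq> 0" using that by auto
      then have "\<bar>real_of_int n\<bar> \<ge> 1" by linarith
      moreover have "cmod (h y - h x) = 2 * \<bar>real_of_int n\<bar> * pi"
        unfolding n by (simp add: norm_mult)
      ultimately show ?thesis by simp
    qed
    then show "\<exists>e>0. \<forall>y. y \<in> {0..1} \<and> h y \<noteq> h x \<longrightarrow> e \<le> cmod (h y - h x)" for x
      by (intro exI[of _ "2 * pi"]) auto
  qed auto
  then have "h 1 = h 0" by (auto simp: constant_on_def)
  moreover have "p 0 = (\<lambda>j\<in>{..<k}. 0)" by (auto simp: p_def)
  moreover have "p 1 = \<theta>" using \<theta> by (auto simp: p_def fun_eq_iff PiE_def extensional_def)
  ultimately show "\<Psi> \<theta> = \<Phi> \<theta>" using assms by (simp add: h_def is_levy_exponent_def)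
qed

lemma levy_exponent_eqI: "is_levy_exponent M X k t \<Psi> \<Longrightarrow> levy_exponent M X k t = \<Psi>"
  unfolding levy_exponent_def is_levy_exponent_def[symmetric]
  by (rule the_equality) (auto dest: is_levy_exponent_unique)

lemma cf_vec_fin_dim_law:
  assumes "\<And>j. j < k \<Longrightarrow> X (t j) \<in> borel_measurable M"
  shows "cf_vec k (fin_dim_law M X k t) \<theta> = (CLINT \<omega>|M. iexp (\<Sum>j<k. \<theta> j * X (t j) \<omega>))"
proof -
  have "(\<lambda>\<omega>. \<lambda>j\<in>{..<k}. X (t j) \<omega>) \<in> measurable M (borel_vec k)"
    using assms by (intro measurable_restrict) auto
  then have "cf_vec k (fin_dim_law M X k t) \<theta> =
      (CLINT \<omega>|M. iexp (\<Sum>j<k. \<theta> j * (\<lambda>j\<in>{..<k}. X (t j) \<omega>) j))"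
    unfolding cf_vec_def fin_dim_law_def by (rule integral_distr) measurable
  also have "\<dots> = (CLINT \<omega>|M. iexp (\<Sum>j<k. \<theta> j * X (t j) \<omega>))"
    by (intro Bochner_Integration.integral_cong refl arg_cong[where f = iexp] sum.cong) auto
  finally show ?thesis .
qed

text \<open>The logarithm is lifted on the normed space of bounded sequences, which contains a copy
  of every \<open>\<real>\<^sup>k\<close> and, unlike \<open>nat \<Rightarrow> real\<close>, is covered by the library's lifting lemma.\<close>

lemma cf_vec_log_exists:
  assumes id: "infinitely_divisible_law k \<mu>"
  obtains \<Psi> where "\<Psi> \<in> extensional (rvec k)" "continuous_on (rvec k) \<Psi>"
    "\<Psi> (\<lambda>j\<in>{..<k}. 0) = 0" "\<And>\<theta>. \<theta> \<in> rvec k \<Longrightarrow> cf_vec k \<mu> \<theta> = exp (\<Psi> \<theta>)"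
proof -
  note \<mu> = infinitely_divisible_law_prob[OF id]
  define F :: "(nat \<Rightarrow>\<^sub>C real) \<Rightarrow> complex" where "F = (\<lambda>e. cf_vec k \<mu> (apply_bcontfun e))"
  have F_lim: "(\<lambda>n. F (x n)) \<longlonglongrightarrow> F a" if lim: "x \<longlonglongrightarrow> a" for x a
    unfolding F_def
  proof (rule cf_vec_tendsto[OF \<mu>])
    fix j
    have "(\<lambda>n. dist (x n) a) \<longlonglongrightarrow> 0" using lim by (rule tendsto_dist_iff[THEN iffD1])
    then have "(\<lambda>n. dist (apply_bcontfun (x n) j) (apply_bcontfun a j)) \<longlonglongrightarrow> 0"
      by (rule tendsto_sandwich[OF _ _ tendsto_const, rotated 2]) (auto simp: dist_bounded)
    then show "(\<lambda>n. apply_bcontfun (x n) j) \<longlonglongrightarrow> apply_bcontfun a j"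
      by (rule tendsto_dist_iff[THEN iffD2])
  qed
  then have "continuous_on UNIV F"
    by (simp add: continuous_on_sequentially o_def)
  moreover have "contractible (UNIV :: (nat \<Rightarrow>\<^sub>C real) set)" by (simp add: convex_imp_contractible)
  ultimately obtain g where g: "continuous_on UNIV g" "\<And>e. F e = exp (g e)"
    using continuous_logarithm_on_contractible[of UNIV F] cf_vec_nonzero[OF id]
    unfolding F_def by (metis UNIV_I)
  \<comment> \<open>Unit sequences, used by \<open>emb\<close> to embed the first \<open>k\<close>
    coordinates, which are all that \<open>cf_vec k\<close> sees.\<close>
  define u where "u j = Bcontfun (\<lambda>i::nat. if i = j then 1 else 0 :: real)" for j
  have u: "apply_bcontfun (u j) i = (if i = j then 1 else 0)" for i j
    unfolding u_def by (subst Bcontfun_inverse) (auto simp: bcontfun_def intro!: boundedI[where B = 1])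
  define emb where "emb \<theta> = (\<Sum>j<k. \<theta> j *\<^sub>R u j)" for \<theta> :: "nat \<Rightarrow> real"
  have emb: "apply_bcontfun (emb \<theta>) i = \<theta> i" if "i < k" for \<theta> i
  proof -
    have "apply_bcontfun (\<Sum>j<m. \<theta> j *\<^sub>R u j) i = (if i < m then \<theta> i else 0)" for m
      by (induction m) (auto simp: u less_Suc_eq)
    then show ?thesis using that by (simp add: emb_def)
  qed
  have F_emb: "F (emb \<theta>) = cf_vec k \<mu> \<theta>" for \<theta>
    unfolding F_def cf_vec_def using emb by (auto intro!: Bochner_Integration.integral_cong sum.cong arg_cong[where f = iexp])
  \<comment> \<open>Subtracting the value at the origin normalises the logarithm. The characteristic
    function is 1 there, so the exponential does not change.\<close>
  define \<Psi> where "\<Psi> = (\<lambda>\<theta>\<in>rvec k. g (emb \<theta>) - g (emb (\<lambda>j\<in>{..<k}. 0)))"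
  have zero: "exp (g (emb (\<lambda>j\<in>{..<k}. 0))) = 1"
  proof -
    have "cf_vec k \<mu> (\<lambda>j\<in>{..<k}. 0) = 1"
      using \<mu>(1) by (simp add: cf_vec_def prob_space.prob_space)
    then show ?thesis using g(2) F_emb by metis
  qed
  show ?thesis
  proof
    show "\<Psi> \<in> extensional (rvec k)" by (simp add: \<Psi>_def)
    have "continuous_on (rvec k) (\<lambda>\<theta>. g (emb \<theta>) - g (emb (\<lambda>j\<in>{..<k}. 0)))"
      unfolding emb_def
      by (intro continuous_intros continuous_on_compose2[OF g(1)]
          continuous_on_subset[OF continuous_on_product_coordinates]) auto
    then show "continuous_on (rvec k) \<Psi>"
      by (rule continuous_on_eq) (simp add: \<Psi>_def)
    show "\<Psi> (\<lambda>j\<in>{..<k}. 0) = 0" by (simp add: \<Psi>_def)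
    show "cf_vec k \<mu> \<theta> = exp (\<Psi> \<theta>)" if "\<theta> \<in> rvec k" for \<theta>
      using that by (simp add: \<Psi>_def exp_diff zero F_emb[symmetric] g(2))
  qed
qed

lemma is_levy_exponent_levy_exponent:
  assumes X: "infinitely_divisible_process M T X" and t: "\<And>j. j < k \<Longrightarrow> t j \<in> T"
  shows "is_levy_exponent M X k t (levy_exponent M X k t)"
proof -
  have "infinitely_divisible_law k (fin_dim_law M X k t)"
    using X t by (simp add: infinitely_divisible_process_def)
  then obtain \<Psi> where "\<Psi> \<in> extensional (rvec k)" "continuous_on (rvec k) \<Psi>"
    "\<Psi> (\<lambda>j\<in>{..<k}. 0) = 0" "\<And>\<theta>. \<theta> \<in> rvec k \<Longrightarrow> cf_vec k (fin_dim_law M X k t) \<theta> = exp (\<Psi> \<theta>)"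
    by (rule cf_vec_log_exists) blast
  moreover have "cf_vec k (fin_dim_law M X k t) \<theta> = (CLINT \<omega>|M. iexp (\<Sum>j<k. \<theta> j * X (t j) \<omega>))" for \<theta>
    by (rule cf_vec_fin_dim_law) (use X t in \<open>auto simp: infinitely_divisible_process_def process_def\<close>)
  ultimately have "is_levy_exponent M X k t \<Psi>"
    by (simp add: is_levy_exponent_def)
  then show ?thesis by (simp add: levy_exponent_eqI)
qed

section \<open>Diagonal rescaling of exponents and laws\<close>

lemma levy_exponent_scale:
  assumes V: "infinitely_divisible_process M T V" and s: "\<And>j. j < k \<Longrightarrow> s j \<in> T"
    and X: "\<And>j \<omega>. j < k \<Longrightarrow> X (t j) \<omega> = a j * V (s j) \<omega>" and \<theta>: "\<theta> \<in> rvec k"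
  shows "levy_exponent M X k t \<theta> = levy_exponent M V k s (\<lambda>j\<in>{..<k}. a j * \<theta> j)"
proof -
  let ?\<Psi> = "levy_exponent M V k s"
  let ?D = "\<lambda>\<theta>. \<lambda>j\<in>{..<k}. a j * \<theta> j"
  have \<Psi>: "continuous_on (rvec k) ?\<Psi>" "?\<Psi> (\<lambda>j\<in>{..<k}. 0) = 0"
    "\<And>\<theta>. \<theta> \<in> rvec k \<Longrightarrow> (CLINT \<omega>|M. iexp (\<Sum>j<k. \<theta> j * V (s j) \<omega>)) = exp (?\<Psi> \<theta>)"
    using is_levy_exponent_levy_exponent[OF V s] by (auto simp: is_levy_exponent_def)
  have "is_levy_exponent M X k t (\<lambda>\<theta>\<in>rvec k. ?\<Psi> (?D \<theta>))"
    unfolding is_levy_exponent_def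
  proof (intro conjI ballI)
    have "continuous_on (rvec k) ?D"
    proof (rule continuous_on_coordinatewise_then_product)
      fix j show "continuous_on (rvec k) (\<lambda>\<theta>. ?D \<theta> j)"
        by (cases "j < k") (auto intro!: continuous_intros continuous_on_subset[OF continuous_on_product_coordinates])
    qed
    then have "continuous_on (rvec k) (\<lambda>\<theta>. ?\<Psi> (?D \<theta>))"
      by (rule continuous_on_compose2[OF \<Psi>(1)]) auto
    then show "continuous_on (rvec k) (\<lambda>\<theta>\<in>rvec k. ?\<Psi> (?D \<theta>))"
      by (rule continuous_on_eq) simp
    have "?D (\<lambda>j\<in>{..<k}. 0) = (\<lambda>j\<in>{..<k}. 0)" by auto
    then show "(\<lambda>\<theta>\<in>rvec k. ?\<Psi> (?D \<theta>)) (\<lambda>j\<in>{..<k}. 0) = 0" by (simp add: \<Psi>(2))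
    fix \<theta> assume \<theta>: "\<theta> \<in> rvec k"
    have "(\<Sum>j<k. \<theta> j * X (t j) \<omega>) = (\<Sum>j<k. ?D \<theta> j * V (s j) \<omega>)" for \<omega>
      by (intro sum.cong) (auto simp: X)
    then show "(CLINT \<omega>|M. iexp (\<Sum>j<k. \<theta> j * X (t j) \<omega>)) = exp ((\<lambda>\<theta>\<in>rvec k. ?\<Psi> (?D \<theta>)) \<theta>)"
      using \<Psi>(3)[of "?D \<theta>"] \<theta> by simp
  qed simp
  then show ?thesis using \<theta> by (simp add: levy_exponent_eqI)
qed

text \<open>A diagonal map commutes with sums of vectors, so it sends a convolution root of
  \<open>\<mu>\<close> to a convolution root of the image law.\<close>

lemma infinitely_divisible_law_scale:
  assumes id: "infinitely_divisible_law k \<mu>"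
  shows "infinitely_divisible_law k (distr \<mu> (borel_vec k) (\<lambda>x. \<lambda>j\<in>{..<k}. a j * x j))"
  unfolding infinitely_divisible_law_def
proof (intro allI impI)
  fix n :: nat assume n: "n \<ge> 1"
  let ?D = "\<lambda>x. \<lambda>j\<in>{..<k}. a j * x j" and ?S = "\<lambda>x. \<lambda>j\<in>{..<k}. \<Sum>i<n. x i j :: real"
  obtain \<nu> where \<nu>: "prob_space \<nu>" "sets \<nu> = sets (borel_vec k)"
    and \<mu>: "\<mu> = distr (PiM {..<n} (\<lambda>_. \<nu>)) (borel_vec k) ?S"
    by (rule infinitely_divisible_lawE[OF id n])
  have D: "?D \<in> measurable (borel_vec k) (borel_vec k)"
    by measurable
  have D\<nu>: "?D \<in> measurable \<nu> (borel_vec k)"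
    using D measurable_cong_sets[OF \<nu>(2) refl] by blast
  let ?\<nu>' = "distr \<nu> (borel_vec k) ?D"
  have \<nu>': "prob_space ?\<nu>'" by (rule prob_space.prob_space_distr[OF \<nu>(1) D\<nu>])
  \<comment> \<open>The target measure of \<open>distr\<close> matters only through its sets, so
    \<open>\<nu>\<close> may stand in for \<open>borel_vec k\<close>.\<close>
  have P: "PiM {..<n} (\<lambda>_. ?\<nu>') = distr (PiM {..<n} (\<lambda>_. \<nu>)) (PiM {..<n} (\<lambda>_. \<nu>)) (compose {..<n} ?D)"
  proof -
    have "distr \<nu> \<nu> ?D = ?\<nu>'" by (rule distr_cong) (use \<nu>(2) in auto)
    moreover have "?D \<in> measurable \<nu> \<nu>" using D\<nu> measurable_cong_sets[OF refl \<nu>(2)] by blast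
    ultimately show ?thesis
      using distr_PiM_finite_prob_space'[of "{..<n}" "\<lambda>_. \<nu>" "\<lambda>_. \<nu>" ?D] \<nu>(1) by simp
  qed
  have C: "compose {..<n} ?D \<in> measurable (PiM {..<n} (\<lambda>_. \<nu>)) (PiM {..<n} (\<lambda>_. \<nu>))"
  proof -
    have "?D \<in> measurable \<nu> \<nu>" using D\<nu> measurable_cong_sets[OF refl \<nu>(2)] by blast
    then show ?thesis unfolding compose_def
      by (intro measurable_restrict measurable_compose[OF measurable_component_singleton])
  qed
  have "distr \<mu> (borel_vec k) ?D = distr (PiM {..<n} (\<lambda>_. \<nu>)) (borel_vec k) (?D \<circ> ?S)"
    unfolding \<mu> by (rule distr_distr[OF D measurable_vec_sum'[OF \<nu>(2)]])
  also have "?D \<circ> ?S = ?S \<circ> compose {..<n} ?D"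
    by (auto simp: fun_eq_iff compose_def sum_distrib_left)
  also have "distr (PiM {..<n} (\<lambda>_. \<nu>)) (borel_vec k) (?S \<circ> compose {..<n} ?D) =
      distr (PiM {..<n} (\<lambda>_. ?\<nu>')) (borel_vec k) ?S"
    unfolding P by (rule distr_distr[OF measurable_vec_sum'[OF \<nu>(2)] C, symmetric])
  finally have eq: "distr \<mu> (borel_vec k) ?D = distr (PiM {..<n} (\<lambda>_. ?\<nu>')) (borel_vec k) ?S" .
  show "\<exists>\<nu>. prob_space \<nu> \<and> sets \<nu> = sets (borel_vec k) \<and>
      distr \<mu> (borel_vec k) ?D = distr (PiM {..<n} (\<lambda>_. \<nu>)) (borel_vec k) ?S"
    by (intro exI[of _ ?\<nu>'] conjI \<nu>' eq) simp
qed

lemma infinitely_divisible_process_scale: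
  assumes V: "infinitely_divisible_process M T V"
    and X: "\<And>t. t \<in> T' \<Longrightarrow> s t \<in> T" "\<And>t \<omega>. t \<in> T' \<Longrightarrow> X t \<omega> = a t * V (s t) \<omega>"
  shows "infinitely_divisible_process M T' X"
  unfolding infinitely_divisible_process_def
proof (intro conjI allI impI)
  have Vm: "V t \<in> borel_measurable M" if "t \<in> T" for t
    using V that by (auto simp: infinitely_divisible_process_def process_def)
  show "process M T' X"
    unfolding process_def
  proof
    fix t assume t: "t \<in> T'"
    have "X t = (\<lambda>\<omega>. a t * V (s t) \<omega>)" using X(2)[OF t] by auto
    then show "X t \<in> borel_measurable M" using Vm[OF X(1)[OF t]] by simp
  qed
  fix k and t :: "nat \<Rightarrow> real" assume t: "\<forall>j<k. t j \<in> T'"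
  let ?D = "\<lambda>x. \<lambda>j\<in>{..<k}. a (t j) * x j"
  have "infinitely_divisible_law k (fin_dim_law M V k (\<lambda>j. s (t j)))"
    using V X(1) t by (simp add: infinitely_divisible_process_def)
  then have "infinitely_divisible_law k (distr (fin_dim_law M V k (\<lambda>j. s (t j))) (borel_vec k) ?D)"
    by (rule infinitely_divisible_law_scale)
  moreover have "distr (fin_dim_law M V k (\<lambda>j. s (t j))) (borel_vec k) ?D = fin_dim_law M X k t"
  proof -
    have "?D \<in> measurable (borel_vec k) (borel_vec k)"
      by measurable
    moreover have "(\<lambda>\<omega>. \<lambda>j\<in>{..<k}. V (s (t j)) \<omega>) \<in> measurable M (borel_vec k)"
      using Vm X(1) t by (intro measurable_restrict) auto
    ultimately have "distr (fin_dim_law M V k (\<lambda>j. s (t j))) (borel_vec k) ?D =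
        distr M (borel_vec k) (?D \<circ> (\<lambda>\<omega>. \<lambda>j\<in>{..<k}. V (s (t j)) \<omega>))"
      unfolding fin_dim_law_def by (rule distr_distr)
    also have "?D \<circ> (\<lambda>\<omega>. \<lambda>j\<in>{..<k}. V (s (t j)) \<omega>) = (\<lambda>\<omega>. \<lambda>j\<in>{..<k}. X (t j) \<omega>)"
      using X(2) t by (auto simp: fun_eq_iff)
    finally show ?thesis unfolding fin_dim_law_def .
  qed
  ultimately show "infinitely_divisible_law k (fin_dim_law M X k t)" by simp
qed

section \<open>The Lamperti-type transforms\<close>

context prob_space
begin

lemma independent_increments_cong:
  assumes "independent_increments M T X" "\<And>t. t \<in> T \<Longrightarrow> X t = Y t"
  shows "independent_increments M T Y"
  unfolding independent_increments_def
proof (intro allI impI, elim conjE)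
  fix n and t :: "nat \<Rightarrow> real"
  assume t: "\<forall>i\<le>n. t i \<in> T" "\<forall>i<n. t i < t (Suc i)"
  have "indep_vars (\<lambda>_. borel) (\<lambda>i \<omega>. X (t (Suc i)) \<omega> - X (t i) \<omega>) {..<n}"
    by (rule independent_increments_indep_vars[OF assms(1)]) (use t in auto)
  then show "indep_vars (\<lambda>_. borel) (\<lambda>i \<omega>. Y (t (Suc i)) \<omega> - Y (t i) \<omega>) {..<n}"
    by (rule indep_vars_cong[THEN iffD1, rotated 3]) (use t assms(2) in auto)
qed

text \<open>The set of paths that are not cadlag is null but possibly not measurable, so
  \<open>Y\<close> is put to 0 on a measurable null set \<open>N\<close> containing it. Off
  \<open>N\<close> the integral is a limit of Stieltjes sums, each of them measurable. This yields
  the existence of a driving process in (a).\<close>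

lemma path_integral_exp_version:
  assumes W: "process M UNIV W" and cadlag: "AE \<omega> in M. cadlag_on UNIV (\<lambda>t. W t \<omega>)"
  obtains Y where "process M UNIV Y"
    "AE \<omega> in M. \<forall>t. Y t \<omega> = path_integral (\<lambda>s. exp (a * s)) (\<lambda>s. W s \<omega>) 0 t"
proof -
  have [measurable]: "W t \<in> borel_measurable M" for t using W by (auto simp: process_def)
  obtain N where N: "{\<omega> \<in> space M. \<not> cadlag_on UNIV (\<lambda>t. W t \<omega>)} \<subseteq> N" "emeasure M N = 0" "N \<in> sets M"
    using cadlag by (rule AE_E)
  note [measurable] = N(3)
  define I where "I p q \<omega> = path_integral (\<lambda>s. exp (a * s)) (\<lambda>s. W s \<omega>) p q" for p q \<omega>
  define Y where "Y t \<omega> = (if \<omega> \<in> N then 0 else I 0 t \<omega>)" for t \<omega>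
  have meas: "(\<lambda>\<omega>. if \<omega> \<in> N then 0 else I p q \<omega>) \<in> borel_measurable M" if "p < q" for p q
  proof (rule borel_measurable_LIMSEQ_real)
    fix \<omega> assume \<omega>: "\<omega> \<in> space M"
    let ?S = "\<lambda>m. \<Sum>j<Suc m. exp (a * mesh p q m j) * (W (mesh p q m (Suc j)) \<omega> - W (mesh p q m j) \<omega>)"
    show "(\<lambda>m. if \<omega> \<in> N then 0 else ?S m) \<longlonglongrightarrow> (if \<omega> \<in> N then 0 else I p q \<omega>)"
    proof (cases "\<omega> \<in> N")
      case False
      then have c: "cadlag_on UNIV (\<lambda>t. W t \<omega>)" using N(1) \<omega> by auto
      have "?S \<longlonglongrightarrow> exp (a * q) * W q \<omega> - exp (a * p) * W p \<omega> - integral {p..q} (\<lambda>s. a * exp (a * s) * W s \<omega>)"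
        by (rule cadlag_stieltjes_sums[OF c has_real_derivative_exp_scaled continuous_on_exp_scaled that])
      also have "exp (a * q) * W q \<omega> - exp (a * p) * W p \<omega> - integral {p..q} (\<lambda>s. a * exp (a * s) * W s \<omega>) = I p q \<omega>"
        using signed_integral_diff[OF cadlag_exp_integrable[OF c], of p q a] that
        by (simp add: I_def path_integral_exp[OF c])
      finally show ?thesis using False by simp
    qed simp
  qed measurable
  have "process M UNIV Y"
    unfolding process_def
  proof
    fix t :: real
    consider "0 < t" | "t = 0" | "t < 0" by linarith
    then show "Y t \<in> borel_measurable M"
    proof cases
      case 1
      then show ?thesis unfolding Y_def using meas[of 0 t] by simp
    next
      case 2
      have "Y t = (\<lambda>_. 0)" by (auto simp: Y_def I_def 2 path_integral_def Let_def)
      then show ?thesis by simp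
    next
      case 3
      have "(\<lambda>\<omega>. - (if \<omega> \<in> N then 0 else I t 0 \<omega>)) \<in> borel_measurable M" using meas[OF 3] by simp
      moreover have "Y t = (\<lambda>\<omega>. - (if \<omega> \<in> N then 0 else I t 0 \<omega>))"
        by (rule ext) (use 3 in \<open>simp add: Y_def I_def path_integral_def Let_def\<close>)
      ultimately show ?thesis by simp
    qed
  qed
  moreover have "AE \<omega> in M. \<forall>t. Y t \<omega> = path_integral (\<lambda>s. exp (a * s)) (\<lambda>s. W s \<omega>) 0 t"
  proof (rule AE_I[OF _ N(2,3)])
    show "{\<omega> \<in> space M. \<not> (\<forall>t. Y t \<omega> = path_integral (\<lambda>s. exp (a * s)) (\<lambda>s. W s \<omega>) 0 t)} \<subseteq> N"
      by (auto simp: Y_def I_def)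
  qed
  ultimately show ?thesis by (rule that)
qed

text \<open>At positive times everything transfers through \<open>ln\<close>. Time 0 corresponds to
  minus infinity: the limit in probability there is stochastic continuity at 0, it exhibits
  increments starting at 0 as limits, and by the maximal inequality it yields right continuity of
  the paths at 0.\<close>

lemma additive_process_log_time:
  assumes U: "process M UNIV U" "independent_increments M UNIV U"
      "\<And>s. tendsto_in_prob M U (U s) (at s)" "AE \<omega> in M. cadlag_on UNIV (\<lambda>t. U t \<omega>)"
      "tendsto_in_prob M U (\<lambda>_. 0) at_bot"
    and X: "\<And>\<omega>. X 0 \<omega> = 0" "\<And>t \<omega>. t > 0 \<Longrightarrow> X t \<omega> = U (ln t) \<omega>"
  shows "additive_process M {0..} X"
proof -
  have Xeq: "X t = U (ln t)" if "t > 0" for t using X(2)[OF that] by auto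
  have X0: "X 0 = (\<lambda>_. 0)" using X(1) by auto
  have Xm: "X t \<in> borel_measurable M" if "t \<ge> 0" for t
    using U(1) that by (cases "t = 0") (auto simp: process_def Xeq X0)
  have prob0: "tendsto_in_prob M X (\<lambda>_. 0) (at_right 0)"
  proof (rule tendsto_in_prob_eventually_cong)
    show "tendsto_in_prob M (\<lambda>t. U (ln t)) (\<lambda>_. 0) (at_right 0)"
      by (rule tendsto_in_prob_compose[OF U(5) ln_at_0])
    show "\<forall>\<^sub>F t in at_right 0. U (ln t) = X t"
      unfolding eventually_at_right_field by (intro exI[of _ 1]) (auto simp: Xeq)
  qed
  have pos: "independent_increments M {0<..} X"
    by (rule independent_increments_cong[OF independent_increments_time_change[OF U(2), of "{0<..}" ln]])
       (auto simp: Xeq)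
  have indep: "independent_increments M {0..} X"
    unfolding independent_increments_def
  proof (intro allI impI, elim conjE)
    fix n and t :: "nat \<Rightarrow> real"
    assume t: "\<forall>i\<le>n. t i \<in> {0..}" "\<forall>i<n. t i < t (Suc i)"
    have tpos: "t i > 0" if "0 < i" "i \<le> n" for i
    proof (cases i)
      case (Suc j)
      then show ?thesis using t(1)[rule_format, of j] t(2)[rule_format, of j] that by simp
    qed (use that in simp)
    show "indep_vars (\<lambda>_. borel) (\<lambda>i \<omega>. X (t (Suc i)) \<omega> - X (t i) \<omega>) {..<n}"
    proof (cases "t 0 > 0")
      case True
      then have "t i > 0" if "i \<le> n" for i using tpos[of i] that by (cases "i = 0") simp_all
      then show ?thesis by (intro independent_increments_indep_vars[OF pos]) (use t(2) in simp_all)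
    next
      case False
      then have t0: "t 0 = 0" using t(1)[rule_format, of 0] by auto
      \<comment> \<open>The initial time 0 is replaced by a small positive time; the denominator
        \<open>m + 2\<close> keeps it strictly below \<open>t 1\<close> already for
        \<open>m = 0\<close>.\<close>
      define s where "s m i = (if i = 0 then t 1 * inverse (real (Suc (Suc m))) else t i)" for m and i :: nat
      show ?thesis
      proof (rule indep_vars_tendsto_in_prob)
        show "indep_vars (\<lambda>_. borel) (\<lambda>i \<omega>. X (s m (Suc i)) \<omega> - X (s m i) \<omega>) {..<n}" for m
        proof (cases "n = 0")
          case True
          then show ?thesis by (simp add: indep_vars_def indep_sets_def)
        next
          case False
          then have t1: "t 1 > 0" using tpos by auto
          then have "t 1 * inverse (real (Suc (Suc m))) < t 1 * 1"
            by (intro mult_strict_left_mono) (auto simp: field_simps)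
          then show ?thesis
            using t t1 tpos
            by (intro independent_increments_indep_vars[OF pos]) (auto simp: s_def)
        qed
        fix i assume i: "i \<in> {..<n}"
        show "(\<lambda>\<omega>. X (t (Suc i)) \<omega> - X (t i) \<omega>) \<in> borel_measurable M"
          using i t by (intro borel_measurable_diff Xm) auto
        show "tendsto_in_prob M (\<lambda>m \<omega>. X (s m (Suc i)) \<omega> - X (s m i) \<omega>) (\<lambda>\<omega>. X (t (Suc i)) \<omega> - X (t i) \<omega>) sequentially"
        proof (cases "i = 0")
          case False
          then show ?thesis by (simp add: s_def tendsto_in_prob_def)
        next
          case True
          then have t1: "t 1 > 0" using tpos i by auto
          have "(\<lambda>m. t 1 * inverse (real (Suc (Suc m)))) \<longlonglongrightarrow> t 1 * 0"
            using LIMSEQ_Suc[OF LIMSEQ_inverse_real_of_nat] by (intro tendsto_intros)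
          then have "filterlim (\<lambda>m. t 1 * inverse (real (Suc (Suc m)))) (at_right 0) sequentially"
            using t1 by (intro tendsto_imp_filterlim_at_right) auto
          from tendsto_in_prob_compose[OF prob0 this] show ?thesis
            unfolding True by (simp add: s_def tendsto_in_prob_def t0 X0)
        qed
      qed simp
    qed
  qed
  have stoch: "tendsto_in_prob M X (X t) (at t within {0..})" if "t \<ge> 0" for t
  proof (cases "t = 0")
    case True
    then show ?thesis using prob0 by (simp add: X0 at_within_Ici_at_right)
  next
    case False
    then have t: "t > 0" using that by simp
    have ev: "\<forall>\<^sub>F s in at t within {0..}. s > 0"
      using t by (intro order_tendstoD[of "\<lambda>s. s" t]) (auto intro: tendsto_ident_at)
    show ?thesis
    proof (rule tendsto_in_prob_eventually_cong)
      have "filterlim ln (at (ln t)) (at t within {0..})"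
        unfolding filterlim_at
      proof
        show "\<forall>\<^sub>F x in at t within {0..}. ln x \<in> UNIV \<and> ln x \<noteq> ln t"
          using ev eventually_neq_at_within[of t t "{0..}"] by eventually_elim (use t in auto)
        show "(ln \<longlongrightarrow> ln t) (at t within {0..})" using t by (intro tendsto_intros) auto
      qed
      from tendsto_in_prob_compose[OF U(3) this]
      show "tendsto_in_prob M (\<lambda>s. U (ln s)) (X t) (at t within {0..})" by (simp add: Xeq[OF t])
      show "\<forall>\<^sub>F s in at t within {0..}. U (ln s) = X s" using ev by eventually_elim (simp add: Xeq)
    qed
  qed
  have right: "((\<lambda>s. X s \<omega>) \<longlongrightarrow> X t \<omega>) (at_right t)" and left: "\<exists>l. ((\<lambda>s. X s \<omega>) \<longlongrightarrow> l) (at_left t)"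
    if \<omega>: "cadlag_on UNIV (\<lambda>t. U t \<omega>)" and t: "t > 0" for t \<omega>
  proof -
    have lim: "(ln \<longlongrightarrow> ln t) (at t within S)" for S using t by (intro tendsto_intros) auto
    have f: "filterlim ln (at_right (ln t)) (at_right t)"
      using lim t by (auto simp: filterlim_at eventually_at_filter)
    have "((\<lambda>s. U s \<omega>) \<longlongrightarrow> U (ln t) \<omega>) (at_right (ln t))"
      using \<omega> unfolding cadlag_on_UNIV_iff by blast
    from filterlim_compose[OF this f]
    have "((\<lambda>s. U (ln s) \<omega>) \<longlongrightarrow> U (ln t) \<omega>) (at_right t)" .
    moreover have "\<forall>\<^sub>F s in at_right t. U (ln s) \<omega> = X s \<omega>"
      unfolding eventually_at_right_field by (intro exI[of _ "t + 1"]) (use t in \<open>auto simp: X(2)\<close>)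
    ultimately show "((\<lambda>s. X s \<omega>) \<longlongrightarrow> X t \<omega>) (at_right t)"
      unfolding X(2)[OF t] by (rule Lim_transform_eventually)
    have ev: "\<forall>\<^sub>F s in at_left t. 0 < s \<and> s < t"
      unfolding eventually_at_left_field by (intro exI[of _ 0]) (use t in auto)
    have f: "filterlim ln (at_left (ln t)) (at_left t)"
      unfolding filterlim_at using lim ev by (auto elim!: eventually_mono)
    obtain l where "((\<lambda>s. U s \<omega>) \<longlongrightarrow> l) (at_left (ln t))"
      using \<omega> unfolding cadlag_on_UNIV_iff by blast
    from filterlim_compose[OF this f] have "((\<lambda>s. U (ln s) \<omega>) \<longlongrightarrow> l) (at_left t)" .
    moreover have "\<forall>\<^sub>F s in at_left t. U (ln s) \<omega> = X s \<omega>"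
      using ev by eventually_elim (simp add: X(2))
    ultimately show "\<exists>l. ((\<lambda>s. X s \<omega>) \<longlongrightarrow> l) (at_left t)"
      by (intro exI[of _ l]) (rule Lim_transform_eventually)
  qed
  have "AE \<omega> in M. ((\<lambda>s. X s \<omega>) \<longlongrightarrow> 0) (at_right 0)"
  proof (rule independent_increments_tendsto_0_AE[OF _ indep X(1) prob0])
    show "process M {0..} X" using Xm by (auto simp: process_def)
    show "AE \<omega> in M. \<forall>t>0. ((\<lambda>s. X s \<omega>) \<longlongrightarrow> X t \<omega>) (at_right t)"
      using U(4) by eventually_elim (use right in blast)
  qed
  with U(4) have "AE \<omega> in M. cadlag_on {0..} (\<lambda>t. X t \<omega>)"
  proof eventually_elim
    case (elim \<omega>)
    show ?case
      unfolding cadlag_on_def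
    proof (intro ballI conjI)
      fix t :: real assume "t \<in> {0..}"
      then have r: "{0..} \<inter> {t<..} = {t<..}" by auto
      show "((\<lambda>t. X t \<omega>) \<longlongrightarrow> X t \<omega>) (at t within {0..} \<inter> {t<..})"
        unfolding r using right[OF elim(1), of t] elim(2) \<open>t \<in> {0..}\<close> by (cases "t = 0") (auto simp: X0)
      show "\<exists>l. ((\<lambda>t. X t \<omega>) \<longlongrightarrow> l) (at t within {0..} \<inter> {..<t})"
      proof (cases "t = 0")
        case True
        then have "{0..} \<inter> {..<t} = {}" by auto
        then show ?thesis by simp
      next
        case False
        then have "t > 0" using \<open>t \<in> {0..}\<close> by simp
        from left[OF elim(1) this] obtain l where "((\<lambda>s. X s \<omega>) \<longlongrightarrow> l) (at_left t)" by blast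
        then have "((\<lambda>s. X s \<omega>) \<longlongrightarrow> l) (at t within {0..} \<inter> {..<t})"
          by (rule tendsto_within_subset) auto
        then show ?thesis by blast
      qed
    qed
  qed
  then show ?thesis
    unfolding additive_process_def using Xm indep stoch by (auto simp: process_def X0)
qed

lemma additive_process_exp_time:
  assumes X: "additive_process M {0..} X"
  shows "process M UNIV (\<lambda>t. X (exp t))" "independent_increments M UNIV (\<lambda>t. X (exp t))"
    "tendsto_in_prob M (\<lambda>t. X (exp t)) (X (exp s)) (at s)"
    "AE \<omega> in M. cadlag_on UNIV (\<lambda>t. X (exp t) \<omega>)"
proof -
  show "process M UNIV (\<lambda>t. X (exp t))"
    using X by (auto simp: additive_process_def process_def)
  show "independent_increments M UNIV (\<lambda>t. X (exp t))"
    by (rule independent_increments_time_change[of M "{0..}"]) (use X in \<open>auto simp: additive_process_def\<close>)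
  have f: "filterlim exp (at (exp s) within {0..}) (at s)"
    unfolding filterlim_at
  proof
    show "\<forall>\<^sub>F x in at s. exp x \<in> {0..} \<and> exp x \<noteq> exp s"
      using eventually_neq_at_within[of s s UNIV] by eventually_elim auto
    show "(exp \<longlongrightarrow> exp s) (at s)" by (intro tendsto_intros)
  qed
  have "tendsto_in_prob M X (X (exp s)) (at (exp s) within {0..})"
    using X by (simp add: additive_process_def)
  from tendsto_in_prob_compose[OF this f]
  show "tendsto_in_prob M (\<lambda>t. X (exp t)) (X (exp s)) (at s)" .
  show "AE \<omega> in M. cadlag_on UNIV (\<lambda>t. X (exp t) \<omega>)"
  proof -
    have "AE \<omega> in M. cadlag_on {0..} (\<lambda>t. X t \<omega>)" using X by (simp add: additive_process_def)
    then show ?thesis by eventually_elim (rule cadlag_on_exp)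
  qed
qed

end

section \<open>Dilative versus translative stability\<close>

text \<open>A shift by \<open>T\<close> in logarithmic time is a dilation by \<open>exp T\<close>.
  The factor \<open>exp T powr (\<alpha> - \<delta> / 2)\<close> from dilative stability cancels the
  change of the weight \<open>a\<close> from \<open>t j\<close> to \<open>t j + T\<close>, and only
  \<open>exp T powr \<delta>\<close> remains.\<close>

lemma translatively_stable_lamperti:
  assumes X: "dilatively_stable M \<alpha> \<delta> X"
  shows "translatively_stable M \<delta> (lamperti \<alpha> \<delta> X)"
  unfolding translatively_stable_def
proof (intro conjI allI ballI)
  define a where "a t = exp (- (\<alpha> - \<delta> / 2) * t)" for t
  have V: "lamperti \<alpha> \<delta> X t \<omega> = a t * X (exp t) \<omega>" for t \<omega>
    by (simp add: lamperti_def a_def)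
  have id: "infinitely_divisible_process M {0..} X" using X by (simp add: dilatively_stable_def)
  show "infinitely_divisible_process M UNIV (lamperti \<alpha> \<delta> X)"
    by (rule infinitely_divisible_process_scale[OF id, where s = exp and a = a]) (auto simp: V)
  fix T k and t \<theta> :: "nat \<Rightarrow> real" assume \<theta>: "\<theta> \<in> rvec k"
  have scale: "levy_exponent M (lamperti \<alpha> \<delta> X) k s \<theta> =
      levy_exponent M X k (\<lambda>j. exp (s j)) (\<lambda>j\<in>{..<k}. a (s j) * \<theta> j)" for s
    by (rule levy_exponent_scale[OF id]) (use \<theta> in \<open>auto simp: V\<close>)
  have "levy_exponent M (lamperti \<alpha> \<delta> X) k (\<lambda>j. t j + T) \<theta> =
      levy_exponent M X k (\<lambda>j. exp T * exp (t j)) (\<lambda>j\<in>{..<k}. a (t j + T) * \<theta> j)"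
    unfolding scale by (simp add: exp_add mult.commute)
  also have "\<dots> = complex_of_real (exp T powr \<delta>) * levy_exponent M X k (\<lambda>j. exp (t j))
      (\<lambda>j\<in>{..<k}. exp T powr (\<alpha> - \<delta> / 2) * (\<lambda>j\<in>{..<k}. a (t j + T) * \<theta> j) j)"
    using X \<theta> unfolding dilatively_stable_def by auto
  also have "(\<lambda>j\<in>{..<k}. exp T powr (\<alpha> - \<delta> / 2) * (\<lambda>j\<in>{..<k}. a (t j + T) * \<theta> j) j) =
      (\<lambda>j\<in>{..<k}. a (t j) * \<theta> j)"
  proof -
    have "exp T powr (\<alpha> - \<delta> / 2) * a (t j + T) = a (t j)" for j
      by (simp add: a_def powr_def exp_add[symmetric] algebra_simps)
    then show ?thesis by (intro restrict_ext) (simp add: mult.assoc[symmetric])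
  qed
  also have "exp T powr \<delta> = exp (\<delta> * T)" by (simp add: powr_def)
  finally show "levy_exponent M (lamperti \<alpha> \<delta> X) k (\<lambda>j. t j + T) \<theta> =
      complex_of_real (exp (\<delta> * T)) * levy_exponent M (lamperti \<alpha> \<delta> X) k t \<theta>"
    by (simp only: scale)
qed

text \<open>The same cancellation with shift \<open>ln T\<close>; the additional point is that times
  \<open>t j = 0\<close> have no logarithm and are absorbed by a vanishing weight.\<close>

lemma dilatively_stable_inverse_lamperti:
  assumes V: "translatively_stable M \<delta> V"
  shows "dilatively_stable M \<alpha> \<delta> (inverse_lamperti \<alpha> \<delta> V)"
  unfolding dilatively_stable_def
proof (intro conjI allI ballI impI)
  define c where "c = \<alpha> - \<delta> / 2"
  \<comment> \<open>At \<open>t = 0\<close> the right-hand side is 0 as well, since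
    \<open>0 powr c = 0\<close>; one formula covers all times.\<close>
  have X: "inverse_lamperti \<alpha> \<delta> V t \<omega> = t powr c * V (ln t) \<omega>" for t \<omega>
    by (simp add: inverse_lamperti_def c_def)
  have id: "infinitely_divisible_process M UNIV V" using V by (simp add: translatively_stable_def)
  show "infinitely_divisible_process M {0..} (inverse_lamperti \<alpha> \<delta> V)"
    by (rule infinitely_divisible_process_scale[OF id, where s = ln and a = "\<lambda>t. t powr c"]) (auto simp: X)
  fix T :: real and k and t \<theta> :: "nat \<Rightarrow> real"
  assume T: "T > 0" and \<theta>: "\<theta> \<in> rvec k" and t: "\<forall>j<k. t j \<ge> 0"
  have "levy_exponent M (inverse_lamperti \<alpha> \<delta> V) k (\<lambda>j. T * t j) \<theta> =
      levy_exponent M V k (\<lambda>j. ln (t j) + ln T) (\<lambda>j\<in>{..<k}. (T * t j) powr c * \<theta> j)"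
  proof (rule levy_exponent_scale[OF id])
    fix j \<omega> assume "j < k"
    then have "t j \<ge> 0" using t by simp
    \<comment> \<open>For \<open>t j = 0\<close> both sides vanish through the weight, whatever the
      time at which \<open>V\<close> is read.\<close>
    then show "inverse_lamperti \<alpha> \<delta> V (T * t j) \<omega> = (T * t j) powr c * V (ln (t j) + ln T) \<omega>"
      using T by (cases "t j = 0") (simp_all add: X ln_mult add.commute)
  qed (use \<theta> in auto)
  also have "\<dots> = complex_of_real (exp (\<delta> * ln T)) *
      levy_exponent M V k (\<lambda>j. ln (t j)) (\<lambda>j\<in>{..<k}. (T * t j) powr c * \<theta> j)"
    using V unfolding translatively_stable_def by auto
  also have "exp (\<delta> * ln T) = T powr \<delta>" using T by (simp add: powr_def)
  also have "(\<lambda>j\<in>{..<k}. (T * t j) powr c * \<theta> j) =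
      (\<lambda>j\<in>{..<k}. t j powr c * (\<lambda>j\<in>{..<k}. T powr c * \<theta> j) j)"
    using T t by (intro restrict_ext) (simp add: powr_mult)
  also have "levy_exponent M V k (\<lambda>j. ln (t j)) \<dots> =
      levy_exponent M (inverse_lamperti \<alpha> \<delta> V) k t (\<lambda>j\<in>{..<k}. T powr c * \<theta> j)"
    by (rule levy_exponent_scale[OF id, symmetric]) (simp_all add: X PiE_def extensional_def)
  finally show "levy_exponent M (inverse_lamperti \<alpha> \<delta> V) k (\<lambda>j. T * t j) \<theta> =
      complex_of_real (T powr \<delta>) *
      levy_exponent M (inverse_lamperti \<alpha> \<delta> V) k t (\<lambda>j\<in>{..<k}. T powr (\<alpha> - \<delta> / 2) * \<theta> j)"
    by (simp only: c_def)
qed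

section \<open>The Ornstein-Uhlenbeck equation in both directions\<close>

text \<open>With \<open>W s = X (exp s)\<close> the integral against \<open>Y\<close> in the OU
  equation is \<open>W t - W 0\<close>. Since \<open>W 0\<close> is also the value of the transform
  at time 0, the right-hand side collapses to \<open>exp (c * t) * W t\<close>.\<close>

lemma (in prob_space) lamperti_wide_sense_OU:
  assumes X: "additive_process M {0..} X"
    and Y: "process_given_by M Y
           (\<lambda>t \<omega>. path_integral (\<lambda>u. u powr (- \<alpha> + \<delta> / 2)) (\<lambda>u. X u \<omega>) 1 (exp t))"
  shows "wide_sense_OU M (\<delta> / 2 - \<alpha>) Y (lamperti \<alpha> \<delta> X)"
proof -
  define c where "c = - \<alpha> + \<delta> / 2"
  note W = additive_process_exp_time[OF X]
  have Yp: "process M UNIV Y" using Y by (simp add: process_given_by_def)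
  have "AE \<omega> in M. \<forall>t. Y t \<omega> = path_integral (\<lambda>u. u powr c) (\<lambda>u. X u \<omega>) 1 (exp t)"
    "AE \<omega> in M. cadlag_on {0..} (\<lambda>t. X t \<omega>)"
    using X Y by (simp_all add: process_given_by_def additive_process_def c_def)
  then have eq: "AE \<omega> in M. \<forall>t. Y t \<omega> = 0 + path_integral (\<lambda>s. exp (c * s)) (\<lambda>s. X (exp s) \<omega>) 0 t"
    by eventually_elim (simp add: path_integral_powr_exp)
  have "AE \<omega> in M. Y 0 \<omega> = 0"
    using eq by eventually_elim (simp add: path_integral_def Let_def)
  then have "additive_process M UNIV Y"
    unfolding additive_process_def
    using Yp independent_increments_path_integral[OF W(1,2,4) Yp eq]
      stochastic_continuity_path_integral[OF W(1,3,4) Yp eq]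
      cadlag_path_integral_process[OF W(4) eq] by simp
  moreover have "process M UNIV (lamperti \<alpha> \<delta> X)"
    unfolding process_def lamperti_def[abs_def] using W(1) by (auto simp: process_def intro!: borel_measurable_times)
  moreover have "AE \<omega> in M. \<forall>t. lamperti \<alpha> \<delta> X t \<omega> = exp ((\<delta> / 2 - \<alpha>) * t) *
      (lamperti \<alpha> \<delta> X 0 \<omega> + path_integral (\<lambda>s. exp (- (\<delta> / 2 - \<alpha>) * s)) (\<lambda>s. Y s \<omega>) 0 t)"
    using eq W(4)
  proof eventually_elim
    case (elim \<omega>)
    have c: "\<delta> / 2 - \<alpha> = c" by (simp add: c_def)
    \<comment> \<open>The inversion lemma is used with \<open>a = - c\<close>, hence the double
      sign.\<close>
    have "(\<lambda>s. Y s \<omega>) = path_integral (\<lambda>s. exp (- (- c) * s)) (\<lambda>s. X (exp s) \<omega>) 0"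
      using elim(1) by auto
    then show ?case
      using path_integral_exp_inverse[OF elim(2), of "- c"] unfolding c
      by (simp add: lamperti_def c_def algebra_simps)
  qed
  ultimately show ?thesis by (simp add: wide_sense_OU_def)
qed

text \<open>Multiplying the OU equation by \<open>exp (c * t)\<close> cancels its exponential
  factor, and \<open>V 0\<close> takes the place of the free summand \<open>K\<close>. The
  hypothesis at minus infinity is then the condition on \<open>U\<close> under which time 0 can be
  added.\<close>

lemma (in prob_space) additive_inverse_lamperti:
  assumes OU: "wide_sense_OU M (\<delta> / 2 - \<alpha>) Y V"
    and lim: "tendsto_in_prob M (\<lambda>t \<omega>. exp ((\<alpha> - \<delta> / 2) * t) * V t \<omega>) (\<lambda>_. 0) at_bot"
  shows "additive_process M {0..} (inverse_lamperti \<alpha> \<delta> V)"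
proof -
  define c where "c = \<alpha> - \<delta> / 2"
  define U where "U t \<omega> = exp (c * t) * V t \<omega>" for t \<omega>
  have Y: "process M UNIV Y" "independent_increments M UNIV Y"
    "tendsto_in_prob M Y (Y s) (at s)" "AE \<omega> in M. cadlag_on UNIV (\<lambda>t. Y t \<omega>)" for s
    using OU by (auto simp: wide_sense_OU_def additive_process_def)
  have U: "process M UNIV U"
    using OU by (auto simp: wide_sense_OU_def process_def U_def[abs_def] intro!: borel_measurable_times)
  have "AE \<omega> in M. \<forall>t. V t \<omega> = exp ((\<delta> / 2 - \<alpha>) * t) *
      (V 0 \<omega> + path_integral (\<lambda>s. exp (- (\<delta> / 2 - \<alpha>) * s)) (\<lambda>s. Y s \<omega>) 0 t)"
    using OU by (simp add: wide_sense_OU_def)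
  then have eq: "AE \<omega> in M. \<forall>t. U t \<omega> = V 0 \<omega> + path_integral (\<lambda>s. exp (c * s)) (\<lambda>s. Y s \<omega>) 0 t"
  proof eventually_elim
    case (elim \<omega>)
    have "- (\<delta> / 2 - \<alpha>) = c" by (simp add: c_def)
    moreover have "exp (c * t) * exp ((\<delta> / 2 - \<alpha>) * t) = 1" for t
      by (simp add: c_def exp_add[symmetric] algebra_simps)
    ultimately show ?case
      using elim unfolding U_def by (metis mult.assoc mult_1)
  qed
  show ?thesis
  proof (rule additive_process_log_time[OF U independent_increments_path_integral[OF Y(1,2,4) U eq]
        stochastic_continuity_path_integral[OF Y(1,3,4) U eq] cadlag_path_integral_process[OF Y(4) eq]])
    show "tendsto_in_prob M U (\<lambda>_. 0) at_bot" using lim by (simp add: U_def[abs_def] c_def)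
    show "inverse_lamperti \<alpha> \<delta> V 0 \<omega> = 0" for \<omega> by (simp add: inverse_lamperti_def)
    show "inverse_lamperti \<alpha> \<delta> V t \<omega> = U (ln t) \<omega>" if "t > 0" for t \<omega>
      using that by (simp add: inverse_lamperti_def U_def powr_def c_def)
  qed
qed

theorem proposition3p6:
  fixes M :: "'a measure" and \<alpha> \<delta> :: real
  assumes "prob_space M"
  shows
    "(\<forall>X. additive_process M {0..} X \<and> dilatively_stable M \<alpha> \<delta> X \<longrightarrow>
        translatively_stable M \<delta> (lamperti \<alpha> \<delta> X) \<and>
        (\<exists>Y. process_given_by M Y
           (\<lambda>t \<omega>. path_integral (\<lambda>u. u powr (- \<alpha> + \<delta> / 2)) (\<lambda>u. X u \<omega>) 1 (exp t))) \<and>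
        (\<forall>Y. process_given_by M Y
           (\<lambda>t \<omega>. path_integral (\<lambda>u. u powr (- \<alpha> + \<delta> / 2)) (\<lambda>u. X u \<omega>) 1 (exp t)) \<longrightarrow>
           wide_sense_OU M (\<delta> / 2 - \<alpha>) Y (lamperti \<alpha> \<delta> X)))
     \<and>
     (\<forall>V L. translatively_stable M \<delta> V \<and>
        two_sided_levy_process M L \<and>
        wide_sense_OU M (\<delta> / 2 - \<alpha>) (\<lambda>t. L (time_change \<delta> t)) V \<and>
        tendsto_in_prob M (\<lambda>t \<omega>. exp ((\<alpha> - \<delta> / 2) * t) * V t \<omega>) (\<lambda>_. 0) at_bot \<longrightarrow>
        additive_process M {0..} (inverse_lamperti \<alpha> \<delta> V) \<and>
        dilatively_stable M \<alpha> \<delta> (inverse_lamperti \<alpha> \<delta> V))"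
proof (intro conjI allI impI; elim conjE)
  interpret prob_space M by fact
  fix X assume X: "additive_process M {0..} X" "dilatively_stable M \<alpha> \<delta> X"
  show "translatively_stable M \<delta> (lamperti \<alpha> \<delta> X)"
    by (rule translatively_stable_lamperti[OF X(2)])
  show "\<exists>Y. process_given_by M Y
      (\<lambda>t \<omega>. path_integral (\<lambda>u. u powr (- \<alpha> + \<delta> / 2)) (\<lambda>u. X u \<omega>) 1 (exp t))"
  proof -
    \<comment> \<open>The process is built in logarithmic time, where Stieltjes sums give
      measurability, and carried back by the substitution.\<close>
    obtain Y where Y: "process M UNIV Y" "AE \<omega> in M. \<forall>t. Y t \<omega> =
        path_integral (\<lambda>s. exp ((- \<alpha> + \<delta> / 2) * s)) (\<lambda>s. X (exp s) \<omega>) 0 t"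
      using additive_process_exp_time(1,4)[OF X(1)] by (rule path_integral_exp_version)
    have "AE \<omega> in M. cadlag_on {0..} (\<lambda>t. X t \<omega>)" using X(1) by (simp add: additive_process_def)
    with Y(2) have "AE \<omega> in M. \<forall>t. Y t \<omega> =
        path_integral (\<lambda>u. u powr (- \<alpha> + \<delta> / 2)) (\<lambda>u. X u \<omega>) 1 (exp t)"
      by eventually_elim (simp add: path_integral_powr_exp)
    with Y(1) show ?thesis by (auto simp: process_given_by_def)
  qed
  fix Y assume "process_given_by M Y
      (\<lambda>t \<omega>. path_integral (\<lambda>u. u powr (- \<alpha> + \<delta> / 2)) (\<lambda>u. X u \<omega>) 1 (exp t))"
  then show "wide_sense_OU M (\<delta> / 2 - \<alpha>) Y (lamperti \<alpha> \<delta> X)"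
    by (rule lamperti_wide_sense_OU[OF X(1)])
next
  interpret prob_space M by fact
  fix V L assume V: "translatively_stable M \<delta> V"
    and OU: "wide_sense_OU M (\<delta> / 2 - \<alpha>) (\<lambda>t. L (time_change \<delta> t)) V"
    and lim: "tendsto_in_prob M (\<lambda>t \<omega>. exp ((\<alpha> - \<delta> / 2) * t) * V t \<omega>) (\<lambda>_. 0) at_bot"
  show "additive_process M {0..} (inverse_lamperti \<alpha> \<delta> V)"
    by (rule additive_inverse_lamperti[OF OU lim])
  show "dilatively_stable M \<alpha> \<delta> (inverse_lamperti \<alpha> \<delta> V)"
    by (rule dilatively_stable_inverse_lamperti[OF V])
qed

end
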